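(* Let $c,d$ be small categories (polynomial comonoids), let $m$ be a monad on $c$ in $\mathbb{C}\mathbf{at}^\sharp$, let $p$ be a $(d,c)$-bicomodule, and write $L=\begin{bmatrix}p\triangleleft_c m\\ p\end{bmatrix}$. For an $m$-algebra $\psi\colon m(X)\to X$ in $c\text{-}\mathbf{Set}$, let $\widetilde N_{m,p}X$ be the presheaf on $\Theta_m^p$ obtained from the left $L$-comodule structure on the $d$-copresheaf $p\triangleleft_c X$ given by the composite $$p\triangleleft_c X\xrightarrow{\;u\,\triangleleft_c X\;}L\triangleleft_d p\triangleleft_c m\triangleleft_c X\xrightarrow{\;\cdots\triangleleft_c\psi\;}L\triangleleft_d p\triangleleft_c X .$$ (i) If $d=c$, $m$ is a familial monad on $c\text{-}\mathbf{Set}$ and $p=m$, then this assignment of a presheaf on $\Theta_m=\Theta_m^m$ to an $m$-algebra agrees with Weber's nerve $N_m$. (ii) For a general bicomodule $p$, this functor agrees with the generalized nerve functor $m\text{-}\mathbf{Alg}\to(\Theta_m^p)^{\mathrm{op}}\text{-}\mathbf{Set}$ given by restricting representables along the inclusion $\Theta^p_m\to m\text{-}\mathbf{Alg}$, i.e. $X\mapsto\bigl(I\mapsto\mathrm{Hom}_{m\text{-}\mathbf{Alg}}(m(p[I]),X)\bigr)$, with morphisms of $\Theta_m^p$ acting by precomposition.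
   Context: **Polynomials, comonoids, bicomodules.** A polynomial is a functor $p=\sum_{I\in p(1)}y^{p[I]}\colon\mathbf{Set}\to\mathbf{Set}$ (a coproduct of representables; $p(1)$ and all $p[I]$ are sets); morphisms are natural transformations. $\mathbf{Poly}$ is monoidal under composition $\triangleleft$ with unit $y$. Comonoids $(c,\epsilon,\delta)$ in $\mathbf{Poly}$ correspond to small categories: objects are the elements of $c(1)$, $c[C]$ is the set of morphisms with source $C$, $\epsilon$ encodes identities and $\delta$ encodes codomains and composition. A $(c,d)$-bicomodule is a polynomial $p$ with compatible left $c$- and right $d$-coactions $c\triangleleft p\leftarrow p\to p\triangleleft d$. Bicomodules compose by $p\triangleleft_d q=\mathrm{eq}(p\triangleleft q\rightrightarrows p\triangleleft d\triangleleft q)$, with identities $c$. $\mathbb{C}\mathbf{at}^\sharp$ is the double category of comonoids, comonoid homomorphisms (cofunctors) and bicomodules. **Familial functors.** $c\text{-}\mathbf{Set}$ is the category of functors $c\to\mathbf{Set}$ (copresheaves). A $(c,d)$-bicomodule $p$ amounts to a familial functor $p\colon d\text{-}\mathbf{Set}\to c\text{-}\mathbf{Set}$, $p(X)_C\cong\sum_{I\in p_C(1)}\mathrm{Hom}_{d\text{-}\mathbf{Set}}(p[I],X)$, with carrier $\sum_{C\in c(1)}\sum_{I\in p_C(1)}y^{p[I]}$, each $p[I]$ being a $d$-copresheaf. Bicomodule morphisms correspond to natural transformations and $\triangleleft_d$ to composition of functors. With $0$ the empty category, $(c,0)$-bicomodules are the same as $c$-copresheaves, and $p\triangleleft_d X=p(X)$.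 **Monads and comonads.** A monad (resp. comonad) on $c$ in $\mathbb{C}\mathbf{at}^\sharp$ is a monoid (resp. comonoid) in $(c,c)$-bicomodules under $\triangleleft_c$; a monad $m$ on $c$ is thus a monad $(m,\eta,\mu)$ on $c\text{-}\mathbf{Set}$ with familial underlying functor, and $m\text{-}\mathbf{Alg}$ is its category of algebras. A familial monad is such a monad which is moreover cartesian. Given a comonad $e$ on $d$, its carrier polynomial is a comonoid in $\mathbf{Poly}$, hence a small category, with comultiplication $e\to e\triangleleft_d e\to e\triangleleft e$ and counit $e\to d\to y$. A left $e$-comodule structure $Z\to e\triangleleft_d Z$ on a $d$-copresheaf $Z$ (a $(d,0)$-bicomodule) yields the structure of an $(e,0)$-bicomodule with the same carrier, via $Z\to e\triangleleft_d Z\to e\triangleleft Z$; that is, a copresheaf on the category $e$ with the same set of elements as $Z$. **Right coclosure.** For a $(d,e)$-bicomodule $q$, $-\triangleleft_d q$ from $(c,d)$-bicomodules to $(c,e)$-bicomodules has a left adjoint $p\mapsto\begin{bmatrix}q\\ p\end{bmatrix}$, with carrier $\sum_{C\in c(1)}\sum_{I\in p_C(1)}y^{q\triangleleft_e p[I]}$. For $p$ a $(d,c)$-bicomodule and $L=\begin{bmatrix}p\triangleleft_c m\\ p\end{bmatrix}$, the unit of the adjunction is $u\colon p\to L\triangleleft_d p\triangleleft_c m$. $L$ is a comonad on $d$: its counit is adjoint to $p\triangleleft_c\eta\colon p\to p\triangleleft_c m$ and its comultiplication is adjoint to $(L\triangleleft_d L\triangleleft_d p\triangleleft_c\mu)\circ(L\triangleleft_d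 u\triangleleft_c m)\circ u$. The composite in the statement is a left $L$-comodule structure on $p\triangleleft_c X$. **Theory categories and nerves.** $\Theta_m^p$ is the full subcategory of the Kleisli category of $m$ spanned by the copresheaves $p[I]$, with objects indexed by $I\in p(1)$; equivalently, the full subcategory of $m\text{-}\mathbf{Alg}$ spanned by the free algebras $m(p[I])$. The category corresponding to the carrier comonoid of $L$ is $(\Theta_m^p)^{\mathrm{op}}$: its objects are the elements $I\in p(1)$ and its morphisms out of $I$ are the elements of $p\triangleleft_c m\triangleleft_c p[I]\cong\sum_{J\in p(1)}\mathrm{Hom}_{c\text{-}\mathbf{Set}}(p[J],m(p[I]))$. Hence copresheaves on $L$ are presheaves on $\Theta_m^p$. For $m$ a familial monad, Weber's theory category is $\Theta_m=\Theta_m^m$, and Weber's nerve of an $m$-algebra $A$ is the functor $N_mA\colon\Theta_m^{\mathrm{op}}\to\mathbf{Set}$, $M\mapsto\mathrm{Hom}_{m\text{-}\mathbf{Alg}}(m(m[M]),A)\cong\mathrm{Hom}_{c\text{-}\mathbf{Set}}(m[M],A)$, with morphisms acting by precomposition. *)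

theory Defs
  imports "HOL-Library.FuncSet"
begin

section \<open>Small categories and copresheaves\<close>

record ('o, 'f) cat =
  Obj :: "'o set"
  Arr :: "'f set"
  Dom :: "'f \<Rightarrow> 'o"
  Cod :: "'f \<Rightarrow> 'o"
  Id :: "'o \<Rightarrow> 'f"
  Comp :: "'f \<Rightarrow> 'f \<Rightarrow> 'f"   \<comment> \<open>\<open>Comp c g f\<close> is \<open>g \<circ> f\<close>\<close>

definition small_category :: "('o, 'f) cat \<Rightarrow> bool" where
  "small_category c \<longleftrightarrow>
    (\<forall>f\<in>Arr c. Dom c f \<in> Obj c \<and> Cod c f \<in> Obj c) \<and>
    (\<forall>C\<in>Obj c. Id c C \<in> Arr c \<and> Dom c (Id c C) = C \<and> Cod c (Id c C) = C) \<and>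
    (\<forall>f\<in>Arr c. \<forall>g\<in>Arr c. Dom c g = Cod c f \<longrightarrow>
      Comp c g f \<in> Arr c \<and> Dom c (Comp c g f) = Dom c f \<and> Cod c (Comp c g f) = Cod c g) \<and>
    (\<forall>f\<in>Arr c. Comp c f (Id c (Dom c f)) = f \<and> Comp c (Id c (Cod c f)) f = f) \<and>
    (\<forall>f\<in>Arr c. \<forall>g\<in>Arr c. \<forall>h\<in>Arr c. Dom c g = Cod c f \<and> Dom c h = Cod c g \<longrightarrow>
      Comp c h (Comp c g f) = Comp c (Comp c h g) f)"

definition opposite :: "('o, 'f) cat \<Rightarrow> ('o, 'f) cat" where
  "opposite c = \<lparr>Obj = Obj c, Arr = Arr c, Dom = Cod c, Cod = Dom c, Id = Id c,
     Comp = (\<lambda>g f. Comp c f g)\<rparr>"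

text \<open>A functor \<open>X: c \<rightarrow> Set\<close> is given by its set of elements (the carrier of the corresponding
  \<open>(c,0)\<close>-bicomodule): \<open>X\<^sub>C\<close> is the fibre of \<open>anchor X\<close> over \<open>C\<close>, and an arrow \<open>f: C \<rightarrow> C'\<close>
  acts by \<open>act X f: X\<^sub>C \<rightarrow> X\<^sub>C\<^sub>'\<close>.\<close>

record ('o, 'f, 'x) copresheaf =
  Elts :: "'x set"
  anchor :: "'x \<Rightarrow> 'o"
  act :: "'f \<Rightarrow> 'x \<Rightarrow> 'x"

definition copresheaf :: "('o, 'f) cat \<Rightarrow> ('o, 'f, 'x) copresheaf \<Rightarrow> bool" where
  "copresheaf c X \<longleftrightarrow>
    (\<forall>x\<in>Elts X. anchor X x \<in> Obj c) \<and>
    (\<forall>x\<in>Elts X. \<forall>f\<in>Arr c. Dom c f = anchor X x \<longrightarrow>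
      act X f x \<in> Elts X \<and> anchor X (act X f x) = Cod c f) \<and>
    (\<forall>x\<in>Elts X. act X (Id c (anchor X x)) x = x) \<and>
    (\<forall>x\<in>Elts X. \<forall>f\<in>Arr c. \<forall>g\<in>Arr c. Dom c f = anchor X x \<and> Dom c g = Cod c f \<longrightarrow>
      act X (Comp c g f) x = act X g (act X f x))"

definition Hom :: "('o, 'f) cat \<Rightarrow> ('o, 'f, 'x) copresheaf \<Rightarrow> ('o, 'f, 'y) copresheaf \<Rightarrow> ('x \<Rightarrow> 'y) set"
  where "Hom c X Y = {h \<in> Elts X \<rightarrow>\<^sub>E Elts Y.
    (\<forall>x\<in>Elts X. anchor Y (h x) = anchor X x) \<and>
    (\<forall>x\<in>Elts X. \<forall>f\<in>Arr c. Dom c f = anchor X x \<longrightarrow> h (act X f x) = act Y f (h x))}"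

abbreviation idmap :: "('o, 'f, 'x) copresheaf \<Rightarrow> 'x \<Rightarrow> 'x" where
  "idmap X \<equiv> (\<lambda>x\<in>Elts X. x)"

section \<open>Bicomodules as familial functors\<close>

text \<open>A \<open>(c,d)\<close>-bicomodule \<open>p\<close>, with its coactions written out. The carrier has positions
  \<open>p(1) = Elts (pos p)\<close> and directions \<open>p[I] = Elts (dir p I)\<close>. The left coaction \<open>p \<rightarrow> c \<triangleleft> p\<close> sends
  \<open>I\<close> to the object \<open>C = anchor (pos p) I\<close> and the positions \<open>f\<cdot>I = act (pos p) f I\<close> for
  \<open>f: C \<rightarrow> C'\<close>, and on directions it consists of the maps \<open>dirmap p f I: p[f\<cdot>I] \<rightarrow> p[I]\<close>. The right
  coaction \<open>p \<rightarrow> p \<triangleleft> d\<close> is the structure of a \<open>d\<close>-copresheaf on each \<open>p[I]\<close>.\<close>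

record ('o, 'f, 'e, 'g, 'i, 'a) bicomodule =
  pos :: "('o, 'f, 'i) copresheaf"
  dir :: "'i \<Rightarrow> ('e, 'g, 'a) copresheaf"
  dirmap :: "'f \<Rightarrow> 'i \<Rightarrow> 'a \<Rightarrow> 'a"

definition bicomodule ::
    "('o, 'f) cat \<Rightarrow> ('e, 'g) cat \<Rightarrow> ('o, 'f, 'e, 'g, 'i, 'a) bicomodule \<Rightarrow> bool" where
  "bicomodule c d p \<longleftrightarrow>
    copresheaf c (pos p) \<and>
    (\<forall>I\<in>Elts (pos p). copresheaf d (dir p I)) \<and>
    (\<forall>I\<in>Elts (pos p). \<forall>f\<in>Arr c. Dom c f = anchor (pos p) I \<longrightarrow>
      dirmap p f I \<in> Hom d (dir p (act (pos p) f I)) (dir p I)) \<and>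
    (\<forall>I\<in>Elts (pos p). dirmap p (Id c (anchor (pos p) I)) I = idmap (dir p I)) \<and>
    (\<forall>I\<in>Elts (pos p). \<forall>f\<in>Arr c. \<forall>g\<in>Arr c. Dom c f = anchor (pos p) I \<and> Dom c g = Cod c f \<longrightarrow>
      dirmap p (Comp c g f) I =
        compose (Elts (dir p (act (pos p) (Comp c g f) I)))
          (dirmap p f I) (dirmap p g (act (pos p) f I)))"

text \<open>The familial functor \<open>d-Set \<rightarrow> c-Set\<close> on objects, with
  \<open>p(X)\<^sub>C = \<Sum> I \<in> p\<^sub>C(1). Hom(p[I], X)\<close>, and on maps \<open>h\<close> out of \<open>X\<close>. This is also
  \<open>p \<triangleleft>\<^sub>d X\<close>, so composite functors are written below by iterating \<open>fam\<close>.\<close>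

definition fam :: "('e, 'g) cat \<Rightarrow> ('o, 'f, 'e, 'g, 'i, 'a) bicomodule \<Rightarrow>
    ('e, 'g, 'x) copresheaf \<Rightarrow> ('o, 'f, 'i \<times> ('a \<Rightarrow> 'x)) copresheaf" where
  "fam d p X = \<lparr>
     Elts = (SIGMA I : Elts (pos p). Hom d (dir p I) X),
     anchor = (\<lambda>(I, k). anchor (pos p) I),
     act = (\<lambda>f (I, k). (act (pos p) f I,
       compose (Elts (dir p (act (pos p) f I))) k (dirmap p f I)))\<rparr>"

definition fam_map :: "('e, 'g) cat \<Rightarrow> ('o, 'f, 'e, 'g, 'i, 'a) bicomodule \<Rightarrow>
    ('e, 'g, 'x) copresheaf \<Rightarrow> ('x \<Rightarrow> 'y) \<Rightarrow> 'i \<times> ('a \<Rightarrow> 'x) \<Rightarrow> 'i \<times> ('a \<Rightarrow> 'y)" where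
  "fam_map d p X h = (\<lambda>(I, k)\<in>Elts (fam d p X). (I, compose (Elts (dir p I)) h k))"

definition id_bicomodule :: "('o, 'f) cat \<Rightarrow> ('o, 'f, 'o, 'f, 'o, 'f) bicomodule" where
  "id_bicomodule c = \<lparr>
     pos = \<lparr>Elts = Obj c, anchor = (\<lambda>C. C), act = (\<lambda>f C. Cod c f)\<rparr>,
     dir = (\<lambda>C. \<lparr>Elts = {h \<in> Arr c. Dom c h = C}, anchor = Cod c, act = Comp c\<rparr>),
     dirmap = (\<lambda>f C. \<lambda>h\<in>{h \<in> Arr c. Dom c h = Cod c f}. Comp c h f)\<rparr>"

text \<open>The composite \<open>p \<triangleleft>\<^sub>d q = eq(p \<triangleleft> q \<rightrightarrows> p \<triangleleft> d \<triangleleft> q)\<close> as a bicomodule. A position is an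
  \<open>I \<in> p(1)\<close> with a map \<open>J: p[I] \<rightarrow> q(1)\<close> of \<open>d\<close>-copresheaves; its directions are the coequalizer of
  the directions \<open>(a, b)\<close>, \<open>b \<in> q[J a]\<close>, of \<open>p \<triangleleft> q\<close> identifying \<open>(g\<cdot>a, b)\<close> with
  \<open>(a, q\<^sub>g b)\<close> for \<open>b \<in> q[J (g\<cdot>a)] = q[g\<cdot>J a]\<close>. Functions on equivalence classes are given on
  representatives by \<open>on_class\<close>.\<close>

definition comp_pairs ::
    "('o, 'f, 'e, 'g, 'i, 'a) bicomodule \<Rightarrow> ('e, 'g, 'u, 'v, 'j, 'b) bicomodule \<Rightarrow>
      'i \<times> ('a \<Rightarrow> 'j) \<Rightarrow> ('a \<times> 'b) set" where
  "comp_pairs p q = (\<lambda>(I, J). SIGMA a : Elts (dir p I). Elts (dir q (J a)))"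

definition comp_step ::
    "('e, 'g) cat \<Rightarrow> ('o, 'f, 'e, 'g, 'i, 'a) bicomodule \<Rightarrow> ('e, 'g, 'u, 'v, 'j, 'b) bicomodule \<Rightarrow>
      'i \<times> ('a \<Rightarrow> 'j) \<Rightarrow> (('a \<times> 'b) \<times> ('a \<times> 'b)) set" where
  "comp_step d p q = (\<lambda>(I, J). {((act (dir p I) g a, b), (a, dirmap q g (J a) b)) | g a b.
     a \<in> Elts (dir p I) \<and> g \<in> Arr d \<and> Dom d g = anchor (dir p I) a \<and>
     b \<in> Elts (dir q (J (act (dir p I) g a)))})"

definition comp_rel ::
    "('e, 'g) cat \<Rightarrow> ('o, 'f, 'e, 'g, 'i, 'a) bicomodule \<Rightarrow> ('e, 'g, 'u, 'v, 'j, 'b) bicomodule \<Rightarrow>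
      'i \<times> ('a \<Rightarrow> 'j) \<Rightarrow> (('a \<times> 'b) \<times> ('a \<times> 'b)) set" where
  "comp_rel d p q K = (comp_step d p q K \<union> (comp_step d p q K)\<inverse>)\<^sup>* \<inter>
     comp_pairs p q K \<times> comp_pairs p q K"

definition on_class :: "('a \<Rightarrow> 'b) \<Rightarrow> 'a set \<Rightarrow> 'b" where
  "on_class h Q = the_elem (h ` Q)"

definition comp_bicomodule ::
    "('e, 'g) cat \<Rightarrow> ('o, 'f, 'e, 'g, 'i, 'a) bicomodule \<Rightarrow> ('e, 'g, 'u, 'v, 'j, 'b) bicomodule \<Rightarrow>
      ('o, 'f, 'u, 'v, 'i \<times> ('a \<Rightarrow> 'j), ('a \<times> 'b) set) bicomodule" where
  "comp_bicomodule d p q = \<lparr>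
     pos = fam d p (pos q),
     dir = (\<lambda>(I, J). \<lparr>
       Elts = comp_pairs p q (I, J) // comp_rel d p q (I, J),
       anchor = on_class (\<lambda>(a, b). anchor (dir q (J a)) b),
       act = (\<lambda>h. on_class (\<lambda>(a, b). comp_rel d p q (I, J) `` {(a, act (dir q (J a)) h b)}))\<rparr>),
     dirmap = (\<lambda>f K. let K' = act (fam d p (pos q)) f K in
       (\<lambda>Q\<in>comp_pairs p q K' // comp_rel d p q K'.
         on_class (\<lambda>(a, b). comp_rel d p q K `` {(dirmap p f (fst K) a, b)}) Q))\<rparr>"

text \<open>The canonical isomorphisms \<open>X \<cong> id\<^sub>c(X)\<close> and \<open>p(q(X)) \<cong> (p \<triangleleft>\<^sub>d q)(X)\<close>.\<close>

definition id_iso :: "('o, 'f) cat \<Rightarrow> ('o, 'f, 'x) copresheaf \<Rightarrow> 'x \<Rightarrow> 'o \<times> ('f \<Rightarrow> 'x)" where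
  "id_iso c X = (\<lambda>x\<in>Elts X. (anchor X x, \<lambda>f\<in>{f \<in> Arr c. Dom c f = anchor X x}. act X f x))"

definition comp_iso ::
    "('e, 'g) cat \<Rightarrow> ('u, 'v) cat \<Rightarrow>
      ('o, 'f, 'e, 'g, 'i, 'a) bicomodule \<Rightarrow> ('e, 'g, 'u, 'v, 'j, 'b) bicomodule \<Rightarrow>
      ('u, 'v, 'x) copresheaf \<Rightarrow>
      'i \<times> ('a \<Rightarrow> 'j \<times> ('b \<Rightarrow> 'x)) \<Rightarrow> ('i \<times> ('a \<Rightarrow> 'j)) \<times> (('a \<times> 'b) set \<Rightarrow> 'x)" where
  "comp_iso d e p q X = (\<lambda>(I, F)\<in>Elts (fam d p (fam e q X)).
     let J = compose (Elts (dir p I)) fst F in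
     ((I, J), \<lambda>Q\<in>Elts (dir (comp_bicomodule d p q) (I, J)). on_class (\<lambda>(a, b). snd (F a) b) Q))"

text \<open>A morphism \<open>\<phi>: p \<rightarrow> q\<close> of \<open>(c,d)\<close>-bicomodules sends a position \<open>I\<close> to \<open>\<phi> I = (\<phi>\<^sub>1 I, \<phi>\<^sup># I)\<close>
  with \<open>\<phi>\<^sub>1 I \<in> q(1)\<close> and \<open>\<phi>\<^sup># I: q[\<phi>\<^sub>1 I] \<rightarrow> p[I]\<close>, i.e. to an element of \<open>q(p[I])\<close>. The
  corresponding natural transformation has components \<open>component d p q \<phi> X\<close>.\<close>

definition bicomodule_map ::
    "('o, 'f) cat \<Rightarrow> ('e, 'g) cat \<Rightarrow> ('o, 'f, 'e, 'g, 'i, 'a) bicomodule \<Rightarrow>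
      ('o, 'f, 'e, 'g, 'j, 'b) bicomodule \<Rightarrow> ('i \<Rightarrow> 'j \<times> ('b \<Rightarrow> 'a)) \<Rightarrow> bool" where
  "bicomodule_map c d p q \<phi> \<longleftrightarrow>
    (\<forall>I\<in>Elts (pos p). \<phi> I \<in> Elts (fam d q (dir p I)) \<and>
      anchor (pos q) (fst (\<phi> I)) = anchor (pos p) I) \<and>
    (\<forall>I\<in>Elts (pos p). \<forall>f\<in>Arr c. Dom c f = anchor (pos p) I \<longrightarrow>
      act (fam d q (dir p I)) f (\<phi> I) =
        fam_map d q (dir p (act (pos p) f I)) (dirmap p f I) (\<phi> (act (pos p) f I)))"

definition component ::
    "('e, 'g) cat \<Rightarrow> ('o, 'f, 'e, 'g, 'i, 'a) bicomodule \<Rightarrow>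
      ('o, 'f, 'e, 'g, 'j, 'b) bicomodule \<Rightarrow> ('i \<Rightarrow> 'j \<times> ('b \<Rightarrow> 'a)) \<Rightarrow>
      ('e, 'g, 'x) copresheaf \<Rightarrow> 'i \<times> ('a \<Rightarrow> 'x) \<Rightarrow> 'j \<times> ('b \<Rightarrow> 'x)" where
  "component d p q \<phi> X = (\<lambda>(I, k)\<in>Elts (fam d p X). fam_map d q (dir p I) k (\<phi> I))"

text \<open>All naturality squares are pullbacks. It is enough to test against maps \<open>h: X \<rightarrow> Y\<close> with
  elements of \<open>X\<close> in the type of directions of \<open>q\<close> and elements of \<open>Y\<close> in that of \<open>p\<close>: the square
  for \<open>\<phi>\<^sup># I: q[\<phi>\<^sub>1 I] \<rightarrow> p[I]\<close> already shows that \<open>\<phi>\<^sup># I\<close> is bijective.\<close>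

definition cartesian ::
    "('e, 'g) cat \<Rightarrow> ('o, 'f, 'e, 'g, 'i, 'a) bicomodule \<Rightarrow>
      ('o, 'f, 'e, 'g, 'j, 'b) bicomodule \<Rightarrow> ('i \<Rightarrow> 'j \<times> ('b \<Rightarrow> 'a)) \<Rightarrow> bool" where
  "cartesian d p q \<phi> \<longleftrightarrow>
    (\<forall>(X :: ('e, 'g, 'b) copresheaf) (Y :: ('e, 'g, 'a) copresheaf) h.
      copresheaf d X \<longrightarrow> copresheaf d Y \<longrightarrow> h \<in> Hom d X Y \<longrightarrow>
      (\<forall>s\<in>Elts (fam d p Y). \<forall>t\<in>Elts (fam d q X).
        component d p q \<phi> Y s = fam_map d q X h t \<longrightarrow>
        (\<exists>!r. r \<in> Elts (fam d p X) \<and> fam_map d p X h r = s \<and> component d p q \<phi> X r = t)))"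

section \<open>Monads and their algebras\<close>

record ('o, 'f, 'i, 'a) monad =
  fun_of :: "('o, 'f, 'o, 'f, 'i, 'a) bicomodule"
  unit_of :: "'o \<Rightarrow> 'i \<times> ('a \<Rightarrow> 'f)"
  mult_of :: "'i \<times> ('a \<Rightarrow> 'i) \<Rightarrow> 'i \<times> ('a \<Rightarrow> ('a \<times> 'a) set)"

abbreviation mon :: "('o, 'f) cat \<Rightarrow> ('o, 'f, 'i, 'a) monad \<Rightarrow> ('o, 'f, 'x) copresheaf \<Rightarrow>
    ('o, 'f, 'i \<times> ('a \<Rightarrow> 'x)) copresheaf" where
  "mon c m X \<equiv> fam c (fun_of m) X"

abbreviation mon_map :: "('o, 'f) cat \<Rightarrow> ('o, 'f, 'i, 'a) monad \<Rightarrow> ('o, 'f, 'x) copresheaf \<Rightarrow>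
    ('x \<Rightarrow> 'y) \<Rightarrow> 'i \<times> ('a \<Rightarrow> 'x) \<Rightarrow> 'i \<times> ('a \<Rightarrow> 'y)" where
  "mon_map c m X h \<equiv> fam_map c (fun_of m) X h"

definition eta :: "('o, 'f) cat \<Rightarrow> ('o, 'f, 'i, 'a) monad \<Rightarrow> ('o, 'f, 'x) copresheaf \<Rightarrow>
    'x \<Rightarrow> 'i \<times> ('a \<Rightarrow> 'x)" where
  "eta c m X = compose (Elts X)
     (component c (id_bicomodule c) (fun_of m) (unit_of m) X) (id_iso c X)"

definition mu :: "('o, 'f) cat \<Rightarrow> ('o, 'f, 'i, 'a) monad \<Rightarrow> ('o, 'f, 'x) copresheaf \<Rightarrow>
    'i \<times> ('a \<Rightarrow> 'i \<times> ('a \<Rightarrow> 'x)) \<Rightarrow> 'i \<times> ('a \<Rightarrow> 'x)" where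
  "mu c m X = compose (Elts (mon c m (mon c m X)))
     (component c (comp_bicomodule c (fun_of m) (fun_of m)) (fun_of m) (mult_of m) X)
     (comp_iso c c (fun_of m) (fun_of m) X)"

text \<open>The monad laws are equations between natural transformations on \<open>c-Set\<close>. They are tested on
  copresheaves with elements in \<open>'a \<times> 'a \<times> 'a\<close>, where \<open>'a\<close> is the type of directions; this implies
  them at every type, since any element of \<open>m(m(m(X)))\<close> involves only the elements of \<open>X\<close>
  indexed by triples of directions.\<close>

definition monad :: "('o, 'f) cat \<Rightarrow> ('o, 'f, 'i, 'a) monad \<Rightarrow> bool" where
  "monad c m \<longleftrightarrow>
    bicomodule c c (fun_of m) \<and>
    bicomodule_map c c (id_bicomodule c) (fun_of m) (unit_of m) \<and>
    bicomodule_map c c (comp_bicomodule c (fun_of m) (fun_of m)) (fun_of m) (mult_of m) \<and>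
    (\<forall>X :: ('o, 'f, 'a \<times> 'a \<times> 'a) copresheaf. copresheaf c X \<longrightarrow>
      (\<forall>t\<in>Elts (mon c m X). mu c m X (eta c m (mon c m X) t) = t) \<and>
      (\<forall>t\<in>Elts (mon c m X). mu c m X (mon_map c m X (eta c m X) t) = t) \<and>
      (\<forall>t\<in>Elts (mon c m (mon c m (mon c m X))).
        mu c m X (mu c m (mon c m X) t) =
        mu c m X (mon_map c m (mon c m (mon c m X)) (mu c m X) t)))"

definition familial_monad :: "('o, 'f) cat \<Rightarrow> ('o, 'f, 'i, 'a) monad \<Rightarrow> bool" where
  "familial_monad c m \<longleftrightarrow> monad c m \<and>
    cartesian c (id_bicomodule c) (fun_of m) (unit_of m) \<and>
    cartesian c (comp_bicomodule c (fun_of m) (fun_of m)) (fun_of m) (mult_of m)"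

type_synonym ('o, 'f, 'i, 'a, 'x) alg = "('o, 'f, 'x) copresheaf \<times> ('i \<times> ('a \<Rightarrow> 'x) \<Rightarrow> 'x)"

definition algebra :: "('o, 'f) cat \<Rightarrow> ('o, 'f, 'i, 'a) monad \<Rightarrow> ('o, 'f, 'i, 'a, 'x) alg \<Rightarrow> bool" where
  "algebra c m = (\<lambda>(X, \<psi>). copresheaf c X \<and> \<psi> \<in> Hom c (mon c m X) X \<and>
    (\<forall>x\<in>Elts X. \<psi> (eta c m X x) = x) \<and>
    (\<forall>t\<in>Elts (mon c m (mon c m X)). \<psi> (mu c m X t) = \<psi> (mon_map c m (mon c m X) \<psi> t)))"

definition alg_hom :: "('o, 'f) cat \<Rightarrow> ('o, 'f, 'i, 'a) monad \<Rightarrow> ('o, 'f, 'i, 'a, 'x) alg \<Rightarrow>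
    ('o, 'f, 'i, 'a, 'y) alg \<Rightarrow> ('x \<Rightarrow> 'y) set" where
  "alg_hom c m = (\<lambda>(X, \<psi>) (Y, \<chi>).
    {h \<in> Hom c X Y. \<forall>t\<in>Elts (mon c m X). h (\<psi> t) = \<chi> (mon_map c m X h t)})"

definition free_alg :: "('o, 'f) cat \<Rightarrow> ('o, 'f, 'i, 'a) monad \<Rightarrow> ('o, 'f, 'x) copresheaf \<Rightarrow>
    ('o, 'f, 'i, 'a, 'i \<times> ('a \<Rightarrow> 'x)) alg" where
  "free_alg c m X = (mon c m X, mu c m X)"

definition Alg :: "('o, 'f) cat \<Rightarrow> ('o, 'f, 'i, 'a) monad \<Rightarrow>
    (('o, 'f, 'i, 'a, 'x) alg,
     ('o, 'f, 'i, 'a, 'x) alg \<times> ('x \<Rightarrow> 'x) \<times> ('o, 'f, 'i, 'a, 'x) alg) cat" where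
  "Alg c m = \<lparr>Obj = {A. algebra c m A},
     Arr = {(A, h, B). algebra c m A \<and> algebra c m B \<and> h \<in> alg_hom c m A B},
     Dom = (\<lambda>(A, h, B). A), Cod = (\<lambda>(A, h, B). B),
     Id = (\<lambda>A. (A, idmap (fst A), A)),
     Comp = (\<lambda>(B, k, C) (A, h, B'). (A, compose (Elts (fst A)) k h, C))\<rparr>"

section \<open>The theory category and nerves\<close>

text \<open>In the category \<open>\<Theta>\<^sub>m\<^sup>p\<close>, a Kleisli arrow \<open>g: p[J] \<rightarrow> m(p[I])\<close> from \<open>J\<close> to \<open>I\<close> is encoded as
  \<open>(I, J, g)\<close>, with its codomain first, so that the arrows into \<open>I\<close> are the \<open>(I, t)\<close> with
  \<open>t \<in> p(m(p[I]))\<close>. Here and in \<open>comonad_category\<close> below the operations are undefined outside their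
  domains, so that the two categories can be compared by equality.\<close>

definition Theta :: "('o, 'f) cat \<Rightarrow> ('o, 'f, 'i, 'a) monad \<Rightarrow>
    ('e, 'g, 'o, 'f, 'j, 'b) bicomodule \<Rightarrow>
    ('j, 'j \<times> 'j \<times> ('b \<Rightarrow> 'i \<times> ('a \<Rightarrow> 'b))) cat" where
  "Theta c m p = (let
     arrows = {(I, J, g). I \<in> Elts (pos p) \<and> J \<in> Elts (pos p) \<and>
       g \<in> Hom c (dir p J) (mon c m (dir p I))}
   in \<lparr>Obj = Elts (pos p), Arr = arrows,
     Dom = (\<lambda>(I, J, g)\<in>arrows. J), Cod = (\<lambda>(I, J, g)\<in>arrows. I),
     Id = (\<lambda>I\<in>Elts (pos p). (I, I, eta c m (dir p I))),
     Comp = (\<lambda>(K, I', g') (I, J, g).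
       if (K, I', g') \<in> arrows \<and> (I, J, g) \<in> arrows \<and> I' = I
       then (K, J, \<lambda>b\<in>Elts (dir p J).
         mu c m (dir p K) (mon_map c m (dir p I) g' (g b)))
       else undefined)\<rparr>)"

text \<open>The inclusion of \<open>\<Theta>\<^sub>m\<^sup>p\<close> into \<open>m-Alg\<close> sends \<open>I\<close> to \<open>m(p[I])\<close> and the Kleisli arrow
  \<open>g: p[J] \<rightarrow> m(p[I])\<close> to its extension \<open>m(p[J]) \<rightarrow> m(p[I])\<close>.\<close>

definition Theta_incl :: "('o, 'f) cat \<Rightarrow> ('o, 'f, 'i, 'a) monad \<Rightarrow>
    ('e, 'g, 'o, 'f, 'j, 'b) bicomodule \<Rightarrow>
    'j \<times> 'j \<times> ('b \<Rightarrow> 'i \<times> ('a \<Rightarrow> 'b)) \<Rightarrow> 'i \<times> ('a \<Rightarrow> 'b) \<Rightarrow> 'i \<times> ('a \<Rightarrow> 'b)" where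
  "Theta_incl c m p = (\<lambda>(I, J, g). compose (Elts (mon c m (dir p J)))
     (mu c m (dir p I)) (mon_map c m (dir p J) g))"

type_synonym ('A, 'F, 'K, 'k, 'x) setfunctor =
  "('A \<Rightarrow> ('K, 'k, 'x) copresheaf) \<times> ('F \<Rightarrow> 'x \<Rightarrow> 'x)"

definition functor_to_copresheaves ::
    "('A, 'F) cat \<Rightarrow> ('K, 'k) cat \<Rightarrow> ('A, 'F, 'K, 'k, 'x) setfunctor \<Rightarrow> bool" where
  "functor_to_copresheaves A K = (\<lambda>(F, F').
    (\<forall>X\<in>Obj A. copresheaf K (F X)) \<and>
    (\<forall>f\<in>Arr A. F' f \<in> Hom K (F (Dom A f)) (F (Cod A f))) \<and>
    (\<forall>X\<in>Obj A. F' (Id A X) = idmap (F X)) \<and>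
    (\<forall>f\<in>Arr A. \<forall>g\<in>Arr A. Dom A g = Cod A f \<longrightarrow>
      F' (Comp A g f) = compose (Elts (F (Dom A f))) (F' g) (F' f)))"

definition naturally_isomorphic ::
    "('A, 'F) cat \<Rightarrow> ('K, 'k) cat \<Rightarrow> ('A, 'F, 'K, 'k, 'x) setfunctor \<Rightarrow>
      ('A, 'F, 'K, 'k, 'y) setfunctor \<Rightarrow> bool" where
  "naturally_isomorphic A K = (\<lambda>(F, F') (G, G').
    functor_to_copresheaves A K (F, F') \<and> functor_to_copresheaves A K (G, G') \<and>
    (\<exists>\<Phi>. (\<forall>X\<in>Obj A. \<Phi> X \<in> Hom K (F X) (G X) \<and> bij_betw (\<Phi> X) (Elts (F X)) (Elts (G X))) \<and>
      (\<forall>f\<in>Arr A. \<forall>x\<in>Elts (F (Dom A f)). \<Phi> (Cod A f) (F' f x) = G' f (\<Phi> (Dom A f) x))))"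

text \<open>The generalized nerve \<open>X \<mapsto> (I \<mapsto> Hom(m(p[I]), X))\<close> and Weber's nerve
  \<open>N\<^sub>m: A \<mapsto> (M \<mapsto> Hom(m(m[M]), A))\<close>. An element of such a presheaf at \<open>I\<close> is a pair of \<open>I\<close> and an
  algebra map.\<close>

definition generalized_nerve :: "('o, 'f) cat \<Rightarrow> ('o, 'f, 'i, 'a) monad \<Rightarrow>
    ('e, 'g, 'o, 'f, 'j, 'b) bicomodule \<Rightarrow>
    (('o, 'f, 'i, 'a, 'x) alg,
     ('o, 'f, 'i, 'a, 'x) alg \<times> ('x \<Rightarrow> 'x) \<times> ('o, 'f, 'i, 'a, 'x) alg,
     'j, 'j \<times> 'j \<times> ('b \<Rightarrow> 'i \<times> ('a \<Rightarrow> 'b)),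
     'j \<times> ('i \<times> ('a \<Rightarrow> 'b) \<Rightarrow> 'x)) setfunctor" where
  "generalized_nerve c m p = (let
     N = (\<lambda>A. \<lparr>Elts = (SIGMA I : Elts (pos p). alg_hom c m (free_alg c m (dir p I)) A),
       anchor = fst,
       act = (\<lambda>(I, J, g) (I', h). (J, compose (Elts (mon c m (dir p J)))
         h (Theta_incl c m p (I, J, g))))\<rparr>)
   in (N, \<lambda>(A, k, B). \<lambda>(I, h)\<in>Elts (N A). (I, compose (Elts (mon c m (dir p I))) k h)))"

abbreviation Weber_theory :: "('o, 'f) cat \<Rightarrow> ('o, 'f, 'i, 'a) monad \<Rightarrow>
    ('i, 'i \<times> 'i \<times> ('a \<Rightarrow> 'i \<times> ('a \<Rightarrow> 'a))) cat" where
  "Weber_theory c m \<equiv> Theta c m (fun_of m)"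

definition Weber_nerve :: "('o, 'f) cat \<Rightarrow> ('o, 'f, 'i, 'a) monad \<Rightarrow>
    (('o, 'f, 'i, 'a, 'x) alg,
     ('o, 'f, 'i, 'a, 'x) alg \<times> ('x \<Rightarrow> 'x) \<times> ('o, 'f, 'i, 'a, 'x) alg,
     'i, 'i \<times> 'i \<times> ('a \<Rightarrow> 'i \<times> ('a \<Rightarrow> 'a)),
     'i \<times> ('i \<times> ('a \<Rightarrow> 'a) \<Rightarrow> 'x)) setfunctor" where
  "Weber_nerve c m = (let
     N = (\<lambda>A. \<lparr>Elts = (SIGMA M : Elts (pos (fun_of m)).
         alg_hom c m (free_alg c m (dir (fun_of m) M)) A),
       anchor = fst,
       act = (\<lambda>(M, M', g) (_, h). (M', compose (Elts (mon c m (dir (fun_of m) M')))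
         h (Theta_incl c m (fun_of m) (M, M', g))))\<rparr>)
   in (N, \<lambda>(A, k, B). \<lambda>(M, h)\<in>Elts (N A). (M, compose (Elts (mon c m (dir (fun_of m) M))) k h)))"

section \<open>Right coclosure\<close>

text \<open>\<open>coclosure p Q Q'\<close> is \<open>[q; p]\<close>, where the bicomodule \<open>q\<close> enters through its functor \<open>Q\<close> on
  objects and \<open>Q' X h: Q X \<rightarrow> Q Y\<close> on maps \<open>h: X \<rightarrow> Y\<close>.
  The unit \<open>u: p \<rightarrow> [q; p] \<triangleleft>\<^sub>d q\<close> of the adjunction has components
  \<open>p(X) \<rightarrow> [q; p](q(X))\<close>, \<open>(I, k) \<mapsto> (I, q(k): q(p[I]) \<rightarrow> q(X))\<close>.
  The adjoint \<open>[q; p] \<rightarrow> r\<close> of \<open>\<phi>: p \<rightarrow> r \<triangleleft>\<^sub>d q\<close> sends a position \<open>I\<close> to the value of \<open>\<phi>\<close> on the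
  generic element \<open>(I, id)\<close> of \<open>p(p[I])\<close>, which lies in \<open>r(q(p[I])) = r([q; p][I])\<close>.\<close>

definition coclosure ::
    "('o, 'f, 'u, 'v, 'j, 'b) bicomodule \<Rightarrow>
      (('u, 'v, 'b) copresheaf \<Rightarrow> ('e, 'g, 'y) copresheaf) \<Rightarrow>
      (('u, 'v, 'b) copresheaf \<Rightarrow> ('b \<Rightarrow> 'b) \<Rightarrow> 'y \<Rightarrow> 'y) \<Rightarrow>
      ('o, 'f, 'e, 'g, 'j, 'y) bicomodule" where
  "coclosure p Q Q' = \<lparr>pos = pos p, dir = (\<lambda>I. Q (dir p I)),
     dirmap = (\<lambda>f I. Q' (dir p (act (pos p) f I)) (dirmap p f I))\<rparr>"

definition coclosure_unit ::
    "('u, 'v) cat \<Rightarrow> ('o, 'f, 'u, 'v, 'j, 'b) bicomodule \<Rightarrow>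
      (('u, 'v, 'b) copresheaf \<Rightarrow> ('b \<Rightarrow> 'x) \<Rightarrow> 'y \<Rightarrow> 'z) \<Rightarrow>
      ('u, 'v, 'x) copresheaf \<Rightarrow> 'j \<times> ('b \<Rightarrow> 'x) \<Rightarrow> 'j \<times> ('y \<Rightarrow> 'z)" where
  "coclosure_unit c p Q' X = (\<lambda>(I, k)\<in>Elts (fam c p X). (I, Q' (dir p I) k))"

definition coclosure_adjoint ::
    "('o, 'f, 'u, 'v, 'j, 'b) bicomodule \<Rightarrow>
      (('u, 'v, 'b) copresheaf \<Rightarrow> 'j \<times> ('b \<Rightarrow> 'b) \<Rightarrow> 't) \<Rightarrow> 'j \<Rightarrow> 't" where
  "coclosure_adjoint p \<phi> I = \<phi> (dir p I) (I, idmap (dir p I))"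

text \<open>Bicomodule maps \<open>\<alpha>: [q; p] \<rightarrow> r\<close> and natural transformations \<open>\<phi>: p \<rightarrow> r \<triangleleft>\<^sub>d q\<close> correspond to each
  other by \<open>\<alpha> \<mapsto> (\<alpha> \<triangleleft>\<^sub>d q) \<circ> u\<close> and \<open>coclosure_adjoint\<close>.\<close>

lemma coclosure_adjoint_of_unit:
  assumes I: "I \<in> Elts (pos p)" and P: "copresheaf c (dir p I)"
    and Q: "copresheaf e (Q (dir p I))" and Q': "Q' (dir p I) (idmap (dir p I)) = idmap (Q (dir p I))"
    and \<alpha>: "\<alpha> I \<in> Elts (fam e r (Q (dir p I)))"
  shows "coclosure_adjoint p (\<lambda>X t.
    component e (coclosure p Q Q') r \<alpha> (Q X) (coclosure_unit c p Q' X t)) I = \<alpha> I"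
proof -
  have "(I, idmap (dir p I)) \<in> Elts (fam c p (dir p I))"
    using I P by (auto simp: fam_def Hom_def copresheaf_def)
  moreover have "(I, idmap (Q (dir p I))) \<in> Elts (fam e (coclosure p Q Q') (Q (dir p I)))"
    using I Q by (auto simp: fam_def Hom_def copresheaf_def coclosure_def)
  moreover have "fam_map e r (Q (dir p I)) (idmap (Q (dir p I))) (\<alpha> I) = \<alpha> I"
  proof -
    obtain R k where R: "\<alpha> I = (R, k)" by force
    have k: "k \<in> Elts (dir r R) \<rightarrow>\<^sub>E Elts (Q (dir p I))"
      using \<alpha> by (simp add: R fam_def Hom_def)
    have "compose (Elts (dir r R)) (idmap (Q (dir p I))) k = k"
      by (rule extensionalityI[of _ "Elts (dir r R)"]) (use k in \<open>auto simp: compose_def PiE_def\<close>)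
    then show ?thesis using \<alpha> by (simp add: R fam_map_def)
  qed
  ultimately show ?thesis
    by (simp add: coclosure_adjoint_def coclosure_unit_def component_def Q')
       (simp add: coclosure_def)
qed

lemma unit_of_coclosure_adjoint:
  assumes "(I, k) \<in> Elts (fam c p X)" and "Q'' (dir p I) k \<in> Hom e (Q (dir p I)) QX"
    and natural: "\<phi>X (fam_map c p (dir p I) k (I, idmap (dir p I))) =
      fam_map e r (Q (dir p I)) (Q'' (dir p I) k) (\<phi> (dir p I) (I, idmap (dir p I)))"
    and "copresheaf c (dir p I)"
  shows "component e (coclosure p Q Q') r (coclosure_adjoint p \<phi>) QX
    (coclosure_unit c p Q'' X (I, k)) = \<phi>X (I, k)"
proof -
  have "(I, idmap (dir p I)) \<in> Elts (fam c p (dir p I))"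
    using assms by (auto simp: fam_def Hom_def copresheaf_def)
  moreover have "compose (Elts (dir p I)) k (idmap (dir p I)) = k"
    by (rule extensionalityI[of _ "Elts (dir p I)"])
       (use assms(1) in \<open>auto simp: compose_def fam_def Hom_def PiE_def\<close>)
  moreover have "(I, Q'' (dir p I) k) \<in> Elts (fam e (coclosure p Q Q') QX)"
    using assms(1,2) by (auto simp: fam_def coclosure_def)
  ultimately show ?thesis
    using natural assms(1)
    by (simp add: component_def coclosure_unit_def coclosure_adjoint_def fam_map_def)
       (simp add: coclosure_def)
qed

definition pm :: "('o, 'f) cat \<Rightarrow> ('o, 'f, 'i, 'a) monad \<Rightarrow>
    ('e, 'g, 'o, 'f, 'j, 'b) bicomodule \<Rightarrow> ('o, 'f, 'x) copresheaf \<Rightarrow>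
    ('e, 'g, 'j \<times> ('b \<Rightarrow> 'i \<times> ('a \<Rightarrow> 'x))) copresheaf" where
  "pm c m p X = fam c p (mon c m X)"

definition pm_map :: "('o, 'f) cat \<Rightarrow> ('o, 'f, 'i, 'a) monad \<Rightarrow>
    ('e, 'g, 'o, 'f, 'j, 'b) bicomodule \<Rightarrow> ('o, 'f, 'x) copresheaf \<Rightarrow> ('x \<Rightarrow> 'y) \<Rightarrow>
    'j \<times> ('b \<Rightarrow> 'i \<times> ('a \<Rightarrow> 'x)) \<Rightarrow> 'j \<times> ('b \<Rightarrow> 'i \<times> ('a \<Rightarrow> 'y))" where
  "pm_map c m p X h = fam_map c p (mon c m X) (mon_map c m X h)"

definition L_of :: "('o, 'f) cat \<Rightarrow> ('o, 'f, 'i, 'a) monad \<Rightarrow>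
    ('e, 'g, 'o, 'f, 'j, 'b) bicomodule \<Rightarrow>
    ('e, 'g, 'e, 'g, 'j, 'j \<times> ('b \<Rightarrow> 'i \<times> ('a \<Rightarrow> 'b))) bicomodule" where
  "L_of c m p = coclosure p (pm c m p) (pm_map c m p)"

definition u_of :: "('o, 'f) cat \<Rightarrow> ('o, 'f, 'i, 'a) monad \<Rightarrow>
    ('e, 'g, 'o, 'f, 'j, 'b) bicomodule \<Rightarrow> ('o, 'f, 'x) copresheaf \<Rightarrow>
    'j \<times> ('b \<Rightarrow> 'x) \<Rightarrow>
    'j \<times> ('j \<times> ('b \<Rightarrow> 'i \<times> ('a \<Rightarrow> 'b)) \<Rightarrow> 'j \<times> ('b \<Rightarrow> 'i \<times> ('a \<Rightarrow> 'x)))" where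
  "u_of c m p X = coclosure_unit c p (pm_map c m p) X"

definition L_counit :: "('o, 'f) cat \<Rightarrow> ('e, 'g) cat \<Rightarrow> ('o, 'f, 'i, 'a) monad \<Rightarrow>
    ('e, 'g, 'o, 'f, 'j, 'b) bicomodule \<Rightarrow>
    'j \<Rightarrow> 'e \<times> ('g \<Rightarrow> 'j \<times> ('b \<Rightarrow> 'i \<times> ('a \<Rightarrow> 'b)))" where
  "L_counit c d m p = coclosure_adjoint p
     (\<lambda>X t. id_iso d (pm c m p X) (fam_map c p X (eta c m X) t))"

definition L_comult :: "('o, 'f) cat \<Rightarrow> ('e, 'g) cat \<Rightarrow> ('o, 'f, 'i, 'a) monad \<Rightarrow>
    ('e, 'g, 'o, 'f, 'j, 'b) bicomodule \<Rightarrow> 'j \<Rightarrow>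
    'j \<times> ('j \<times> ('b \<Rightarrow> 'i \<times> ('a \<Rightarrow> 'b)) \<Rightarrow>
    'j \<times> ('j \<times> ('b \<Rightarrow> 'i \<times> ('a \<Rightarrow> 'b)) \<Rightarrow> 'j \<times> ('b \<Rightarrow> 'i \<times> ('a \<Rightarrow> 'b))))" where
  "L_comult c d m p = coclosure_adjoint p (\<lambda>X t.
     let M = mon c m X; l = L_of c m p in
     fam_map d l (fam d l (pm c m p M))
       (fam_map d l (pm c m p M) (fam_map c p (mon c m M) (mu c m X)))
       (fam_map d l (fam c p M) (u_of c m p M) (u_of c m p X t)))"

section \<open>Comonads, comodules, and the induced copresheaves\<close>

text \<open>The category of the carrier comonoid of a comonad \<open>(e, \<epsilon>, \<delta>)\<close> on \<open>d\<close>: an arrow out of a position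
  \<open>I\<close> is a direction \<open>a \<in> e[I]\<close>, encoded as \<open>(I, a)\<close>. The identity at \<open>I\<close> is the
  image of the direction of \<open>y\<close> under \<open>e \<rightarrow> d \<rightarrow> y\<close>. The map \<open>e \<rightarrow> e \<triangleleft>\<^sub>d e \<rightarrow> e \<triangleleft> e\<close> sends \<open>I\<close> to
  \<open>\<delta> I \<in> e(e(e[I]))\<close>, whose second component assigns to a direction \<open>a\<close> out of \<open>I\<close> its codomain
  \<open>J\<close> and the map \<open>e[J] \<rightarrow> e[I]\<close> of precomposition with \<open>a\<close>.\<close>

definition comonad_category ::
    "('e, 'g) cat \<Rightarrow> ('e, 'g, 'e, 'g, 'j, 'y) bicomodule \<Rightarrow> ('j \<Rightarrow> 'e \<times> ('g \<Rightarrow> 'y)) \<Rightarrow>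
      ('j \<Rightarrow> 'j \<times> ('y \<Rightarrow> 'j \<times> ('y \<Rightarrow> 'y))) \<Rightarrow> ('j, 'j \<times> 'y) cat" where
  "comonad_category d e \<epsilon> \<delta> = (let
     arrows = (SIGMA I : Elts (pos e). Elts (dir e I));
     cod = (\<lambda>(I, a)\<in>arrows. fst (snd (\<delta> I) a))
   in \<lparr>Obj = Elts (pos e), Arr = arrows, Dom = (\<lambda>(I, a)\<in>arrows. I), Cod = cod,
     Id = (\<lambda>I\<in>Elts (pos e). (I, snd (\<epsilon> I) (Id d (fst (\<epsilon> I))))),
     Comp = (\<lambda>(J, b) (I, a).
       if (J, b) \<in> arrows \<and> (I, a) \<in> arrows \<and> J = cod (I, a)
       then (I, snd (snd (\<delta> I) a) b) else undefined)\<rparr>)"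

text \<open>The copresheaf on that category obtained from a coaction \<open>\<rho>: Z \<rightarrow> e(Z)\<close>, via
  \<open>Z \<rightarrow> e \<triangleleft>\<^sub>d Z \<rightarrow> e \<triangleleft> Z\<close>: an element \<open>z\<close> with \<open>\<rho> z = (I, k)\<close> lies over \<open>I\<close>, and \<open>a \<in> e[I]\<close> acts on
  it by \<open>k a\<close>.\<close>

definition comodule_copresheaf ::
    "('e, 'g, 'z) copresheaf \<Rightarrow> ('z \<Rightarrow> 'j \<times> ('y \<Rightarrow> 'z)) \<Rightarrow> ('j, 'j \<times> 'y, 'z) copresheaf" where
  "comodule_copresheaf Z \<rho> = \<lparr>Elts = Elts Z, anchor = (\<lambda>z. fst (\<rho> z)),
     act = (\<lambda>(I, a) z. snd (\<rho> z) a)\<rparr>"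

definition L_coaction :: "('o, 'f) cat \<Rightarrow> ('e, 'g) cat \<Rightarrow> ('o, 'f, 'i, 'a) monad \<Rightarrow>
    ('e, 'g, 'o, 'f, 'j, 'b) bicomodule \<Rightarrow> ('o, 'f, 'i, 'a, 'x) alg \<Rightarrow>
    'j \<times> ('b \<Rightarrow> 'x) \<Rightarrow>
    'j \<times> ('j \<times> ('b \<Rightarrow> 'i \<times> ('a \<Rightarrow> 'b)) \<Rightarrow> 'j \<times> ('b \<Rightarrow> 'x))" where
  "L_coaction c d m p = (\<lambda>(X, \<psi>). compose (Elts (fam c p X))
     (fam_map d (L_of c m p) (pm c m p X) (fam_map c p (mon c m X) \<psi>)) (u_of c m p X))"

definition N_tilde :: "('o, 'f) cat \<Rightarrow> ('e, 'g) cat \<Rightarrow> ('o, 'f, 'i, 'a) monad \<Rightarrow>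
    ('e, 'g, 'o, 'f, 'j, 'b) bicomodule \<Rightarrow>
    (('o, 'f, 'i, 'a, 'x) alg,
     ('o, 'f, 'i, 'a, 'x) alg \<times> ('x \<Rightarrow> 'x) \<times> ('o, 'f, 'i, 'a, 'x) alg,
     'j, 'j \<times> 'j \<times> ('b \<Rightarrow> 'i \<times> ('a \<Rightarrow> 'b)),
     'j \<times> ('b \<Rightarrow> 'x)) setfunctor" where
  "N_tilde c d m p =
    (\<lambda>A. comodule_copresheaf (fam c p (fst A)) (L_coaction c d m p A),
     \<lambda>(A, h, B). fam_map c p (fst A) h)"

end

(*
  A coaction of L on p(X) built from an algebra (X, \<psi>) sends (I, k) with k: p[I] -> X to I together
  with the map taking (J, g), for a Kleisli arrow g: p[J] -> m(p[I]), to (J, \<psi> o m(k) o g). Here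
  \<psi> o m(k) is the unique extension of k to an algebra map m(p[I]) -> X, so (I, k) corresponds to an
  element of Hom(m(p[I]), X), and the coaction to precomposition with the extension of g. Applied to
  free algebras, the same computation identifies the comultiplication of L with Kleisli composition.
*)

theory Submission
  imports Defs
begin

section \<open>Maps of copresheaves and familial functors\<close>

text \<open>The groundwork is to make \<open>eta\<close> and \<open>mu\<close> natural maps of
  copresheaves obeying the monad laws wherever they are used. A bicomodule map is given by elements
  \<open>\<phi> I\<close> of \<open>q(p[I])\<close>, so naturality is a Yoneda argument; for
  \<open>mu\<close> it must be combined with the isomorphism from \<open>m(m(X))\<close> to the
  functor of the composite bicomodule, whose directions are equivalence classes. The laws are
  assumed at a single element type, since a hypothesis cannot quantify over types, but are needed at
  the copresheaves \<open>p[I]\<close>, whose elements have the type of directions of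
  \<open>p\<close>. Hence every element is first moved to a copy of the part of \<open>X\<close>
  that it involves. Uniqueness of extensions from free algebras comes from the law
  \<open>\<mu> \<circ> m(\<eta>) = id\<close>; compatibility with composition comes from algebra
  maps commuting with extensions. Since maps are extensional functions and the operations of both
  categories are undefined off their domains, the category of \<open>L\<close> can be proved equal,
  not just isomorphic, to the opposite of \<open>Theta\<close>.\<close>

lemma copresheafD:
  assumes "copresheaf c X" "x \<in> Elts X"
  shows "anchor X x \<in> Obj c" "act X (Id c (anchor X x)) x = x"
    "f \<in> Arr c \<Longrightarrow> Dom c f = anchor X x \<Longrightarrow> act X f x \<in> Elts X"
    "f \<in> Arr c \<Longrightarrow> Dom c f = anchor X x \<Longrightarrow> anchor X (act X f x) = Cod c f"
    "f \<in> Arr c \<Longrightarrow> g \<in> Arr c \<Longrightarrow> Dom c f = anchor X x \<Longrightarrow> Dom c g = Cod c f \<Longrightarrow>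
      act X (Comp c g f) x = act X g (act X f x)"
  using assms by (auto simp: copresheaf_def)

lemma HomI:
  assumes "h \<in> extensional (Elts X)" "\<And>x. x \<in> Elts X \<Longrightarrow> h x \<in> Elts Y"
    "\<And>x. x \<in> Elts X \<Longrightarrow> anchor Y (h x) = anchor X x"
    "\<And>x f. x \<in> Elts X \<Longrightarrow> f \<in> Arr c \<Longrightarrow> Dom c f = anchor X x \<Longrightarrow>
      h (act X f x) = act Y f (h x)"
  shows "h \<in> Hom c X Y"
  using assms by (auto simp: Hom_def PiE_def)

lemma HomD:
  assumes "h \<in> Hom c X Y"
  shows "h \<in> extensional (Elts X)" "x \<in> Elts X \<Longrightarrow> h x \<in> Elts Y"
    "x \<in> Elts X \<Longrightarrow> anchor Y (h x) = anchor X x"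
    "x \<in> Elts X \<Longrightarrow> f \<in> Arr c \<Longrightarrow> Dom c f = anchor X x \<Longrightarrow> h (act X f x) = act Y f (h x)"
  using assms by (auto simp: Hom_def PiE_def)

lemma Hom_compose:
  assumes "copresheaf c X" "f \<in> Hom c X Y" "g \<in> Hom c Y Z"
  shows "compose (Elts X) g f \<in> Hom c X Z"
  by (rule HomI)
    (use assms in \<open>auto simp: compose_def HomD[OF assms(2)] HomD[OF assms(3)] copresheafD\<close>)

lemma Hom_idmap: "copresheaf c X \<Longrightarrow> idmap X \<in> Hom c X X"
  by (rule HomI) (auto simp: copresheafD)

lemma bicomoduleD:
  assumes "bicomodule c d p" "I \<in> Elts (pos p)"
  shows "copresheaf d (dir p I)"
    "f \<in> Arr c \<Longrightarrow> Dom c f = anchor (pos p) I \<Longrightarrow>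
      dirmap p f I \<in> Hom d (dir p (act (pos p) f I)) (dir p I)"
    "dirmap p (Id c (anchor (pos p) I)) I = idmap (dir p I)"
    "f \<in> Arr c \<Longrightarrow> g \<in> Arr c \<Longrightarrow> Dom c f = anchor (pos p) I \<Longrightarrow> Dom c g = Cod c f \<Longrightarrow>
      dirmap p (Comp c g f) I =
        compose (Elts (dir p (act (pos p) (Comp c g f) I)))
          (dirmap p f I) (dirmap p g (act (pos p) f I))"
  using assms by (auto simp: bicomodule_def)

lemma bicomodule_pos: "bicomodule c d p \<Longrightarrow> copresheaf c (pos p)"
  by (simp add: bicomodule_def)

lemma Elts_fam: "(I, k) \<in> Elts (fam d p X) \<longleftrightarrow> I \<in> Elts (pos p) \<and> k \<in> Hom d (dir p I) X"
  by (simp add: fam_def)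

lemma anchor_fam: "anchor (fam d p X) t = anchor (pos p) (fst t)"
  by (simp add: fam_def split: prod.split)

lemma act_fam: "act (fam d p X) f (I, k) = (act (pos p) f I,
    compose (Elts (dir p (act (pos p) f I))) k (dirmap p f I))"
  by (simp add: fam_def)

text \<open>An arrow acts on \<open>(I, k)\<close> by precomposing \<open>k\<close> with
  \<open>dirmap\<close>, so the laws reduce to those of \<open>pos p\<close> and to contravariant
  functoriality of \<open>dirmap\<close>.\<close>

lemma copresheaf_fam:
  assumes c: "small_category c" and p: "bicomodule c d p"
  shows "copresheaf c (fam d p X)"
proof -
  note P = bicomodule_pos[OF p] and B = bicomoduleD[OF p]
  have C: "g \<in> Arr c \<Longrightarrow> f \<in> Arr c \<Longrightarrow> Dom c g = Cod c f \<Longrightarrow>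
      Comp c g f \<in> Arr c \<and> Dom c (Comp c g f) = Dom c f" for f g
    using c by (auto simp: small_category_def)
  have 1: "act (fam d p X) f t \<in> Elts (fam d p X)"
    if "t \<in> Elts (fam d p X)" "f \<in> Arr c" "Dom c f = anchor (fam d p X) t" for f t
  proof -
    obtain I k where t: "t = (I, k)" by force
    then show ?thesis using that
      by (auto simp: Elts_fam anchor_fam act_fam intro!: Hom_compose[OF B(1) B(2)] copresheafD[OF P])
  qed
  have 2: "act (fam d p X) (Id c (anchor (fam d p X) t)) t = t" if "t \<in> Elts (fam d p X)" for t
  proof -
    obtain I k where t: "t = (I, k)" by force
    have "compose (Elts (dir p I)) k (idmap (dir p I)) = k"
      by (rule extensionalityI[of _ "Elts (dir p I)"])
        (use that in \<open>auto simp: t Elts_fam compose_def dest: HomD(1)\<close>)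
    then show ?thesis using that
      by (simp add: t Elts_fam anchor_fam act_fam copresheafD[OF P] B)
  qed
  have 3: "act (fam d p X) (Comp c g f) t = act (fam d p X) g (act (fam d p X) f t)"
    if "t \<in> Elts (fam d p X)" "f \<in> Arr c" "Dom c f = anchor (fam d p X) t"
      "g \<in> Arr c" "Dom c g = Cod c f" for f g t
  proof -
    obtain I k where t: "t = (I, k)" by force
    have I: "I \<in> Elts (pos p)" "Dom c f = anchor (pos p) I"
      using that by (auto simp: t Elts_fam anchor_fam)
    \<comment> \<open>\<open>compose\<close> is undefined off its domain, so the inner composite can
      be evaluated only once \<open>dirmap p g\<close> is known to land in the directions at
      \<open>act (pos p) f I\<close>.\<close>
    have "dirmap p g (act (pos p) f I) \<in>
      Hom d (dir p (act (pos p) g (act (pos p) f I))) (dir p (act (pos p) f I))"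
      using I that by (intro B) (auto simp: copresheafD[OF P])
    from HomD(2)[OF this] show ?thesis using that I
      by (auto simp: t act_fam copresheafD[OF P] B compose_def fun_eq_iff)
  qed
  show ?thesis
    unfolding copresheaf_def using 1 2 3
    by (auto simp: anchor_fam copresheafD[OF P] Elts_fam act_fam)
qed

lemma fam_map_apply:
  "(I, k) \<in> Elts (fam d p X) \<Longrightarrow> fam_map d p X h (I, k) = (I, compose (Elts (dir p I)) h k)"
  by (simp add: fam_map_def)

lemma fam_map_Hom:
  assumes c: "small_category c" and p: "bicomodule c d p" and h: "h \<in> Hom d X Y"
  shows "fam_map d p X h \<in> Hom c (fam d p X) (fam d p Y)"
proof -
  note P = bicomodule_pos[OF p] and B = bicomoduleD[OF p]
  note F = copresheaf_fam[OF c p, of X]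
  show ?thesis
  proof (rule HomI)
    show "fam_map d p X h \<in> extensional (Elts (fam d p X))" by (simp add: fam_map_def)
  next
    fix t assume t: "t \<in> Elts (fam d p X)"
    obtain I k where [simp]: "t = (I, k)" by force
    show "fam_map d p X h t \<in> Elts (fam d p Y)" "anchor (fam d p Y) (fam_map d p X h t) = anchor (fam d p X) t"
      using t by (auto simp: fam_map_apply Elts_fam anchor_fam intro!: Hom_compose[OF B(1) _ h])
    fix f assume f: "f \<in> Arr c" "Dom c f = anchor (fam d p X) t"
    have I: "I \<in> Elts (pos p)" "Dom c f = anchor (pos p) I" using t f by (auto simp: Elts_fam anchor_fam)
    have "act (fam d p X) f t \<in> Elts (fam d p X)" using F t f by (auto simp: copresheafD)
    then show "fam_map d p X h (act (fam d p X) f t) = act (fam d p Y) f (fam_map d p X h t)"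
      using t B(2)[OF I(1) f(1) I(2)]
      by (auto simp: act_fam fam_map_apply compose_def fun_eq_iff Elts_fam dest: HomD(2))
  qed
qed

lemma fam_map_mem:
  "bicomodule c d p \<Longrightarrow> h \<in> Hom d X Y \<Longrightarrow> t \<in> Elts (fam d p X) \<Longrightarrow>
    fam_map d p X h t \<in> Elts (fam d p Y)"
  by (cases t) (auto simp: fam_map_apply Elts_fam intro!: Hom_compose bicomoduleD(1))

text \<open>The composite \<open>l\<close> is given by pointwise agreement and not as a
  \<open>compose\<close> term, so that one rule covers lambda abstractions, \<open>extension\<close>
  and equations obtained from naturality.\<close>

lemma fam_map_comp:
  assumes "bicomodule c d p" "h \<in> Hom d X Y" "t \<in> Elts (fam d p X)"
    and hk: "\<And>x. x \<in> Elts X \<Longrightarrow> l x = k (h x)"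
  shows "fam_map d p Y k (fam_map d p X h t) = fam_map d p X l t"
proof -
  obtain I s where [simp]: "t = (I, s)" by force
  show ?thesis using fam_map_mem[OF assms(1-3)] assms(3)
    by (auto simp: fam_map_apply compose_def fun_eq_iff Elts_fam hk HomD(2))
qed

lemma fam_map_id:
  assumes "t \<in> Elts (fam d p X)" and h: "\<And>x. x \<in> Elts X \<Longrightarrow> h x = x"
  shows "fam_map d p X h t = t"
proof -
  obtain I s where [simp]: "t = (I, s)" by force
  have "compose (Elts (dir p I)) h s = s"
    by (rule extensionalityI[of _ "Elts (dir p I)"])
      (use assms in \<open>auto simp: compose_def h Elts_fam dest: HomD\<close>)
  with assms show ?thesis by (simp add: fam_map_apply)
qed

section \<open>Components of bicomodule maps\<close>

lemma component_apply:
  "(I, k) \<in> Elts (fam d p X) \<Longrightarrow> component d p q \<phi> X (I, k) = fam_map d q (dir p I) k (\<phi> I)"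
  by (simp add: component_def)

text \<open>The component at \<open>(I, k)\<close> pushes the element \<open>\<phi> I\<close> of
  \<open>q(p[I])\<close> forward along \<open>k\<close>, which keeps its position and therefore its
  anchor.\<close>

lemma component_mem:
  assumes q: "bicomodule c d q" and \<phi>: "bicomodule_map c d p q \<phi>" and t: "t \<in> Elts (fam d p X)"
  shows "component d p q \<phi> X t \<in> Elts (fam d q X)"
    and "anchor (fam d q X) (component d p q \<phi> X t) = anchor (fam d p X) t"
proof -
  obtain I k where [simp]: "t = (I, k)" by force
  have I: "I \<in> Elts (pos p)" "k \<in> Hom d (dir p I) X" using t by (auto simp: Elts_fam)
  have \<phi>I: "\<phi> I \<in> Elts (fam d q (dir p I))" "anchor (pos q) (fst (\<phi> I)) = anchor (pos p) I"
    using \<phi> I by (auto simp: bicomodule_map_def)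
  show "component d p q \<phi> X t \<in> Elts (fam d q X)"
    using t fam_map_mem[OF q I(2) \<phi>I(1)] by (simp add: component_apply)
  show "anchor (fam d q X) (component d p q \<phi> X t) = anchor (fam d p X) t"
    using t \<phi>I by (cases "\<phi> I") (simp add: component_apply anchor_fam fam_map_apply)
qed

text \<open>The hypothesis that \<open>act f t\<close> is again an element replaces the assumption that \<open>p\<close> is a
  bicomodule, which would have to be verified for composites.\<close>

lemma component_act:
  assumes c: "small_category c" and q: "bicomodule c d q" and \<phi>: "bicomodule_map c d p q \<phi>"
    and t: "t \<in> Elts (fam d p X)" and f: "f \<in> Arr c" "Dom c f = anchor (fam d p X) t"
    and ft: "act (fam d p X) f t \<in> Elts (fam d p X)"
  shows "component d p q \<phi> X (act (fam d p X) f t) = act (fam d q X) f (component d p q \<phi> X t)"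
proof -
  obtain I k where [simp]: "t = (I, k)" by force
  let ?J = "act (pos p) f I"
  have I: "I \<in> Elts (pos p)" "k \<in> Hom d (dir p I) X" "Dom c f = anchor (pos p) I"
    using t f by (auto simp: Elts_fam anchor_fam)
  have J: "?J \<in> Elts (pos p)" using ft by (simp add: act_fam Elts_fam)
  have \<phi>I: "\<phi> I \<in> Elts (fam d q (dir p I))" "anchor (pos q) (fst (\<phi> I)) = anchor (pos p) I"
    and \<phi>J: "\<phi> ?J \<in> Elts (fam d q (dir p ?J))"
    and n: "act (fam d q (dir p I)) f (\<phi> I) = fam_map d q (dir p ?J) (dirmap p f I) (\<phi> ?J)"
    using \<phi> I J f by (auto simp: bicomodule_map_def)
  have kk: "fam_map d q (dir p I) k \<in> Hom c (fam d q (dir p I)) (fam d q X)"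
    by (rule fam_map_Hom[OF c q I(2)])
  \<comment> \<open>\<open>fam_map_comp\<close> would ask that \<open>dirmap p f I\<close> be a map
    of copresheaves. The equation \<open>n\<close> identifies the pushed-forward element with this
    one instead, so its membership is enough.\<close>
  have mem: "act (fam d q (dir p I)) f (\<phi> I) \<in> Elts (fam d q (dir p I))"
    using copresheaf_fam[OF c q] \<phi>I I f by (auto intro!: copresheafD(3) simp: anchor_fam)
  have "component d p q \<phi> X (act (fam d p X) f t)
      = fam_map d q (dir p ?J) (compose (Elts (dir p ?J)) k (dirmap p f I)) (\<phi> ?J)"
    using ft by (simp add: component_apply act_fam)
  also have "\<dots> = fam_map d q (dir p I) k (fam_map d q (dir p ?J) (dirmap p f I) (\<phi> ?J))"
  proof -
    obtain R r where R: "\<phi> ?J = (R, r)" by force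
    show ?thesis using mem \<phi>J unfolding n
      by (auto simp: R fam_map_apply compose_def fun_eq_iff Elts_fam HomD(2))
  qed
  also have "\<dots> = act (fam d q X) f (fam_map d q (dir p I) k (\<phi> I))"
    unfolding n[symmetric] using HomD(4)[OF kk \<phi>I(1) f(1)] \<phi>I I by (simp add: anchor_fam)
  finally show ?thesis using t by (simp add: component_apply)
qed

text \<open>Both sides push \<open>\<phi> I\<close> forward, once along \<open>h \<circ> k\<close>
  and once along \<open>k\<close> and then \<open>h\<close>. As in \<open>component_act\<close>, a
  membership hypothesis lets \<open>p\<close> be a composite.\<close>

lemma component_natural:
  assumes q: "bicomodule c d q" and \<phi>: "bicomodule_map c d p q \<phi>" and t: "t \<in> Elts (fam d p X)"
    and h: "h \<in> Hom d X Y" and ht: "fam_map d p X h t \<in> Elts (fam d p Y)"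
  shows "component d p q \<phi> Y (fam_map d p X h t) = fam_map d q X h (component d p q \<phi> X t)"
proof -
  obtain I k where [simp]: "t = (I, k)" by force
  have I: "I \<in> Elts (pos p)" "k \<in> Hom d (dir p I) X" using t by (auto simp: Elts_fam)
  have \<phi>I: "\<phi> I \<in> Elts (fam d q (dir p I))" using \<phi> I by (auto simp: bicomodule_map_def)
  have "fam_map d q X h (fam_map d q (dir p I) k (\<phi> I))
      = fam_map d q (dir p I) (compose (Elts (dir p I)) h k) (\<phi> I)"
    by (rule fam_map_comp[OF q I(2) \<phi>I]) (simp add: compose_def)
  then show ?thesis using t ht by (simp add: component_apply fam_map_apply)
qed

section \<open>The canonical isomorphisms for identities and composites\<close>

lemma id_iso_apply:
  assumes "x \<in> Elts X"
  shows "id_iso c X x = (anchor X x, \<lambda>f\<in>{f \<in> Arr c. Dom c f = anchor X x}. act X f x)"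
  using assms by (simp add: id_iso_def)

text \<open>This is the Yoneda lemma: \<open>x\<close> over \<open>C\<close> gives the map from the
  representable \<open>c[C]\<close> to \<open>X\<close> with
  \<open>f \<mapsto> f\<cdot>x\<close>.\<close>

lemma id_iso_mem:
  assumes c: "small_category c" and X: "copresheaf c X" and x: "x \<in> Elts X"
  shows "id_iso c X x \<in> Elts (fam c (id_bicomodule c) X)"
    and "anchor (fam c (id_bicomodule c) X) (id_iso c X x) = anchor X x"
  using assms
  by (auto simp: id_iso_apply anchor_fam Elts_fam id_bicomodule_def small_category_def
      copresheafD[OF X] intro!: HomI)

text \<open>As functions of an arrow \<open>g\<close> the two sides have the values
  \<open>g\<cdot>(f\<cdot>x)\<close> and \<open>(g \<circ> f)\<cdot>x\<close>.\<close>

lemma id_iso_act: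
  assumes c: "small_category c" and X: "copresheaf c X" and x: "x \<in> Elts X"
    and f: "f \<in> Arr c" "Dom c f = anchor X x"
  shows "id_iso c X (act X f x) = act (fam c (id_bicomodule c) X) f (id_iso c X x)"
  using assms
  by (auto simp: id_iso_apply act_fam id_bicomodule_def small_category_def compose_def
      copresheafD[OF X] fun_eq_iff)

lemma id_iso_natural:
  assumes c: "small_category c" and X: "copresheaf c X" and x: "x \<in> Elts X" and h: "h \<in> Hom c X Y"
  shows "id_iso c Y (h x) = fam_map c (id_bicomodule c) X h (id_iso c X x)"
  using id_iso_mem[OF c X x] HomD[OF h] x
  by (auto simp: id_iso_apply fam_map_apply id_bicomodule_def compose_def fun_eq_iff)

section \<open>The equivalence relation on pairs of directions of a composite\<close>

lemma equiv_comp_rel: "equiv (comp_pairs p q K) (comp_rel d p q K)"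
proof (rule equivI)
  show "refl_on (comp_pairs p q K) (comp_rel d p q K)"
    by (auto simp: refl_on_def comp_rel_def)
  show "sym (comp_rel d p q K)"
    unfolding comp_rel_def
    by (intro sym_Int sym_rtrancl sym_Un_converse) (auto simp: sym_def)
  show "trans (comp_rel d p q K)"
    unfolding comp_rel_def by (intro trans_Int trans_rtrancl) (auto simp: trans_def)
qed (auto simp: comp_rel_def)

text \<open>Related pairs are joined by a zigzag of steps, so induction applies. \<open>P\<close>
  travels along the zigzag because the equation for \<open>h\<close> is conditional on it.\<close>

lemma comp_rel_invariant:
  assumes "(y, z) \<in> comp_rel d p q K"
    and "\<And>x y. (x, y) \<in> comp_step d p q K \<Longrightarrow> P x = P y \<and> (P x \<longrightarrow> h x = h y)"
  shows "P y = P z \<and> (P y \<longrightarrow> h y = h z)"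
proof -
  have "(y, z) \<in> (comp_step d p q K \<union> (comp_step d p q K)\<inverse>)\<^sup>*"
    using assms(1) by (auto simp: comp_rel_def)
  then show ?thesis by induction (use assms(2) in fastforce)+
qed

text \<open>The guard \<open>P\<close> is needed for the action of an arrow \<open>f\<close>, which is only meaningful on
  representatives over the domain of \<open>f\<close>.\<close>

lemma on_class_guarded:
  assumes z: "z \<in> comp_pairs p q K" "P z"
    and step: "\<And>x y. (x, y) \<in> comp_step d p q K \<Longrightarrow> P x = P y \<and> (P x \<longrightarrow> h x = h y)"
  shows "on_class h (comp_rel d p q K `` {z}) = h z"
proof -
  have "h ` (comp_rel d p q K `` {z}) = {h z}"
  proof (intro set_eqI iffI)
    fix w assume "w \<in> h ` (comp_rel d p q K `` {z})"
    then obtain y where "(z, y) \<in> comp_rel d p q K" "w = h y" by auto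
    then show "w \<in> {h z}" using comp_rel_invariant[of z y d p q K P h] step z(2) by auto
  qed (use equiv_class_self[OF equiv_comp_rel z(1), of d] in auto)
  then show ?thesis by (simp add: on_class_def)
qed

lemma on_class_eq:
  assumes z: "z \<in> comp_pairs p q K"
    and step: "\<And>x y. (x, y) \<in> comp_step d p q K \<Longrightarrow> h x = h y"
  shows "on_class h (comp_rel d p q K `` {z}) = h z"
  using on_class_guarded[of z p q K "\<lambda>_. True"] assms by blast

lemma comp_class_eqI:
  assumes "(x, y) \<in> comp_step d p q K" "x \<in> comp_pairs p q K" "y \<in> comp_pairs p q K"
  shows "comp_rel d p q K `` {x} = comp_rel d p q K `` {y}"
  by (rule equiv_class_eq[OF equiv_comp_rel]) (use assms in \<open>auto simp: comp_rel_def\<close>)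

lemma dir_comp_bicomodule:
  "Elts (dir (comp_bicomodule d p q) K) = comp_pairs p q K // comp_rel d p q K"
  "anchor (dir (comp_bicomodule d p q) K) = on_class (\<lambda>(a, b). anchor (dir q (snd K a)) b)"
  "act (dir (comp_bicomodule d p q) K) f =
    on_class (\<lambda>(a, b). comp_rel d p q K `` {(a, act (dir q (snd K a)) f b)})"
  by (cases K; simp add: comp_bicomodule_def)+

lemma pos_comp_bicomodule: "pos (comp_bicomodule d p q) = fam d p (pos q)"
  by (simp add: comp_bicomodule_def)

lemma mem_comp_pairs:
  "(a, b) \<in> comp_pairs p q K \<longleftrightarrow> a \<in> Elts (dir p (fst K)) \<and> b \<in> Elts (dir q (snd K a))"
  by (cases K) (simp add: comp_pairs_def)

lemma comp_stepE:
  assumes "(x, y) \<in> comp_step d p q K"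
  obtains g a b where "x = (act (dir p (fst K)) g a, b)" "y = (a, dirmap q g (snd K a) b)"
    "a \<in> Elts (dir p (fst K))" "g \<in> Arr d" "Dom d g = anchor (dir p (fst K)) a"
    "b \<in> Elts (dir q (snd K (act (dir p (fst K)) g a)))"
  using assms by (cases K) (auto simp: comp_step_def)

lemma comp_stepI:
  assumes "a \<in> Elts (dir p (fst K))" "g \<in> Arr d" "Dom d g = anchor (dir p (fst K)) a"
    "b \<in> Elts (dir q (snd K (act (dir p (fst K)) g a)))"
  shows "((act (dir p (fst K)) g a, b), (a, dirmap q g (snd K a) b)) \<in> comp_step d p q K"
  using assms by (cases K) (auto simp: comp_step_def)

lemma dir_comp_cases:
  assumes "Q \<in> Elts (dir (comp_bicomodule d p q) K)"
  obtains a b where "Q = comp_rel d p q K `` {(a, b)}" "(a, b) \<in> comp_pairs p q K"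
    "a \<in> Elts (dir p (fst K))" "b \<in> Elts (dir q (snd K a))"
  using assms unfolding dir_comp_bicomodule
  by (elim quotientE) (metis mem_comp_pairs surj_pair)

lemma class_in_dir_comp:
  "(a, b) \<in> comp_pairs p q K \<Longrightarrow>
    comp_rel d p q K `` {(a, b)} \<in> Elts (dir (comp_bicomodule d p q) K)"
  unfolding dir_comp_bicomodule by (rule quotientI)

section \<open>Directions of a composite computed on representatives\<close>

context
  fixes d :: "('e, 'g) cat" and e :: "('u, 'v) cat"
    and p :: "('o, 'f, 'e, 'g, 'i, 'a) bicomodule" and q :: "('e, 'g, 'u, 'v, 'j, 'b) bicomodule"
    and K :: "'i \<times> ('a \<Rightarrow> 'j)"
  assumes p: "copresheaf d (dir p (fst K))" and q: "bicomodule d e q"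
    and K: "snd K \<in> Hom d (dir p (fst K)) (pos q)"
begin

lemma comp_position:
  assumes "a \<in> Elts (dir p (fst K))"
  shows "snd K a \<in> Elts (pos q)" "anchor (pos q) (snd K a) = anchor (dir p (fst K)) a"
    "g \<in> Arr d \<Longrightarrow> Dom d g = anchor (dir p (fst K)) a \<Longrightarrow>
      snd K (act (dir p (fst K)) g a) = act (pos q) g (snd K a)"
  using HomD[OF K] assms by auto

lemma comp_dirmap:
  assumes "a \<in> Elts (dir p (fst K))" "g \<in> Arr d" "Dom d g = anchor (dir p (fst K)) a"
  shows "dirmap q g (snd K a) \<in> Hom e (dir q (snd K (act (dir p (fst K)) g a))) (dir q (snd K a))"
  using assms comp_position by (auto intro: bicomoduleD[OF q])

text \<open>\<open>p[I]\<close> is closed under the action and \<open>dirmap\<close> lands in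
  \<open>q[J a]\<close>; hence both ends of a step lie in the carrier, and a step gives an equality
  of classes.\<close>

lemma comp_step_pairs:
  assumes "(x, y) \<in> comp_step d p q K"
  shows "x \<in> comp_pairs p q K" "y \<in> comp_pairs p q K"
  using assms p by (auto elim!: comp_stepE simp: mem_comp_pairs copresheafD HomD(2)[OF comp_dirmap])

lemma comp_step_class:
  "(x, y) \<in> comp_step d p q K \<Longrightarrow> comp_rel d p q K `` {x} = comp_rel d p q K `` {y}"
  by (metis comp_class_eqI comp_step_pairs)

text \<open>A step changes the second coordinate by \<open>dirmap\<close>, which is a map of
  copresheaves and preserves anchors.\<close>

lemma anchor_dir_comp:
  assumes "(a, b) \<in> comp_pairs p q K"
  shows "anchor (dir (comp_bicomodule d p q) K) (comp_rel d p q K `` {(a, b)}) =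
    anchor (dir q (snd K a)) b"
  unfolding dir_comp_bicomodule
  by (subst on_class_eq[OF assms]) (auto elim!: comp_stepE simp: HomD(3)[OF comp_dirmap])

text \<open>\<open>dirmap\<close> commutes with \<open>f\<close>, so acting by \<open>f\<close> on
  both ends of a step gives a step again. The guard says that the representative lies over the
  domain of \<open>f\<close>; steps preserve it because they preserve anchors.\<close>

lemma act_dir_comp:
  assumes ab: "(a, b) \<in> comp_pairs p q K" and f: "f \<in> Arr e" "Dom e f = anchor (dir q (snd K a)) b"
  shows "act (dir (comp_bicomodule d p q) K) f (comp_rel d p q K `` {(a, b)}) =
    comp_rel d p q K `` {(a, act (dir q (snd K a)) f b)}"
  unfolding dir_comp_bicomodule
proof (subst on_class_guarded[OF ab, where P = "\<lambda>(a, b). Dom e f = anchor (dir q (snd K a)) b"])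
  fix x y assume xy: "(x, y) \<in> comp_step d p q K"
  let ?P = "\<lambda>(a, b). Dom e f = anchor (dir q (snd K a)) b"
  let ?h = "\<lambda>(a, b). comp_rel d p q K `` {(a, act (dir q (snd K a)) f b)}"
  obtain g a b where *: "x = (act (dir p (fst K)) g a, b)" "y = (a, dirmap q g (snd K a) b)"
    and a: "a \<in> Elts (dir p (fst K))" "g \<in> Arr d" "Dom d g = anchor (dir p (fst K)) a"
    and b: "b \<in> Elts (dir q (snd K (act (dir p (fst K)) g a)))"
    using xy by (elim comp_stepE)
  note H = HomD[OF comp_dirmap[OF a]]
  have "?h x = ?h y" if "?P x"
  proof -
    let ?b = "act (dir q (snd K (act (dir p (fst K)) g a))) f b"
    have J: "snd K (act (dir p (fst K)) g a) \<in> Elts (pos q)"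
      using a p by (simp add: comp_position(1) copresheafD)
    have "?b \<in> Elts (dir q (snd K (act (dir p (fst K)) g a)))"
      using that b f bicomoduleD(1)[OF q J] by (simp add: * copresheafD)
    then have "((act (dir p (fst K)) g a, ?b), (a, dirmap q g (snd K a) ?b)) \<in> comp_step d p q K"
      using a by (intro comp_stepI)
    moreover have "dirmap q g (snd K a) ?b = act (dir q (snd K a)) f (dirmap q g (snd K a) b)"
      using H(4)[OF b f(1)] that by (simp add: *)
    ultimately show ?thesis using comp_step_class by (simp add: *)
  qed
  then show "?P x = ?P y \<and> (?P x \<longrightarrow> ?h x = ?h y)"
    using H(3)[OF b] by (auto simp: *)
qed (use f in auto)

end

section \<open>The isomorphism between an iterated functor and the functor of the composite\<close>

context
  fixes c :: "('o, 'f) cat" and d :: "('e, 'g) cat" and e :: "('u, 'v) cat"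
    and p :: "('o, 'f, 'e, 'g, 'i, 'a) bicomodule" and q :: "('e, 'g, 'u, 'v, 'j, 'b) bicomodule"
  assumes c: "small_category c" and d: "small_category d"
    and p: "bicomodule c d p" and q: "bicomodule d e q"
begin

text \<open>These facts unfold the equation \<open>F(g\<cdot>a) = g\<cdot>F(a)\<close>. The last one
  says that \<open>(a, b) \<mapsto> snd (F a) b\<close> agrees on both ends of a generating step, so
  it descends to classes.\<close>

lemma fam_fam_elem:
  assumes t: "(I, F) \<in> Elts (fam d p (fam e q X))" and a: "a \<in> Elts (dir p I)"
  shows "fst (F a) \<in> Elts (pos q)" "snd (F a) \<in> Hom e (dir q (fst (F a))) X"
    "anchor (pos q) (fst (F a)) = anchor (dir p I) a"
    "g \<in> Arr d \<Longrightarrow> Dom d g = anchor (dir p I) a \<Longrightarrow>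
      fst (F (act (dir p I) g a)) = act (pos q) g (fst (F a))"
    "g \<in> Arr d \<Longrightarrow> Dom d g = anchor (dir p I) a \<Longrightarrow>
      b \<in> Elts (dir q (fst (F (act (dir p I) g a)))) \<Longrightarrow>
      snd (F (act (dir p I) g a)) b = snd (F a) (dirmap q g (fst (F a)) b)"
proof -
  have F: "F \<in> Hom d (dir p I) (fam e q X)" using t by (simp add: Elts_fam)
  note H = HomD[OF F]
  obtain R k where [simp]: "F a = (R, k)" by force
  show "fst (F a) \<in> Elts (pos q)" "snd (F a) \<in> Hom e (dir q (fst (F a))) X"
    "anchor (pos q) (fst (F a)) = anchor (dir p I) a"
    using H(2,3)[OF a] by (auto simp: Elts_fam anchor_fam)
  show "g \<in> Arr d \<Longrightarrow> Dom d g = anchor (dir p I) a \<Longrightarrow>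
      fst (F (act (dir p I) g a)) = act (pos q) g (fst (F a))"
    "g \<in> Arr d \<Longrightarrow> Dom d g = anchor (dir p I) a \<Longrightarrow>
      b \<in> Elts (dir q (fst (F (act (dir p I) g a)))) \<Longrightarrow>
      snd (F (act (dir p I) g a)) b = snd (F a) (dirmap q g (fst (F a)) b)"
    using H(4)[OF a] by (auto simp: act_fam compose_def)
qed

lemma comp_iso_position:
  assumes t: "(I, F) \<in> Elts (fam d p (fam e q X))"
  shows "compose (Elts (dir p I)) fst F \<in> Hom d (dir p I) (pos q)"
  using bicomoduleD(1)[OF p, of I] t
  by (intro HomI) (auto simp: compose_def fam_fam_elem[OF t] copresheafD Elts_fam)

text \<open>Every direction of the composite is a class, so the values on classes determine
  \<open>k\<close>. Stating them here spares later proofs the unfolding of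
  \<open>on_class\<close>.\<close>

lemma comp_iso_apply:
  assumes t: "(I, F) \<in> Elts (fam d p (fam e q X))" and K: "K = (I, compose (Elts (dir p I)) fst F)"
  shows "\<exists>k. comp_iso d e p q X (I, F) = (K, k) \<and> k \<in> Hom e (dir (comp_bicomodule d p q) K) X \<and>
    K \<in> Elts (pos (comp_bicomodule d p q)) \<and>
    (\<forall>a b. (a, b) \<in> comp_pairs p q K \<longrightarrow> k (comp_rel d p q K `` {(a, b)}) = snd (F a) b)"
proof -
  let ?k = "\<lambda>Q\<in>Elts (dir (comp_bicomodule d p q) K). on_class (\<lambda>(a, b). snd (F a) b) Q"
  have I: "I \<in> Elts (pos p)" using t by (simp add: Elts_fam)
  have KH: "snd K \<in> Hom d (dir p (fst K)) (pos q)" using comp_iso_position[OF t] K by simp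
  have P: "copresheaf d (dir p (fst K))" using bicomoduleD(1)[OF p I] K by simp
  have sK: "snd K a = fst (F a)" if "a \<in> Elts (dir p I)" for a using that K by (simp add: compose_def)
  have k: "?k (comp_rel d p q K `` {(a, b)}) = snd (F a) b" if ab: "(a, b) \<in> comp_pairs p q K" for a b
  proof -
    have "on_class (\<lambda>(a, b). snd (F a) b) (comp_rel d p q K `` {(a, b)}) = snd (F a) b"
    proof (subst on_class_eq[OF ab])
      fix x y assume "(x, y) \<in> comp_step d p q K"
      then obtain g a b where *: "x = (act (dir p I) g a, b)" "y = (a, dirmap q g (snd K a) b)"
        and a: "a \<in> Elts (dir p I)" and g: "g \<in> Arr d" "Dom d g = anchor (dir p I) a"
        and b: "b \<in> Elts (dir q (snd K (act (dir p I) g a)))"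
        by (elim comp_stepE) (simp add: K)
      have "act (dir p I) g a \<in> Elts (dir p I)" using a g P by (simp add: K copresheafD)
      then show "(\<lambda>(a, b). snd (F a) b) x = (\<lambda>(a, b). snd (F a) b) y"
        using a b fam_fam_elem(5)[OF t a g] by (simp add: * sK)
    qed simp
    then show ?thesis using class_in_dir_comp[OF ab] by simp
  qed
  have "?k \<in> Hom e (dir (comp_bicomodule d p q) K) X"
  proof (rule HomI)
    fix Q assume Q: "Q \<in> Elts (dir (comp_bicomodule d p q) K)"
    then obtain a b where Qab: "Q = comp_rel d p q K `` {(a, b)}" and ab: "(a, b) \<in> comp_pairs p q K"
      by (elim dir_comp_cases)
    then have a: "a \<in> Elts (dir p I)" and b: "b \<in> Elts (dir q (fst (F a)))"
      using K by (auto simp: mem_comp_pairs compose_def)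
    note H = HomD[OF fam_fam_elem(2)[OF t a]]
    show "?k Q \<in> Elts X" unfolding Qab k[OF ab] using b by (rule H)
    show "anchor X (?k Q) = anchor (dir (comp_bicomodule d p q) K) Q"
      unfolding Qab k[OF ab] anchor_dir_comp[OF P q KH ab] using H(3)[OF b] a by (simp add: sK)
    fix f assume f: "f \<in> Arr e" "Dom e f = anchor (dir (comp_bicomodule d p q) K) Q"
    then have f': "Dom e f = anchor (dir q (snd K a)) b" by (simp add: Qab anchor_dir_comp[OF P q KH ab])
    have "act (dir q (snd K a)) f b \<in> Elts (dir q (snd K a))"
      using bicomoduleD(1)[OF q fam_fam_elem(1)[OF t a]] f' f b a by (simp add: sK copresheafD)
    then have "(a, act (dir q (snd K a)) f b) \<in> comp_pairs p q K"
      using a K by (simp add: mem_comp_pairs)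
    then show "?k (act (dir (comp_bicomodule d p q) K) f Q) = act X f (?k Q)"
      unfolding Qab act_dir_comp[OF P q KH ab f(1) f'] k[OF ab]
      using k H(4)[OF b f(1)] f' a by (simp add: sK)
  qed simp
  moreover have "comp_iso d e p q X (I, F) = (K, ?k)"
    using t by (simp add: comp_iso_def K Let_def)
  moreover have "K \<in> Elts (pos (comp_bicomodule d p q))"
    using I comp_iso_position[OF t] by (simp add: pos_comp_bicomodule K Elts_fam)
  ultimately show ?thesis using k by blast
qed

lemma comp_iso_mem:
  assumes t: "t \<in> Elts (fam d p (fam e q X))"
  shows "comp_iso d e p q X t \<in> Elts (fam e (comp_bicomodule d p q) X)"
    and "anchor (fam e (comp_bicomodule d p q) X) (comp_iso d e p q X t) =
      anchor (fam d p (fam e q X)) t"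
proof -
  obtain I F where IF: "t = (I, F)" by force
  obtain k where "comp_iso d e p q X t = ((I, compose (Elts (dir p I)) fst F), k)"
    "k \<in> Hom e (dir (comp_bicomodule d p q) (I, compose (Elts (dir p I)) fst F)) X"
    "(I, compose (Elts (dir p I)) fst F) \<in> Elts (pos (comp_bicomodule d p q))"
    using t comp_iso_apply IF by blast
  then show "comp_iso d e p q X t \<in> Elts (fam e (comp_bicomodule d p q) X)"
    "anchor (fam e (comp_bicomodule d p q) X) (comp_iso d e p q X t) = anchor (fam d p (fam e q X)) t"
    by (simp_all add: Elts_fam anchor_fam pos_comp_bicomodule IF)
qed

lemma comp_iso_natural:
  assumes t: "t \<in> Elts (fam d p (fam e q X))" and h: "h \<in> Hom e X Y"
  shows "comp_iso d e p q Y (fam_map d p (fam e q X) (fam_map e q X h) t) =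
    fam_map e (comp_bicomodule d p q) X h (comp_iso d e p q X t)"
proof -
  obtain I F where IF: "t = (I, F)" by force
  let ?F = "compose (Elts (dir p I)) (fam_map e q X h) F"
  have t': "fam_map d p (fam e q X) (fam_map e q X h) t = (I, ?F)"
    using t by (simp add: IF fam_map_apply)
  have F: "\<And>a. a \<in> Elts (dir p I) \<Longrightarrow> F a \<in> Elts (fam e q X)"
    using t by (auto simp: IF Elts_fam HomD(2))
  have F': "?F a = (fst (F a), compose (Elts (dir q (fst (F a)))) h (snd (F a)))"
    if "a \<in> Elts (dir p I)" for a
    using F[OF that] that by (cases "F a") (simp add: compose_def[of "Elts (dir p I)"] fam_map_apply)
  define K where K: "K = (I, compose (Elts (dir p I)) fst F)"
  \<comment> \<open>\<open>q(h)\<close> leaves the positions of \<open>q\<close> unchanged, so both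
    sides lie over the same \<open>K\<close> and only their functions on classes remain to be
    compared.\<close>
  have K': "K = (I, compose (Elts (dir p I)) fst ?F)"
    by (auto simp: K F' compose_def[of _ fst] fun_eq_iff)
  have "fam_map d p (fam e q X) (fam_map e q X h) t \<in> Elts (fam d p (fam e q Y))"
    by (rule fam_map_mem[OF p fam_map_Hom[OF d q h] t])
  then obtain k' where k': "comp_iso d e p q Y (I, ?F) = (K, k')"
    "k' \<in> Hom e (dir (comp_bicomodule d p q) K) Y" "K \<in> Elts (pos (comp_bicomodule d p q))"
    "\<And>a b. (a, b) \<in> comp_pairs p q K \<Longrightarrow> k' (comp_rel d p q K `` {(a, b)}) = snd (?F a) b"
    unfolding t' using comp_iso_apply[OF _ K'] by blast
  obtain k where k: "comp_iso d e p q X (I, F) = (K, k)"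
    "k \<in> Hom e (dir (comp_bicomodule d p q) K) X" "K \<in> Elts (pos (comp_bicomodule d p q))"
    "\<And>a b. (a, b) \<in> comp_pairs p q K \<Longrightarrow> k (comp_rel d p q K `` {(a, b)}) = snd (F a) b"
    using comp_iso_apply[OF t[unfolded IF] K] by blast
  have "k' = compose (Elts (dir (comp_bicomodule d p q) K)) h k"
  proof (rule extensionalityI[OF HomD(1)[OF k'(2)]])
    fix Q assume Q: "Q \<in> Elts (dir (comp_bicomodule d p q) K)"
    then obtain a b where ab: "Q = comp_rel d p q K `` {(a, b)}" "(a, b) \<in> comp_pairs p q K"
      by (elim dir_comp_cases)
    then have "a \<in> Elts (dir p I)" "b \<in> Elts (dir q (fst (F a)))"
      by (auto simp: mem_comp_pairs K compose_def)
    then show "k' Q = compose (Elts (dir (comp_bicomodule d p q) K)) h k Q"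
      using Q k'(4)[OF ab(2)] k(4)[OF ab(2)] F' by (simp add: ab(1) compose_def)
  qed simp
  then show ?thesis using k k' unfolding t' by (simp add: IF fam_map_apply Elts_fam)
qed

lemma comp_iso_act:
  assumes t: "t \<in> Elts (fam d p (fam e q X))"
    and f: "f \<in> Arr c" "Dom c f = anchor (fam d p (fam e q X)) t"
  shows "comp_iso d e p q X (act (fam d p (fam e q X)) f t) =
    act (fam e (comp_bicomodule d p q) X) f (comp_iso d e p q X t)"
proof -
  obtain I F where IF: "t = (I, F)" by force
  let ?I = "act (pos p) f I"
  let ?F = "compose (Elts (dir p ?I)) F (dirmap p f I)"
  have t': "act (fam d p (fam e q X)) f t = (?I, ?F)" by (simp add: IF act_fam)
  have I: "I \<in> Elts (pos p)" "Dom c f = anchor (pos p) I" using t f by (auto simp: IF Elts_fam anchor_fam)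
  note D = bicomoduleD(2)[OF p I(1) f(1) I(2)]
  have I': "?I \<in> Elts (pos p)" using I f by (simp add: copresheafD[OF bicomodule_pos[OF p]])
  define K where K: "K = (I, compose (Elts (dir p I)) fst F)"
  define K' where K': "K' = (?I, compose (Elts (dir p ?I)) fst ?F)"
  have fK: "K' = act (fam d p (pos q)) f K"
    by (auto simp: K K' act_fam compose_def fun_eq_iff HomD(2)[OF D])
  have "act (fam d p (fam e q X)) f t \<in> Elts (fam d p (fam e q X))"
    using t f by (intro copresheafD[OF copresheaf_fam[OF c p]])
  then obtain k' where k': "comp_iso d e p q X (?I, ?F) = (K', k')"
    "k' \<in> Hom e (dir (comp_bicomodule d p q) K') X" "K' \<in> Elts (pos (comp_bicomodule d p q))"
    "\<And>a b. (a, b) \<in> comp_pairs p q K' \<Longrightarrow> k' (comp_rel d p q K' `` {(a, b)}) = snd (?F a) b"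
    unfolding t' using comp_iso_apply[OF _ K'] by blast
  obtain k where k: "comp_iso d e p q X (I, F) = (K, k)"
    "k \<in> Hom e (dir (comp_bicomodule d p q) K) X" "K \<in> Elts (pos (comp_bicomodule d p q))"
    "\<And>a b. (a, b) \<in> comp_pairs p q K \<Longrightarrow> k (comp_rel d p q K `` {(a, b)}) = snd (F a) b"
    using comp_iso_apply[OF t[unfolded IF] K] by blast
  have KH: "snd K \<in> Hom d (dir p (fst K)) (pos q)" using k(3) K by (simp add: pos_comp_bicomodule Elts_fam)
  have P: "copresheaf d (dir p (fst K))" using bicomoduleD(1)[OF p I(1)] K by simp
  have sK': "snd K' a = snd K (dirmap p f I a)" if "a \<in> Elts (dir p ?I)" for a
    using that HomD(2)[OF D that] by (simp add: K K' compose_def)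
  have pairs: "(dirmap p f I a, b) \<in> comp_pairs p q K" if "(a, b) \<in> comp_pairs p q K'" for a b
    using that sK' HomD(2)[OF D] by (auto simp: mem_comp_pairs K K')
  \<comment> \<open>Well-definedness: \<open>dirmap p f I\<close> is a map of copresheaves, so it
    carries steps over \<open>K'\<close> to steps over \<open>K\<close>.\<close>
  have dm: "dirmap (comp_bicomodule d p q) f K (comp_rel d p q K' `` {(a, b)}) =
      comp_rel d p q K `` {(dirmap p f I a, b)}" if ab: "(a, b) \<in> comp_pairs p q K'" for a b
  proof -
    have "on_class (\<lambda>(a, b). comp_rel d p q K `` {(dirmap p f I a, b)}) (comp_rel d p q K' `` {(a, b)}) =
      comp_rel d p q K `` {(dirmap p f I a, b)}"
    proof (subst on_class_eq[OF ab])
      fix x y assume "(x, y) \<in> comp_step d p q K'"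
      then obtain g a b where *: "x = (act (dir p ?I) g a, b)" "y = (a, dirmap q g (snd K' a) b)"
        and a: "a \<in> Elts (dir p ?I)" and g: "g \<in> Arr d" "Dom d g = anchor (dir p ?I) a"
        and b: "b \<in> Elts (dir q (snd K' (act (dir p ?I) g a)))"
        by (elim comp_stepE) (simp add: K')
      have ga: "act (dir p ?I) g a \<in> Elts (dir p ?I)"
        using a g bicomoduleD(1)[OF p I'] by (simp add: copresheafD)
      have "((act (dir p (fst K)) g (dirmap p f I a), b),
          (dirmap p f I a, dirmap q g (snd K (dirmap p f I a)) b)) \<in> comp_step d p q K"
        by (rule comp_stepI) (use a g b ga HomD[OF D] in \<open>auto simp: sK' K\<close>)
      then have "((dirmap p f I (act (dir p ?I) g a), b),
          (dirmap p f I a, dirmap q g (snd K' a) b)) \<in> comp_step d p q K"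
        using HomD(4)[OF D a g] a by (simp add: sK' K)
      then show "(\<lambda>(a, b). comp_rel d p q K `` {(dirmap p f I a, b)}) x =
          (\<lambda>(a, b). comp_rel d p q K `` {(dirmap p f I a, b)}) y"
        unfolding * using comp_step_class[OF P q KH] by simp
    qed simp
    moreover have "comp_rel d p q K' `` {(a, b)} \<in> comp_pairs p q K' // comp_rel d p q K'"
      using ab by (rule quotientI)
    moreover have "fst K = I" by (simp add: K)
    ultimately show ?thesis by (simp add: comp_bicomodule_def fK[symmetric])
  qed
  have "k' = compose (Elts (dir (comp_bicomodule d p q) K')) k (dirmap (comp_bicomodule d p q) f K)"
  proof (rule extensionalityI[OF HomD(1)[OF k'(2)]])
    fix Q assume Q: "Q \<in> Elts (dir (comp_bicomodule d p q) K')"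
    then obtain a b where ab: "Q = comp_rel d p q K' `` {(a, b)}" "(a, b) \<in> comp_pairs p q K'"
      by (elim dir_comp_cases)
    then have "a \<in> Elts (dir p ?I)" by (simp add: mem_comp_pairs K')
    then show "k' Q = compose (Elts (dir (comp_bicomodule d p q) K')) k
        (dirmap (comp_bicomodule d p q) f K) Q"
      using Q k'(4)[OF ab(2)] k(4)[OF pairs[OF ab(2)]] dm[OF ab(2)] by (simp add: ab(1) compose_def)
  qed simp
  then show ?thesis using k(1) k'(1) unfolding t' IF k(1)
    by (simp add: act_fam pos_comp_bicomodule fK)
qed

end

section \<open>Units and multiplications\<close>

text \<open>The structure of the sub-copresheaf on \<open>S\<close> is carried along the injection
  \<open>\<sigma>\<close> into a possibly different type; \<open>i\<close> is the inclusion of the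
  resulting copy into \<open>X\<close>. It serves to bring small pieces of \<open>X\<close> to the
  type at which the monad laws are assumed.\<close>

lemma copresheaf_transport:
  assumes X: "copresheaf c X" and S: "S \<subseteq> Elts X"
    and closed: "\<And>x f. x \<in> S \<Longrightarrow> f \<in> Arr c \<Longrightarrow> Dom c f = anchor X x \<Longrightarrow> act X f x \<in> S"
    and \<sigma>: "inj_on \<sigma> S"
  obtains X' i where "copresheaf c X'" "i \<in> Hom c X' X" "restrict \<sigma> S \<in> Hom c (X\<lparr>Elts := S\<rparr>) X'"
    "\<And>x. x \<in> S \<Longrightarrow> i (\<sigma> x) = x"
proof
  let ?X' = "\<lparr>Elts = \<sigma> ` S, anchor = (\<lambda>y. anchor X (inv_into S \<sigma> y)),
    act = (\<lambda>f y. \<sigma> (act X f (inv_into S \<sigma> y)))\<rparr>"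
  let ?i = "\<lambda>y\<in>\<sigma> ` S. inv_into S \<sigma> y"
  have [simp]: "inv_into S \<sigma> (\<sigma> x) = x" if "x \<in> S" for x using that \<sigma> by simp
  have [simp]: "x \<in> Elts X" if "x \<in> S" for x using that S by auto
  show "copresheaf c ?X'"
    unfolding copresheaf_def using closed by (auto simp: copresheafD[OF X] inj_on_eq_iff[OF \<sigma>])
  show "?i \<in> Hom c ?X' X" by (rule HomI) (auto simp: closed inj_on_eq_iff[OF \<sigma>])
  show "restrict \<sigma> S \<in> Hom c (X\<lparr>Elts := S\<rparr>) ?X'" by (rule HomI) (auto simp: closed)
  show "\<And>x. x \<in> S \<Longrightarrow> ?i (\<sigma> x) = x" by simp
qed

text \<open>Being a map into \<open>Y\<close> constrains only values, anchors and actions; thus an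
  element of \<open>p(X)\<close> belongs to \<open>p(Y)\<close> for every part \<open>Y\<close> of
  \<open>X\<close> that contains its values.\<close>

lemma fam_restrict:
  assumes t: "t \<in> Elts (fam d p X)" and Y: "anchor Y = anchor X" "act Y = act X"
    and "\<And>a. a \<in> Elts (dir p (fst t)) \<Longrightarrow> snd t a \<in> Elts Y"
  shows "t \<in> Elts (fam d p Y)"
proof -
  obtain I k where "t = (I, k)" by force
  then show ?thesis using assms by (auto simp: Elts_fam dest: HomD intro!: HomI)
qed

text \<open>The set of elements of \<open>X\<close> does not enter these fields, which is what lets
  \<open>fam_restrict\<close> be iterated through nested layers.\<close>

lemma anchor_act_fam_restrict:
  "anchor (fam d p Y) = anchor (fam d p X)" "act (fam d p Y) = act (fam d p X)"
  by (simp_all add: fam_def)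

lemma fam_snd:
  assumes "t \<in> Elts (fam d p X)"
  shows "snd t \<in> Hom d (dir p (fst t)) X"
  using assms by (cases t) (simp add: Elts_fam)

section \<open>Unit and multiplication as natural maps of copresheaves\<close>

locale sharp_monad =
  fixes c :: "('o, 'f) cat" and m :: "('o, 'f, 'i, 'a) monad"
  assumes c: "small_category c" and m: "monad c m"
begin

lemma fun_bicomodule: "bicomodule c c (fun_of m)"
  and unit_map: "bicomodule_map c c (id_bicomodule c) (fun_of m) (unit_of m)"
  and mult_map: "bicomodule_map c c (comp_bicomodule c (fun_of m) (fun_of m)) (fun_of m) (mult_of m)"
  using m by (simp_all add: monad_def)

lemma mon_copresheaf: "copresheaf c (mon c m X)"
  by (rule copresheaf_fam[OF c fun_bicomodule])

lemma mon_map_Hom: "h \<in> Hom c X Y \<Longrightarrow> mon_map c m X h \<in> Hom c (mon c m X) (mon c m Y)"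
  by (rule fam_map_Hom[OF c fun_bicomodule])

lemma eta_apply:
  assumes "x \<in> Elts X"
  shows "eta c m X x = component c (id_bicomodule c) (fun_of m) (unit_of m) X (id_iso c X x)"
  using assms by (simp add: eta_def compose_def)

lemma mu_apply:
  assumes "t \<in> Elts (mon c m (mon c m X))"
  shows "mu c m X t = component c (comp_bicomodule c (fun_of m) (fun_of m)) (fun_of m) (mult_of m) X
    (comp_iso c c (fun_of m) (fun_of m) X t)"
  using assms by (simp add: mu_def compose_def)

lemma eta_Hom:
  assumes X: "copresheaf c X"
  shows "eta c m X \<in> Hom c X (mon c m X)"
proof (rule HomI)
  fix x assume x: "x \<in> Elts X"
  note I = id_iso_mem[OF c X x]
  show "eta c m X x \<in> Elts (mon c m X)" "anchor (mon c m X) (eta c m X x) = anchor X x"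
    using component_mem[OF fun_bicomodule unit_map I(1)] I(2) by (simp_all add: eta_apply x)
  fix f assume f: "f \<in> Arr c" "Dom c f = anchor X x"
  have fx: "act X f x \<in> Elts X" using X x f by (simp add: copresheafD)
  show "eta c m X (act X f x) = act (mon c m X) f (eta c m X x)"
    using component_act[OF c fun_bicomodule unit_map I(1) f(1)] f(2) id_iso_act[OF c X x f] id_iso_mem(1)[OF c X fx]
    by (simp add: eta_apply x fx I(2))
qed (simp add: eta_def)

lemma eta_natural:
  assumes X: "copresheaf c X" and Y: "copresheaf c Y" and h: "h \<in> Hom c X Y" and x: "x \<in> Elts X"
  shows "eta c m Y (h x) = mon_map c m X h (eta c m X x)"
  using component_natural[OF fun_bicomodule unit_map id_iso_mem(1)[OF c X x] h] id_iso_mem(1)[OF c Y HomD(2)[OF h x]]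
    id_iso_natural[OF c X x h] x HomD(2)[OF h x] by (simp add: eta_apply)

text \<open>The membership hypothesis of \<open>component_act\<close> is met by applying
  \<open>comp_iso_mem\<close> to the element \<open>f\<cdot>t\<close> and moving \<open>f\<close>
  across the isomorphism with \<open>comp_iso_act\<close>.\<close>

lemma mu_Hom: "mu c m X \<in> Hom c (mon c m (mon c m X)) (mon c m X)"
proof (rule HomI)
  fix t assume t: "t \<in> Elts (mon c m (mon c m X))"
  note I = comp_iso_mem[OF c c fun_bicomodule fun_bicomodule t]
  show "mu c m X t \<in> Elts (mon c m X)"
    "anchor (mon c m X) (mu c m X t) = anchor (mon c m (mon c m X)) t"
    using component_mem[OF fun_bicomodule mult_map I(1)] I(2) by (simp_all add: mu_apply t)
  fix f assume f: "f \<in> Arr c" "Dom c f = anchor (mon c m (mon c m X)) t"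
  have ft: "act (mon c m (mon c m X)) f t \<in> Elts (mon c m (mon c m X))"
    by (rule copresheafD(3)[OF mon_copresheaf t f])
  show "mu c m X (act (mon c m (mon c m X)) f t) = act (mon c m X) f (mu c m X t)"
    using component_act[OF c fun_bicomodule mult_map I(1) f(1)] f(2) comp_iso_act[OF c c fun_bicomodule fun_bicomodule t f]
      comp_iso_mem(1)[OF c c fun_bicomodule fun_bicomodule ft] by (simp add: mu_apply t ft I(2))
qed (simp add: mu_def)

lemma mu_natural:
  assumes h: "h \<in> Hom c X Y" and t: "t \<in> Elts (mon c m (mon c m X))"
  shows "mu c m Y (mon_map c m (mon c m X) (mon_map c m X h) t) = mon_map c m X h (mu c m X t)"
proof -
  have t': "mon_map c m (mon c m X) (mon_map c m X h) t \<in> Elts (mon c m (mon c m Y))"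
    using HomD(2)[OF mon_map_Hom[OF mon_map_Hom[OF h]] t] .
  show ?thesis
    using component_natural[OF fun_bicomodule mult_map comp_iso_mem(1)[OF c c fun_bicomodule fun_bicomodule t] h]
      comp_iso_mem(1)[OF c c fun_bicomodule fun_bicomodule t'] comp_iso_natural[OF c c fun_bicomodule fun_bicomodule t h] t t'
    by (simp add: mu_apply)
qed

text \<open>The monad laws are assumed only for elements in the type \<open>'a \<times> 'a \<times> 'a\<close>. Every element of
  \<open>m(X)\<close> or \<open>m(m(m(X)))\<close> comes from a sub-copresheaf of \<open>X\<close> indexed by (triples of) directions,
  which has a copy in that type; naturality then transports the laws.\<close>

lemma mon_small:
  assumes X: "copresheaf c X" and t: "t \<in> Elts (mon c m X)"
  shows "\<exists>(X' :: ('o, 'f, 'a \<times> 'a \<times> 'a) copresheaf) i t'. copresheaf c X' \<and> i \<in> Hom c X' X \<and>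
    t' \<in> Elts (mon c m X') \<and> t = mon_map c m X' i t'"
proof -
  note k = HomD[OF fam_snd[OF t]]
  define S where "S = snd t ` Elts (dir (fun_of m) (fst t))"
  have D: "copresheaf c (dir (fun_of m) (fst t))"
    using t bicomoduleD(1)[OF fun_bicomodule] by (cases t) (simp add: Elts_fam)
  have S: "S \<subseteq> Elts X" using k by (auto simp: S_def)
  have closed: "act X f x \<in> S" if "x \<in> S" "f \<in> Arr c" "Dom c f = anchor X x" for x f
  proof -
    obtain a where a: "a \<in> Elts (dir (fun_of m) (fst t))" "x = snd t a" using \<open>x \<in> S\<close> by (auto simp: S_def)
    have "act (dir (fun_of m) (fst t)) f a \<in> Elts (dir (fun_of m) (fst t))"
      using a that k by (intro copresheafD(3)[OF D]) simp_all
    moreover have "act X f x = snd t (act (dir (fun_of m) (fst t)) f a)"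
      using k(4)[OF a(1) that(2)] k(3)[OF a(1)] that(3) by (simp add: a(2))
    ultimately show ?thesis by (simp add: S_def)
  qed
  \<comment> \<open>Each element of \<open>S\<close> is coded by a chosen direction at which
    \<open>t\<close> takes it as value. One layer of \<open>m\<close> uses one coordinate of the
    triple; the other two are fillers.\<close>
  let ?\<sigma> = "\<lambda>x. (inv_into (Elts (dir (fun_of m) (fst t))) (snd t) x, undefined, undefined)"
  have "inj_on ?\<sigma> S" unfolding S_def by (auto simp: inj_on_def dest: inv_into_injective)
  from copresheaf_transport[OF X S closed this]
  obtain X' :: "('o, 'f, 'a \<times> 'a \<times> 'a) copresheaf" and i where
    X': "copresheaf c X'" and i: "i \<in> Hom c X' X" and \<sigma>: "restrict ?\<sigma> S \<in> Hom c (X\<lparr>Elts := S\<rparr>) X'"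
    and i\<sigma>: "\<And>x. x \<in> S \<Longrightarrow> i (?\<sigma> x) = x" by blast
  \<comment> \<open>Seen as an element over \<open>S\<close>, \<open>t\<close> can be sent to the
    copy by \<open>\<sigma>\<close> and is recovered by \<open>i\<close>.\<close>
  have tS: "t \<in> Elts (mon c m (X\<lparr>Elts := S\<rparr>))"
    using t by (rule fam_restrict) (auto simp: S_def)
  have "mon_map c m X' i (mon_map c m (X\<lparr>Elts := S\<rparr>) (restrict ?\<sigma> S) t) =
      mon_map c m (X\<lparr>Elts := S\<rparr>) (\<lambda>x. x) t"
    by (rule fam_map_comp[OF fun_bicomodule \<sigma> tS]) (simp add: i\<sigma>)
  also have "\<dots> = t" by (rule fam_map_id[OF tS]) simp
  finally show ?thesis using X' i HomD(2)[OF mon_map_Hom[OF \<sigma>] tS] by metis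
qed

lemma mon3_small:
  assumes X: "copresheaf c X" and t: "t \<in> Elts (mon c m (mon c m (mon c m X)))"
  shows "\<exists>(X' :: ('o, 'f, 'a \<times> 'a \<times> 'a) copresheaf) i t'. copresheaf c X' \<and> i \<in> Hom c X' X \<and>
    t' \<in> Elts (mon c m (mon c m (mon c m X'))) \<and>
    t = mon_map c m (mon c m (mon c m X')) (mon_map c m (mon c m X') (mon_map c m X' i)) t'"
proof -
  let ?D = "\<lambda>I. Elts (dir (fun_of m) I)"
  \<comment> \<open>\<open>T\<close> collects the paths of directions through the three layers of
    \<open>t\<close>, and \<open>\<phi>\<close> reads off the element of \<open>X\<close> at the end
    of a path. This is where the triple in the element type comes from.\<close>
  define T where "T = {(a, b, e). a \<in> ?D (fst t) \<and> b \<in> ?D (fst (snd t a)) \<and>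
    e \<in> ?D (fst (snd (snd t a) b))}"
  define \<phi> where "\<phi> = (\<lambda>(a, b, e). snd (snd (snd t a) b) e)"
  define S where "S = \<phi> ` T"
  have t1: "snd t a \<in> Elts (mon c m (mon c m X))" if "a \<in> ?D (fst t)" for a
    using HomD(2)[OF fam_snd[OF t] that] .
  have t2: "snd (snd t a) b \<in> Elts (mon c m X)" if "a \<in> ?D (fst t)" "b \<in> ?D (fst (snd t a))" for a b
    using HomD(2)[OF fam_snd[OF t1] that(2)] that(1) .
  have S: "S \<subseteq> Elts X" using HomD(2)[OF fam_snd[OF t2]] by (auto simp: S_def T_def \<phi>_def)
  have closed: "act X f x \<in> S" if "x \<in> S" "f \<in> Arr c" "Dom c f = anchor X x" for x f
  proof -
    obtain a b e where T: "(a, b, e) \<in> T" "x = \<phi> (a, b, e)" using \<open>x \<in> S\<close> by (auto simp: S_def)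
    then have e: "e \<in> ?D (fst (snd (snd t a) b))"
      and s: "snd (snd t a) b \<in> Elts (mon c m X)" using t2 by (auto simp: T_def)
    note k = HomD[OF fam_snd[OF s]]
    have D: "copresheaf c (dir (fun_of m) (fst (snd (snd t a) b)))"
      using s bicomoduleD(1)[OF fun_bicomodule] by (cases "snd (snd t a) b") (simp add: Elts_fam)
    \<comment> \<open>An arrow moves only the innermost direction of a path, the layer that takes
      values in \<open>X\<close>.\<close>
    let ?e = "act (dir (fun_of m) (fst (snd (snd t a) b))) f e"
    have "?e \<in> ?D (fst (snd (snd t a) b))"
      using e T that k(3)[OF e] by (intro copresheafD(3)[OF D]) (simp_all add: \<phi>_def)
    then have "(a, b, ?e) \<in> T" using T by (simp add: T_def)
    moreover have "act X f x = \<phi> (a, b, ?e)"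
      using k(4)[OF e that(2)] k(3)[OF e] that(3) T by (simp add: \<phi>_def)
    ultimately show ?thesis by (simp add: S_def)
  qed
  let ?\<sigma> = "inv_into T \<phi>"
  have "inj_on ?\<sigma> S" unfolding S_def by (simp add: inj_on_inv_into)
  from copresheaf_transport[OF X S closed this]
  obtain X' :: "('o, 'f, 'a \<times> 'a \<times> 'a) copresheaf" and i where
    X': "copresheaf c X'" and i: "i \<in> Hom c X' X" and \<sigma>: "restrict ?\<sigma> S \<in> Hom c (X\<lparr>Elts := S\<rparr>) X'"
    and i\<sigma>: "\<And>x. x \<in> S \<Longrightarrow> i (?\<sigma> x) = x" by blast
  define Y where "Y = X\<lparr>Elts := S\<rparr>"
  \<comment> \<open>The restriction to \<open>Y\<close> is made layer by layer from the outside;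
    only the innermost layer uses the choice of \<open>S\<close>.\<close>
  have tS: "t \<in> Elts (mon c m (mon c m (mon c m Y)))"
    using t
  proof (rule fam_restrict[OF _ anchor_act_fam_restrict], goal_cases)
    case (1 a)
    from t1[OF this] show ?case
    proof (rule fam_restrict[OF _ anchor_act_fam_restrict], goal_cases)
      case (1 b)
      from t2[OF \<open>a \<in> _\<close> this] show ?case
        by (rule fam_restrict)
          (use 1 \<open>a \<in> _\<close> in \<open>force simp: S_def T_def \<phi>_def Y_def image_iff\<close>)+
    qed
  qed
  note s = \<sigma>[folded Y_def] mon_map_Hom[OF \<sigma>[folded Y_def]]
    mon_map_Hom[OF mon_map_Hom[OF \<sigma>[folded Y_def]]]
  let ?t = "mon_map c m (mon c m (mon c m Y)) (mon_map c m (mon c m Y) (mon_map c m Y (restrict ?\<sigma> S))) t"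
  \<comment> \<open>\<open>i\<close> undoes \<open>\<sigma>\<close> on \<open>S\<close>, and
    functoriality lifts this through one, two and finally three applications of
    \<open>m\<close>.\<close>
  have 1: "mon_map c m X' i (mon_map c m Y (restrict ?\<sigma> S) x) = x" if "x \<in> Elts (mon c m Y)" for x
    using fam_map_comp[OF fun_bicomodule s(1) that, of "\<lambda>x. x" i] i\<sigma> fam_map_id[OF that, of "\<lambda>x. x"]
    by (simp add: Y_def)
  have 2: "mon_map c m (mon c m X') (mon_map c m X' i)
      (mon_map c m (mon c m Y) (mon_map c m Y (restrict ?\<sigma> S)) x) = x"
    if "x \<in> Elts (mon c m (mon c m Y))" for x
    using fam_map_comp[OF fun_bicomodule s(2) that, of "\<lambda>x. x" "mon_map c m X' i"] 1 fam_map_id[OF that, of "\<lambda>x. x"]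
    by simp
  have "mon_map c m (mon c m (mon c m X')) (mon_map c m (mon c m X') (mon_map c m X' i)) ?t = t"
    using fam_map_comp[OF fun_bicomodule s(3) tS, of "\<lambda>x. x" "mon_map c m (mon c m X') (mon_map c m X' i)"] 2
      fam_map_id[OF tS, of "\<lambda>x. x"] by simp
  moreover have "?t \<in> Elts (mon c m (mon c m (mon c m X')))"
    by (rule HomD(2)[OF mon_map_Hom[OF s(3)] tS])
  ultimately show ?thesis using X' i by metis
qed

section \<open>The monad laws at every element type\<close>

text \<open>With \<open>t = m(i)(t')\<close>, naturality of \<open>\<eta>\<close> and
  \<open>\<mu>\<close> moves \<open>m(i)\<close> to the outside, where the law assumed for
  \<open>X'\<close> applies to \<open>t'\<close>.\<close>

lemma mu_eta:
  assumes X: "copresheaf c X" and t: "t \<in> Elts (mon c m X)"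
  shows "mu c m X (eta c m (mon c m X) t) = t"
proof -
  obtain X' :: "('o, 'f, 'a \<times> 'a \<times> 'a) copresheaf" and i t' where
    X': "copresheaf c X'" and i: "i \<in> Hom c X' X" and t': "t' \<in> Elts (mon c m X')"
    and tt': "t = mon_map c m X' i t'" using mon_small[OF X t] by blast
  have e: "eta c m (mon c m X') t' \<in> Elts (mon c m (mon c m X'))"
    by (rule HomD(2)[OF eta_Hom[OF mon_copresheaf] t'])
  have "mu c m X (eta c m (mon c m X) t) =
      mu c m X (mon_map c m (mon c m X') (mon_map c m X' i) (eta c m (mon c m X') t'))"
    by (simp add: tt' eta_natural[OF mon_copresheaf mon_copresheaf mon_map_Hom[OF i] t'])
  also have "\<dots> = mon_map c m X' i (mu c m X' (eta c m (mon c m X') t'))"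
    by (rule mu_natural[OF i e])
  also have "mu c m X' (eta c m (mon c m X') t') = t'"
    using m X' t' by (simp add: monad_def)
  finally show ?thesis by (simp add: tt')
qed

lemma mu_mon_eta:
  assumes X: "copresheaf c X" and t: "t \<in> Elts (mon c m X)"
  shows "mu c m X (mon_map c m X (eta c m X) t) = t"
proof -
  obtain X' :: "('o, 'f, 'a \<times> 'a \<times> 'a) copresheaf" and i t' where
    X': "copresheaf c X'" and i: "i \<in> Hom c X' X" and t': "t' \<in> Elts (mon c m X')"
    and tt': "t = mon_map c m X' i t'" using mon_small[OF X t] by blast
  have e: "mon_map c m X' (eta c m X') t' \<in> Elts (mon c m (mon c m X'))"
    by (rule HomD(2)[OF mon_map_Hom[OF eta_Hom[OF X']] t'])
  \<comment> \<open>By naturality of \<open>\<eta>\<close>, the function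
    \<open>\<eta> \<circ> i\<close> is also \<open>m(i) \<circ> \<eta>\<close>; the image of
    \<open>t'\<close> is factored in both ways.\<close>
  have "mon_map c m X (eta c m X) t =
      mon_map c m X' (\<lambda>x. eta c m X (i x)) t'"
    unfolding tt' by (rule fam_map_comp[OF fun_bicomodule i t']) simp
  also have "\<dots> = mon_map c m (mon c m X') (mon_map c m X' i) (mon_map c m X' (eta c m X') t')"
    by (rule fam_map_comp[OF fun_bicomodule eta_Hom[OF X'] t', symmetric]) (rule eta_natural[OF X' X i])
  finally have "mu c m X (mon_map c m X (eta c m X) t) =
      mon_map c m X' i (mu c m X' (mon_map c m X' (eta c m X') t'))"
    using mu_natural[OF i e] by simp
  also have "mu c m X' (mon_map c m X' (eta c m X') t') = t'"
    using m X' t' by (simp add: monad_def)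
  finally show ?thesis by (simp add: tt')
qed

text \<open>Here \<open>i\<close> sits three layers deep: on one side naturality of
  \<open>\<mu>\<close> is used at \<open>m(i)\<close> and then at \<open>i\<close>, on the other at
  \<open>i\<close> both inside \<open>m\<close> and outside.\<close>

lemma mu_mu:
  assumes X: "copresheaf c X" and t: "t \<in> Elts (mon c m (mon c m (mon c m X)))"
  shows "mu c m X (mu c m (mon c m X) t) = mu c m X (mon_map c m (mon c m (mon c m X)) (mu c m X) t)"
proof -
  obtain X' :: "('o, 'f, 'a \<times> 'a \<times> 'a) copresheaf" and i t' where
    X': "copresheaf c X'" and i: "i \<in> Hom c X' X"
    and t': "t' \<in> Elts (mon c m (mon c m (mon c m X')))"
    and tt': "t = mon_map c m (mon c m (mon c m X')) (mon_map c m (mon c m X') (mon_map c m X' i)) t'"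
    using mon3_small[OF X t] by blast
  note i1 = mon_map_Hom[OF i] and i2 = mon_map_Hom[OF mon_map_Hom[OF i]]
  have a: "mu c m (mon c m X') t' \<in> Elts (mon c m (mon c m X'))"
    by (rule HomD(2)[OF mu_Hom t'])
  have b: "mon_map c m (mon c m (mon c m X')) (mu c m X') t' \<in> Elts (mon c m (mon c m X'))"
    by (rule HomD(2)[OF mon_map_Hom[OF mu_Hom] t'])
  have "mu c m X (mu c m (mon c m X) t) = mon_map c m X' i (mu c m X' (mu c m (mon c m X') t'))"
    unfolding tt' by (simp add: mu_natural[OF i1 t'] mu_natural[OF i a])
  also have "mu c m X' (mu c m (mon c m X') t') =
      mu c m X' (mon_map c m (mon c m (mon c m X')) (mu c m X') t')"
    using m X' t' by (simp add: monad_def)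
  also have "mon_map c m X' i \<dots> = mu c m X (mon_map c m (mon c m X') (mon_map c m X' i)
      (mon_map c m (mon c m (mon c m X')) (mu c m X') t'))"
    by (simp add: mu_natural[OF i b])
  also have "mon_map c m (mon c m X') (mon_map c m X' i)
      (mon_map c m (mon c m (mon c m X')) (mu c m X') t') =
      mon_map c m (mon c m (mon c m X')) (\<lambda>x. mon_map c m X' i (mu c m X' x)) t'"
    by (rule fam_map_comp[OF fun_bicomodule mu_Hom t']) simp
  also have "\<dots> = mon_map c m (mon c m (mon c m X)) (mu c m X) t"
    unfolding tt' by (rule fam_map_comp[OF fun_bicomodule i2 t', symmetric]) (simp add: mu_natural[OF i])
  finally show ?thesis .
qed

section \<open>Kleisli extension\<close>

text \<open>Leaving \<open>\<psi>\<close> arbitrary makes one term serve both purposes: with an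
  algebra structure it is the induced map on a free algebra, with \<open>mu\<close> it is Kleisli
  extension, the map part of \<open>Theta_incl\<close>.\<close>

definition extension where
  "extension P \<psi> k = compose (Elts (mon c m P)) \<psi> (mon_map c m P k)"

lemma extension_apply: "t \<in> Elts (mon c m P) \<Longrightarrow> extension P \<psi> k t = \<psi> (mon_map c m P k t)"
  by (simp add: extension_def compose_def)

lemma extension_extensional: "extension P \<psi> k \<in> extensional (Elts (mon c m P))"
  by (simp add: extension_def)

lemma extension_Hom:
  assumes "\<psi> \<in> Hom c (mon c m X) X" "k \<in> Hom c P X"
  shows "extension P \<psi> k \<in> Hom c (mon c m P) X"
  unfolding extension_def by (rule Hom_compose[OF mon_copresheaf mon_map_Hom[OF assms(2)] assms(1)])

lemma algebraD:
  assumes "algebra c m (X, \<psi>)"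
  shows "copresheaf c X" "\<psi> \<in> Hom c (mon c m X) X" "x \<in> Elts X \<Longrightarrow> \<psi> (eta c m X x) = x"
    "t \<in> Elts (mon c m (mon c m X)) \<Longrightarrow> \<psi> (mu c m X t) = \<psi> (mon_map c m (mon c m X) \<psi> t)"
  using assms by (simp_all add: algebra_def)

lemma alg_homD:
  assumes "h \<in> alg_hom c m (X, \<psi>) (Y, \<chi>)"
  shows "h \<in> Hom c X Y" "t \<in> Elts (mon c m X) \<Longrightarrow> h (\<psi> t) = \<chi> (mon_map c m X h t)"
  using assms by (simp_all add: alg_hom_def)

lemma free_algebra:
  assumes X: "copresheaf c X"
  shows "algebra c m (mon c m X, mu c m X)"
  by (simp add: algebra_def mon_copresheaf mu_Hom mu_eta[OF X] mu_mu[OF X])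

text \<open>Naturality of \<open>\<mu>\<close> at \<open>k\<close> followed by the associativity law
  of \<open>\<psi>\<close>.\<close>

lemma extension_alg_hom:
  assumes A: "algebra c m (X, \<psi>)" and k: "k \<in> Hom c P X"
  shows "extension P \<psi> k \<in> alg_hom c m (free_alg c m P) (X, \<psi>)"
proof -
  note A = algebraD[OF A]
  have "extension P \<psi> k (mu c m P t) = \<psi> (mon_map c m (mon c m P) (extension P \<psi> k) t)"
    if t: "t \<in> Elts (mon c m (mon c m P))" for t
  proof -
    have t': "mon_map c m (mon c m P) (mon_map c m P k) t \<in> Elts (mon c m (mon c m X))"
      by (rule HomD(2)[OF mon_map_Hom[OF mon_map_Hom[OF k]] t])
    have "extension P \<psi> k (mu c m P t) = \<psi> (mu c m X (mon_map c m (mon c m P) (mon_map c m P k) t))"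
      by (simp add: extension_apply HomD(2)[OF mu_Hom t] mu_natural[OF k t])
    also have "\<dots> = \<psi> (mon_map c m (mon c m X) \<psi> (mon_map c m (mon c m P) (mon_map c m P k) t))"
      by (rule A(4)[OF t'])
    also have "mon_map c m (mon c m X) \<psi> (mon_map c m (mon c m P) (mon_map c m P k) t) =
        mon_map c m (mon c m P) (extension P \<psi> k) t"
      by (rule fam_map_comp[OF fun_bicomodule mon_map_Hom[OF k] t]) (rule extension_apply)
    finally show ?thesis .
  qed
  then show ?thesis using extension_Hom[OF A(2) k] by (simp add: alg_hom_def free_alg_def)
qed

text \<open>Naturality of \<open>\<eta>\<close> at \<open>k\<close> followed by the unit law of
  \<open>\<psi>\<close>.\<close>

lemma extension_eta:
  assumes A: "algebra c m (X, \<psi>)" and P: "copresheaf c P" and k: "k \<in> Hom c P X" and x: "x \<in> Elts P"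
  shows "extension P \<psi> k (eta c m P x) = k x"
  using algebraD[OF A] eta_natural[OF P _ k x, symmetric] HomD(2)[OF eta_Hom[OF P] x] HomD(2)[OF k x]
  by (simp add: extension_apply)

text \<open>\<open>h \<circ> \<chi> \<circ> m(g) = \<psi> \<circ> m(h) \<circ> m(g)\<close>. This
  rule is the source of the composition laws of both presheaves, of the action on algebra maps, and
  of the naturality of the comparison.\<close>

lemma alg_hom_extension:
  assumes h: "h \<in> alg_hom c m (Y, \<chi>) (X, \<psi>)" and g: "g \<in> Hom c P Y"
    and l: "\<And>x. x \<in> Elts P \<Longrightarrow> l x = h (g x)"
  shows "compose (Elts (mon c m P)) h (extension P \<chi> g) = extension P \<psi> l"
proof (rule extensionalityI)
  fix t assume t: "t \<in> Elts (mon c m P)"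
  have "h (\<chi> (mon_map c m P g t)) = \<psi> (mon_map c m Y h (mon_map c m P g t))"
    by (rule alg_homD(2)[OF h HomD(2)[OF mon_map_Hom[OF g] t]])
  also have "mon_map c m Y h (mon_map c m P g t) = mon_map c m P l t"
    by (rule fam_map_comp[OF fun_bicomodule g t]) (rule l)
  finally show "compose (Elts (mon c m P)) h (extension P \<chi> g) t = extension P \<psi> l t"
    using t by (simp add: compose_def extension_apply)
qed (simp_all add: extension_extensional)

text \<open>The extension of \<open>\<eta>\<close> is the identity of \<open>m(P)\<close> by
  \<open>mu_mon_eta\<close>; composing it with \<open>h\<close> and applying
  \<open>alg_hom_extension\<close> writes \<open>h\<close> as an extension.\<close>

lemma alg_hom_from_free:
  assumes P: "copresheaf c P" and h: "h \<in> alg_hom c m (free_alg c m P) (X, \<psi>)"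
    and l: "\<And>x. x \<in> Elts P \<Longrightarrow> l x = h (eta c m P x)"
  shows "h = extension P \<psi> l"
proof -
  have "extension P (mu c m P) (eta c m P) t = t" if "t \<in> Elts (mon c m P)" for t
    using that by (simp add: extension_apply mu_mon_eta[OF P])
  moreover have "h \<in> extensional (Elts (mon c m P))"
    using h HomD(1)[OF alg_homD(1)] by (auto simp: free_alg_def)
  ultimately have "h = compose (Elts (mon c m P)) h (extension P (mu c m P) (eta c m P))"
    by (intro extensionalityI[of h "Elts (mon c m P)"]) (simp_all add: compose_def)
  also have "\<dots> = extension P \<psi> l"
    using alg_hom_extension[OF h[unfolded free_alg_def] eta_Hom[OF P] l] .
  finally show ?thesis .
qed

lemma alg_hom_compose:
  assumes f: "f \<in> alg_hom c m (X, \<psi>) (Y, \<chi>)" and g: "g \<in> alg_hom c m (Y, \<chi>) (Z, \<zeta>)"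
    and X: "copresheaf c X" and \<psi>: "\<psi> \<in> Hom c (mon c m X) X"
  shows "compose (Elts X) g f \<in> alg_hom c m (X, \<psi>) (Z, \<zeta>)"
proof -
  have "compose (Elts X) g f (\<psi> t) = \<zeta> (mon_map c m X (compose (Elts X) g f) t)"
    if t: "t \<in> Elts (mon c m X)" for t
  proof -
    have "compose (Elts X) g f (\<psi> t) = \<zeta> (mon_map c m Y g (mon_map c m X f t))"
      using HomD(2)[OF \<psi> t] t HomD(2)[OF mon_map_Hom[OF alg_homD(1)[OF f]] t]
      by (simp add: compose_def alg_homD(2)[OF f] alg_homD(2)[OF g])
    also have "mon_map c m Y g (mon_map c m X f t) = mon_map c m X (compose (Elts X) g f) t"
      by (rule fam_map_comp[OF fun_bicomodule alg_homD(1)[OF f] t]) (simp add: compose_def)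
    finally show ?thesis .
  qed
  then show ?thesis
    using Hom_compose[OF X alg_homD(1)[OF f] alg_homD(1)[OF g]] by (simp add: alg_hom_def)
qed

end

locale nerve_setting = sharp_monad c m
  for c :: "('o, 'f) cat" and m :: "('o, 'f, 'i, 'a) monad" +
  fixes d :: "('e, 'g) cat" and p :: "('e, 'g, 'o, 'f, 'j, 'b) bicomodule"
  assumes d: "small_category d" and p: "bicomodule d c p"
begin

section \<open>The category of the coclosure comonad\<close>

lemma dir_copresheaf: "I \<in> Elts (pos p) \<Longrightarrow> copresheaf c (dir p I)"
  by (rule bicomoduleD(1)[OF p])

lemma L_simps:
  "pos (L_of c m p) = pos p" "dir (L_of c m p) I = fam c p (mon c m (dir p I))"
  by (simp_all add: L_of_def coclosure_def pm_def)

lemma pm_map_Hom: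
  "k \<in> Hom c X Y \<Longrightarrow> pm_map c m p X k \<in> Hom d (fam c p (mon c m X)) (fam c p (mon c m Y))"
  unfolding pm_map_def by (intro fam_map_Hom[OF d p] mon_map_Hom)

lemma u_apply:
  "(I, k) \<in> Elts (fam c p X) \<Longrightarrow> u_of c m p X (I, k) = (I, pm_map c m p (dir p I) k)"
  by (simp add: u_of_def coclosure_unit_def)

lemma u_mem:
  "(I, k) \<in> Elts (fam c p X) \<Longrightarrow>
    (I, pm_map c m p (dir p I) k) \<in> Elts (fam d (L_of c m p) (fam c p (mon c m X)))"
  by (simp add: Elts_fam L_simps pm_map_Hom)

text \<open>Acting by \<open>f\<close> precomposes with \<open>dirmap p f I\<close> before or after
  \<open>p \<circ> m\<close> is applied, so the claim is functoriality of \<open>pm_map\<close> at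
  the composite of \<open>k\<close> and \<open>dirmap p f I\<close>.\<close>

lemma u_Hom: "u_of c m p X \<in> Hom d (fam c p X) (fam d (L_of c m p) (fam c p (mon c m X)))"
proof (rule HomI)
  show "u_of c m p X \<in> extensional (Elts (fam c p X))"
    by (simp add: u_of_def coclosure_unit_def)
next
  fix t assume t: "t \<in> Elts (fam c p X)"
  obtain I k where [simp]: "t = (I, k)" by force
  have I: "I \<in> Elts (pos p)" "k \<in> Hom c (dir p I) X" using t by (simp_all add: Elts_fam)
  show "u_of c m p X t \<in> Elts (fam d (L_of c m p) (fam c p (mon c m X)))"
    "anchor (fam d (L_of c m p) (fam c p (mon c m X))) (u_of c m p X t) = anchor (fam c p X) t"
    using t u_mem by (simp_all add: u_apply anchor_fam L_simps)
  fix f assume f: "f \<in> Arr d" "Dom d f = anchor (fam c p X) t"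
  let ?J = "act (pos p) f I"
  have ft: "act (fam c p X) f t \<in> Elts (fam c p X)"
    by (rule copresheafD(3)[OF copresheaf_fam[OF d p] t f])
  have D: "dirmap p f I \<in> Hom c (dir p ?J) (dir p I)"
    using f by (intro bicomoduleD(2)[OF p I(1)]) (simp_all add: anchor_fam)
  have "pm_map c m p (dir p ?J) (compose (Elts (dir p ?J)) k (dirmap p f I)) =
      compose (Elts (fam c p (mon c m (dir p ?J)))) (pm_map c m p (dir p I) k)
        (pm_map c m p (dir p ?J) (dirmap p f I))"
  proof (rule extensionalityI)
    fix s assume s: "s \<in> Elts (fam c p (mon c m (dir p ?J)))"
    have *: "mon_map c m (dir p ?J) (compose (Elts (dir p ?J)) k (dirmap p f I)) x =
        mon_map c m (dir p I) k (mon_map c m (dir p ?J) (dirmap p f I) x)"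
      if "x \<in> Elts (mon c m (dir p ?J))" for x
      by (rule fam_map_comp[OF fun_bicomodule D that, symmetric]) (simp add: compose_def)
    have "pm_map c m p (dir p I) k (pm_map c m p (dir p ?J) (dirmap p f I) s) =
        pm_map c m p (dir p ?J) (compose (Elts (dir p ?J)) k (dirmap p f I)) s"
      unfolding pm_map_def by (rule fam_map_comp[OF p mon_map_Hom[OF D] s]) (rule *)
    then show "pm_map c m p (dir p ?J) (compose (Elts (dir p ?J)) k (dirmap p f I)) s =
      compose (Elts (fam c p (mon c m (dir p ?J)))) (pm_map c m p (dir p I) k)
        (pm_map c m p (dir p ?J) (dirmap p f I)) s"
      using s by (simp add: compose_def[of "Elts (fam c p _)"])
  qed (simp_all add: pm_map_def fam_map_def)
  then show "u_of c m p X (act (fam c p X) f t) =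
      act (fam d (L_of c m p) (fam c p (mon c m X))) f (u_of c m p X t)"
    using ft t by (simp add: u_apply act_fam L_simps)
      (simp add: L_of_def coclosure_def)
qed

lemma generic_element:
  "I \<in> Elts (pos p) \<Longrightarrow> (I, idmap (dir p I)) \<in> Elts (fam c p (dir p I))"
  by (simp add: Elts_fam Hom_idmap dir_copresheaf)

text \<open>\<open>p(\<eta>)\<close> sends the generic element \<open>(I, id)\<close> to
  \<open>(I, \<eta>)\<close>, and evaluation at the identity arrow undoes the Yoneda map
  \<open>id_iso\<close>.\<close>

lemma L_counit_arrow:
  assumes I: "I \<in> Elts (pos p)"
  shows "snd (L_counit c d m p I) (Id d (fst (L_counit c d m p I))) = (I, eta c m (dir p I))"
proof -
  let ?t = "fam_map c p (dir p I) (eta c m (dir p I)) (I, idmap (dir p I))"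
  have "compose (Elts (dir p I)) (eta c m (dir p I)) (idmap (dir p I)) = eta c m (dir p I)"
    using HomD(1)[OF eta_Hom[OF dir_copresheaf[OF I]]]
    by (intro extensionalityI[of _ "Elts (dir p I)"]) (simp_all add: compose_def)
  then have t: "?t = (I, eta c m (dir p I))"
    by (simp add: fam_map_apply generic_element I)
  then have "?t \<in> Elts (fam c p (mon c m (dir p I)))"
    by (simp add: Elts_fam I eta_Hom dir_copresheaf)
  moreover have "copresheaf d (fam c p (mon c m (dir p I)))" by (rule copresheaf_fam[OF d p])
  ultimately show ?thesis
    using d by (auto simp: L_counit_def coclosure_adjoint_def id_iso_apply pm_def t copresheafD
      small_category_def)
qed

text \<open>The generic element \<open>(I, id)\<close> is followed through the defining composite:
  the outer \<open>u\<close> acts on directions as the identity, the inner one turns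
  \<open>(J, g)\<close> into \<open>p(m(g))\<close>, and \<open>p(\<mu>)\<close> completes
  \<open>m(g)\<close> to the Kleisli extension of \<open>g\<close>.\<close>

lemma L_comult_arrow:
  assumes I: "I \<in> Elts (pos p)" and g: "(J, g) \<in> Elts (fam c p (mon c m (dir p I)))"
    and h: "(K, h) \<in> Elts (fam c p (mon c m (dir p J)))"
  shows "fst (snd (L_comult c d m p I) (J, g)) = J"
    and "snd (snd (L_comult c d m p I) (J, g)) (K, h) =
      (K, compose (Elts (dir p K)) (extension (dir p J) (mu c m (dir p I)) g) h)"
proof -
  let ?P = "dir p I" and ?l = "L_of c m p"
  let ?M = "mon c m (dir p I)"
  let ?r = "fam_map c p (mon c m ?M) (mu c m ?P)"
  have gH: "g \<in> Hom c (dir p J) ?M" "J \<in> Elts (pos p)" using g by (simp_all add: Elts_fam)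
  have hH: "h \<in> Hom c (dir p K) (mon c m (dir p J))" using h by (simp add: Elts_fam)
  have id: "idmap ?P \<in> Hom c ?P ?P" by (simp add: Hom_idmap dir_copresheaf I)
  have u1: "u_of c m p ?P (I, idmap ?P) = (I, pm_map c m p ?P (idmap ?P))"
    by (simp add: u_apply generic_element I)
  have pid: "pm_map c m p ?P (idmap ?P) (J, g) = (J, g)"
  proof -
    have "mon_map c m ?P (idmap ?P) t = t" if "t \<in> Elts ?M" for t
      using fam_map_id[OF that] by simp
    then show ?thesis unfolding pm_map_def by (intro fam_map_id[OF g])
  qed
  have u1_mem: "(I, pm_map c m p ?P (idmap ?P)) \<in> Elts (fam d ?l (fam c p ?M))"
    using pm_map_Hom[OF id] I by (simp add: Elts_fam L_simps)
  \<comment> \<open>\<open>G\<close> is the second component once the inner \<open>u\<close> has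
    been applied to every direction of the outer layer.\<close>
  define G where "G = compose (Elts (dir ?l I)) (u_of c m p ?M) (pm_map c m p ?P (idmap ?P))"
  have s2: "fam_map d ?l (fam c p ?M) (u_of c m p ?M) (I, pm_map c m p ?P (idmap ?P)) = (I, G)"
    using u1_mem by (simp add: fam_map_apply G_def)
  have I2: "(I, G) \<in> Elts (fam d ?l (fam d ?l (fam c p (mon c m ?M))))"
    using Hom_compose[OF copresheaf_fam[OF d p] pm_map_Hom[OF id] u_Hom] I
    by (simp add: Elts_fam L_simps G_def)
  have GJ: "G (J, g) = (J, pm_map c m p (dir p J) g)"
    using g pid by (simp add: G_def compose_def L_simps u_apply)
  have "snd (L_comult c d m p I) (J, g) =
      fam_map d ?l (fam c p (mon c m ?M)) ?r (J, pm_map c m p (dir p J) g)"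
    using g I2 s2 by (simp add: L_comult_def coclosure_adjoint_def Let_def u1 pm_def fam_map_apply
      compose_def[of _ _ G] L_simps GJ)
  also have "\<dots> = (J, compose (Elts (dir ?l J)) ?r (pm_map c m p (dir p J) g))"
    using u_mem[OF g] by (simp add: fam_map_apply)
  finally have *: "snd (L_comult c d m p I) (J, g) =
    (J, compose (Elts (dir ?l J)) ?r (pm_map c m p (dir p J) g))" .
  show "fst (snd (L_comult c d m p I) (J, g)) = J" by (simp add: *)
  have "snd (snd (L_comult c d m p I) (J, g)) (K, h) = ?r (pm_map c m p (dir p J) g (K, h))"
    using h by (simp add: * compose_def L_simps)
  also have "\<dots> = fam_map c p (mon c m (dir p J)) (extension (dir p J) (mu c m ?P) g) (K, h)"
    unfolding pm_map_def
    by (rule fam_map_comp[OF p mon_map_Hom[OF gH(1)] h]) (rule extension_apply)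
  finally show "snd (snd (L_comult c d m p I) (J, g)) (K, h) =
      (K, compose (Elts (dir p K)) (extension (dir p J) (mu c m (dir p I)) g) h)"
    using h by (simp add: fam_map_apply)
qed

lemma Theta_simps:
  "Obj (Theta c m p) = Elts (pos p)"
  "(I, J, g) \<in> Arr (Theta c m p) \<longleftrightarrow>
    I \<in> Elts (pos p) \<and> J \<in> Elts (pos p) \<and> g \<in> Hom c (dir p J) (mon c m (dir p I))"
  "(I, J, g) \<in> Arr (Theta c m p) \<Longrightarrow> Dom (Theta c m p) (I, J, g) = J"
  "(I, J, g) \<in> Arr (Theta c m p) \<Longrightarrow> Cod (Theta c m p) (I, J, g) = I"
  "I \<in> Elts (pos p) \<Longrightarrow> Id (Theta c m p) I = (I, I, eta c m (dir p I))"
  by (simp_all add: Theta_def Let_def)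

lemma Theta_Comp:
  assumes "(K, I, g') \<in> Arr (Theta c m p)" "(I, J, g) \<in> Arr (Theta c m p)"
  shows "Comp (Theta c m p) (K, I, g') (I, J, g) =
    (K, J, compose (Elts (dir p J)) (extension (dir p I) (mu c m (dir p K)) g') g)"
proof -
  have "g b \<in> Elts (mon c m (dir p I))" if "b \<in> Elts (dir p J)" for b
    using assms(2) that by (auto simp: Theta_simps intro: HomD(2))
  then have "(\<lambda>b\<in>Elts (dir p J). mu c m (dir p K) (mon_map c m (dir p I) g' (g b))) =
      compose (Elts (dir p J)) (extension (dir p I) (mu c m (dir p K)) g') g"
    by (simp add: compose_def extension_apply cong: restrict_cong)
  then show ?thesis using assms by (simp add: Theta_def Let_def)
qed

text \<open>An arrow out of \<open>I\<close> is the same triple \<open>(I, J, g)\<close> on both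
  sides, so the records are compared field by field, including the arguments where the operations
  are \<open>undefined\<close>.\<close>

lemma comonad_category_L:
  "comonad_category d (L_of c m p) (L_counit c d m p) (L_comult c d m p) = opposite (Theta c m p)"
proof -
  define C where "C = comonad_category d (L_of c m p) (L_counit c d m p) (L_comult c d m p)"
  let ?A = "SIGMA I : Elts (pos p). Elts (fam c p (mon c m (dir p I)))"
  have A: "Arr (Theta c m p) = ?A"
    by (auto simp: Theta_def Let_def Elts_fam)
  have "Obj C = Obj (Theta c m p)" "Arr C = ?A"
    by (simp_all add: C_def comonad_category_def Let_def L_simps Theta_simps)
  moreover have "Dom C = Cod (Theta c m p)"
    unfolding C_def comonad_category_def Let_def L_simps
    by (rule ext) (use A in \<open>auto simp: Theta_def Let_def Elts_fam\<close>)
  moreover have cod: "Cod C = Dom (Theta c m p)"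
  proof (rule ext)
    fix x :: "'j \<times> 'j \<times> ('b \<Rightarrow> 'i \<times> ('a \<Rightarrow> 'b))"
    obtain I J g where x: "x = (I, J, g)" by (metis surj_pair)
    show "Cod C x = Dom (Theta c m p) x"
    proof (cases "x \<in> ?A")
      case True
      then have I: "I \<in> Elts (pos p)" and g: "(J, g) \<in> Elts (fam c p (mon c m (dir p I)))"
        and arr: "(I, J, g) \<in> Arr (Theta c m p)"
        using A by (simp_all add: x)
      \<comment> \<open>\<open>L_comult_arrow\<close> speaks of two composable arrows; the identity
        \<open>\<eta>\<close> at \<open>J\<close> serves as the second one in order to read off the
        codomain of the first.\<close>
      have "(J, eta c m (dir p J)) \<in> Elts (fam c p (mon c m (dir p J)))"
        using g by (simp add: Elts_fam eta_Hom dir_copresheaf)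
      from L_comult_arrow(1)[OF I g this] show ?thesis
        using I g by (simp add: x C_def comonad_category_def Let_def L_simps Theta_simps(3)[OF arr])
    next
      case False
      then show ?thesis
        by (auto simp: x C_def comonad_category_def Let_def L_simps Theta_def Let_def Elts_fam)
    qed
  qed
  moreover have "Id C = Id (Theta c m p)"
    unfolding C_def comonad_category_def Let_def L_simps
    by (rule ext) (simp add: Theta_def Let_def L_counit_arrow restrict_def)
  moreover have "Comp C y x = Comp (Theta c m p) x y" for x y
  proof -
    obtain I J g where x: "x = (I, J, g)" by (metis surj_pair)
    obtain J' K h where y: "y = (J', K, h)" by (metis surj_pair)
    have C: "Comp C y x = (if y \<in> ?A \<and> x \<in> ?A \<and> J' = Cod C x
        then (I, snd (snd (L_comult c d m p I) (J, g)) (K, h)) else undefined)"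
      by (simp add: C_def comonad_category_def Let_def L_simps x y)
    show ?thesis
    proof (cases "y \<in> ?A \<and> x \<in> ?A \<and> J' = J")
      case True
      then have xy: "(I, J, g) \<in> Arr (Theta c m p)" "(J, K, h) \<in> Arr (Theta c m p)"
        using A by (auto simp: x y)
      have "Comp C y x = (I, snd (snd (L_comult c d m p I) (J, g)) (K, h))"
        unfolding C cod using True by (auto simp: x y Theta_simps(3)[OF xy(1)])
      also have "\<dots> = Comp (Theta c m p) x y"
        using True L_comult_arrow(2)[of I J g K h] Theta_Comp[OF xy] by (auto simp: x y)
      finally show ?thesis .
    next
      case False
      have "Comp C y x = undefined"
        unfolding C cod using False A by (auto simp: x y Theta_simps(3))
      moreover have "Comp (Theta c m p) x y = undefined"
        using False A by (auto simp: x y Theta_def Let_def)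
      ultimately show ?thesis by simp
    qed
  qed
  ultimately have "C = opposite (Theta c m p)"
    by (intro cat.equality) (auto simp: opposite_def A fun_eq_iff)
  then show ?thesis by (simp add: C_def)
qed

section \<open>Presheaves on the theory category\<close>

text \<open>\<open>F\<close> has values \<open>E I\<close>, with elements tagged by \<open>I\<close>, and \<open>(I, J, g)\<close>, an arrow from \<open>J\<close> to \<open>I\<close>,
  acts by \<open>r I J g: E I \<rightarrow> E J\<close>.\<close>

definition presheaf_data where
  "presheaf_data F E r \<longleftrightarrow> Elts F = (SIGMA I : Elts (pos p). E I) \<and>
    (\<forall>I\<in>Elts (pos p). \<forall>k\<in>E I. anchor F (I, k) = I) \<and>
    (\<forall>I J g. (I, J, g) \<in> Arr (Theta c m p) \<longrightarrow>
      (\<forall>k\<in>E I. act F (I, J, g) (I, k) = (J, r I J g k) \<and> r I J g k \<in> E J))"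

lemma Theta_eta: "I \<in> Elts (pos p) \<Longrightarrow> (I, I, eta c m (dir p I)) \<in> Arr (Theta c m p)"
  by (simp add: Theta_simps eta_Hom dir_copresheaf)

lemma Theta_compose:
  assumes "(I, J, g) \<in> Arr (Theta c m p)" "(J, K, h) \<in> Arr (Theta c m p)"
  shows "(I, K, compose (Elts (dir p K)) (extension (dir p J) (mu c m (dir p I)) g) h) \<in> Arr (Theta c m p)"
  using assms unfolding Theta_simps
  by (auto intro!: Hom_compose[OF dir_copresheaf _ extension_Hom[OF mu_Hom]])

text \<open>Elements carry their object as a tag, so the laws reduce to the untagged maps
  \<open>r\<close>. Both nerves are instances, with maps \<open>p[I] \<rightarrow> X\<close> or
  algebra maps \<open>m(p[I]) \<rightarrow> X\<close> as \<open>E I\<close>.\<close>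

lemma presheaf_copresheaf:
  assumes F: "presheaf_data F E r"
    and id: "\<And>I k. I \<in> Elts (pos p) \<Longrightarrow> k \<in> E I \<Longrightarrow> r I I (eta c m (dir p I)) k = k"
    and comp: "\<And>I J K g h k. (I, J, g) \<in> Arr (Theta c m p) \<Longrightarrow> (J, K, h) \<in> Arr (Theta c m p) \<Longrightarrow>
      k \<in> E I \<Longrightarrow> r I K (compose (Elts (dir p K)) (extension (dir p J) (mu c m (dir p I)) g) h) k =
        r J K h (r I J g k)"
  shows "copresheaf (opposite (Theta c m p)) F"
proof -
  have E: "Elts F = (SIGMA I : Elts (pos p). E I)"
    and an: "\<And>I k. I \<in> Elts (pos p) \<Longrightarrow> k \<in> E I \<Longrightarrow> anchor F (I, k) = I"
    and act: "\<And>I J g k. (I, J, g) \<in> Arr (Theta c m p) \<Longrightarrow> k \<in> E I \<Longrightarrow>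
      act F (I, J, g) (I, k) = (J, r I J g k) \<and> r I J g k \<in> E J"
    using F by (auto simp: presheaf_data_def)
  have 1: "act F f x \<in> Elts F \<and> anchor F (act F f x) = Dom (Theta c m p) f"
    if "x \<in> Elts F" "f \<in> Arr (Theta c m p)" "Cod (Theta c m p) f = anchor F x" for x f
  proof -
    obtain I k where x: "x = (I, k)" by force
    obtain I' J g where f: "f = (I', J, g)" by (metis surj_pair)
    have k: "I \<in> Elts (pos p)" "k \<in> E I" using that by (auto simp: x E)
    have "I' = I" using that an[OF k] by (simp add: x f Theta_simps(4))
    then show ?thesis using that act[of I J g k] k an by (simp add: x f E Theta_simps)
  qed
  have 2: "act F (Id (Theta c m p) (anchor F x)) x = x" if "x \<in> Elts F" for x
  proof -
    obtain I k where x: "x = (I, k)" by force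
    have k: "I \<in> Elts (pos p)" "k \<in> E I" using that by (auto simp: x E)
    then show ?thesis using act[OF Theta_eta[OF k(1)] k(2)] id by (simp add: x an Theta_simps(5))
  qed
  have 3: "act F (Comp (Theta c m p) f g) x = act F g (act F f x)"
    if "x \<in> Elts F" "f \<in> Arr (Theta c m p)" "g \<in> Arr (Theta c m p)"
      "Cod (Theta c m p) f = anchor F x" "Cod (Theta c m p) g = Dom (Theta c m p) f" for x f g
  proof -
    obtain I k where x: "x = (I, k)" by force
    obtain I' J f' where f: "f = (I', J, f')" by (metis surj_pair)
    obtain J' K g' where g: "g = (J', K, g')" by (metis surj_pair)
    have k: "I \<in> Elts (pos p)" "k \<in> E I" using that by (auto simp: x E)
    have I: "I' = I" using that an[OF k] by (simp add: x f Theta_simps(4))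
    have J: "J' = J" using that by (simp add: f g Theta_simps(3,4))
    have fA: "(I, J, f') \<in> Arr (Theta c m p)" and gA: "(J, K, g') \<in> Arr (Theta c m p)"
      using that I J by (simp_all add: f g)
    show ?thesis
      using act[OF fA k(2)] act[OF gA] act[OF Theta_compose[OF fA gA] k(2)] comp[OF fA gA k(2)]
      by (simp add: f g x I J Theta_Comp[OF fA gA])
  qed
  have 4: "anchor F x \<in> Elts (pos p)" if "x \<in> Elts F" for x
    using that an by (auto simp: E)
  show ?thesis
    unfolding copresheaf_def using 1 2 3 4 by (simp add: opposite_def Theta_simps(1))
qed

text \<open>It covers three cases: the two nerves applied to an algebra map, and the comparison
  between them.\<close>

lemma presheaf_Hom:
  assumes F: "presheaf_data F E r" and F': "presheaf_data F' E' r'"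
    and H: "\<And>I k. I \<in> Elts (pos p) \<Longrightarrow> k \<in> E I \<Longrightarrow> H (I, k) = (I, s I k) \<and> s I k \<in> E' I"
    and ext: "H \<in> extensional (Elts F)"
    and nat: "\<And>I J g k. (I, J, g) \<in> Arr (Theta c m p) \<Longrightarrow> k \<in> E I \<Longrightarrow>
      s J (r I J g k) = r' I J g (s I k)"
  shows "H \<in> Hom (opposite (Theta c m p)) F F'"
proof (rule HomI[OF ext])
  have E: "Elts F = (SIGMA I : Elts (pos p). E I)" and E': "Elts F' = (SIGMA I : Elts (pos p). E' I)"
    and an: "\<And>I k. I \<in> Elts (pos p) \<Longrightarrow> k \<in> E I \<Longrightarrow> anchor F (I, k) = I"
    and an': "\<And>I k. I \<in> Elts (pos p) \<Longrightarrow> k \<in> E' I \<Longrightarrow> anchor F' (I, k) = I"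
    and act: "\<And>I J g k. (I, J, g) \<in> Arr (Theta c m p) \<Longrightarrow> k \<in> E I \<Longrightarrow>
      act F (I, J, g) (I, k) = (J, r I J g k) \<and> r I J g k \<in> E J"
    and act': "\<And>I J g k. (I, J, g) \<in> Arr (Theta c m p) \<Longrightarrow> k \<in> E' I \<Longrightarrow>
      act F' (I, J, g) (I, k) = (J, r' I J g k)"
    using F F' by (auto simp: presheaf_data_def)
  fix x assume x: "x \<in> Elts F"
  then obtain I k where Ik: "x = (I, k)" and I: "I \<in> Elts (pos p)" and k: "k \<in> E I" by (auto simp: E)
  show "H x \<in> Elts F'" "anchor F' (H x) = anchor F x"
    using H[OF I k] I by (simp_all add: E' Ik an an' k)
  fix f assume f: "f \<in> Arr (opposite (Theta c m p))" "Dom (opposite (Theta c m p)) f = anchor F x"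
  obtain I' J g where "f = (I', J, g)" by (metis surj_pair)
  with f have g: "f = (I, J, g)" "(I, J, g) \<in> Arr (Theta c m p)"
    by (auto simp: opposite_def Ik an I k Theta_simps(4))
  have J: "J \<in> Elts (pos p)" using g(2) by (simp add: Theta_simps)
  show "H (act F f x) = act F' f (H x)"
    using act[OF g(2) k] act'[OF g(2)] H[OF I k] H[OF J] nat[OF g(2) k] by (simp add: Ik g(1))
qed

section \<open>The nerve functors\<close>

text \<open>Functoriality of \<open>p\<close> fuses \<open>p(m(k))\<close> and
  \<open>p(\<psi>)\<close> into \<open>p\<close> of the extension of \<open>k\<close>, which acts on
  \<open>(J, g)\<close> by postcomposition.\<close>

lemma L_coaction_apply:
  assumes t: "(I, k) \<in> Elts (fam c p X)"
  shows "fst (L_coaction c d m p (X, \<psi>) (I, k)) = I"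
    and "(J, g) \<in> Elts (fam c p (mon c m (dir p I))) \<Longrightarrow>
      snd (L_coaction c d m p (X, \<psi>) (I, k)) (J, g) =
        (J, compose (Elts (dir p J)) (extension (dir p I) \<psi> k) g)"
proof -
  let ?P = "fam c p (mon c m (dir p I))"
  have k: "k \<in> Hom c (dir p I) X" using t by (simp add: Elts_fam)
  have *: "L_coaction c d m p (X, \<psi>) (I, k) =
      (I, compose (Elts ?P) (fam_map c p (mon c m X) \<psi>) (pm_map c m p (dir p I) k))"
    using t u_mem[OF t]
    by (simp add: L_coaction_def compose_def[of "Elts (fam c p X)"] u_apply pm_def fam_map_apply L_simps)
  then show "fst (L_coaction c d m p (X, \<psi>) (I, k)) = I" by simp
  assume g: "(J, g) \<in> Elts ?P"
  have "fam_map c p (mon c m X) \<psi> (pm_map c m p (dir p I) k (J, g)) =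
      fam_map c p (mon c m (dir p I)) (extension (dir p I) \<psi> k) (J, g)"
    unfolding pm_map_def by (rule fam_map_comp[OF p mon_map_Hom[OF k] g]) (rule extension_apply)
  then show "snd (L_coaction c d m p (X, \<psi>) (I, k)) (J, g) =
        (J, compose (Elts (dir p J)) (extension (dir p I) \<psi> k) g)"
    using g by (simp add: * compose_def[of "Elts (fam c p _)"] fam_map_apply)
qed

lemma N_tilde_data:
  assumes A: "algebra c m (X, \<psi>)"
  shows "presheaf_data (fst (N_tilde c d m p) (X, \<psi>)) (\<lambda>I. Hom c (dir p I) X)
    (\<lambda>I J g k. compose (Elts (dir p J)) (extension (dir p I) \<psi> k) g)"
  by (auto simp: presheaf_data_def N_tilde_def comodule_copresheaf_def Elts_fam Theta_simps
      L_coaction_apply fam_def[of c p X]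
      intro!: Hom_compose[OF dir_copresheaf] extension_Hom[OF algebraD(2)[OF A]])

text \<open>Identities act trivially by \<open>extension_eta\<close>. For composites, the extension
  of \<open>k\<close> is itself an algebra map out of a free algebra, so
  \<open>alg_hom_extension\<close> moves it inside the extension of \<open>g\<close>.\<close>

lemma N_tilde_copresheaf:
  assumes A: "algebra c m (X, \<psi>)"
  shows "copresheaf (opposite (Theta c m p)) (fst (N_tilde c d m p) (X, \<psi>))"
proof (rule presheaf_copresheaf[OF N_tilde_data[OF A]])
  fix I k assume I: "I \<in> Elts (pos p)" and k: "k \<in> Hom c (dir p I) X"
  show "compose (Elts (dir p I)) (extension (dir p I) \<psi> k) (eta c m (dir p I)) = k"
    using HomD(1)[OF k] extension_eta[OF A dir_copresheaf[OF I] k]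
    by (intro extensionalityI[of _ "Elts (dir p I)"]) (simp_all add: compose_def)
next
  fix I J K g h k
  assume g: "(I, J, g) \<in> Arr (Theta c m p)" and h: "(J, K, h) \<in> Arr (Theta c m p)"
    and k: "k \<in> Hom c (dir p I) X"
  have gH: "g \<in> Hom c (dir p J) (mon c m (dir p I))" and hH: "h \<in> Hom c (dir p K) (mon c m (dir p J))"
    using g h by (simp_all add: Theta_simps)
  have eq: "compose (Elts (mon c m (dir p J))) (extension (dir p I) \<psi> k)
      (extension (dir p J) (mu c m (dir p I)) g) =
      extension (dir p J) \<psi> (compose (Elts (dir p J)) (extension (dir p I) \<psi> k) g)"
    using extension_alg_hom[OF A k] gH
    by (intro alg_hom_extension) (simp_all add: free_alg_def compose_def)
  show "compose (Elts (dir p K)) (extension (dir p I) \<psi> k)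
      (compose (Elts (dir p K)) (extension (dir p J) (mu c m (dir p I)) g) h) =
    compose (Elts (dir p K)) (extension (dir p J) \<psi>
      (compose (Elts (dir p J)) (extension (dir p I) \<psi> k) g)) h"
    unfolding eq[symmetric] using HomD(2)[OF hH] by (simp add: compose_def fun_eq_iff)
qed

lemma Theta_incl_extension:
  "Theta_incl c m p (I, J, g) = extension (dir p J) (mu c m (dir p I)) g"
  by (simp add: Theta_incl_def extension_def)

lemma Theta_incl_alg_hom:
  assumes "(I, J, g) \<in> Arr (Theta c m p)"
  shows "extension (dir p J) (mu c m (dir p I)) g \<in>
    alg_hom c m (free_alg c m (dir p J)) (free_alg c m (dir p I))"
  using assms unfolding free_alg_def[of c m "dir p I"] Theta_simps
  by (intro extension_alg_hom[OF free_algebra[OF dir_copresheaf]]) simp_all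

lemma generalized_nerve_data:
  assumes A: "algebra c m (X, \<psi>)"
  shows "presheaf_data (fst (generalized_nerve c m p) (X, \<psi>))
    (\<lambda>I. alg_hom c m (free_alg c m (dir p I)) (X, \<psi>))
    (\<lambda>I J g h. compose (Elts (mon c m (dir p J))) h (extension (dir p J) (mu c m (dir p I)) g))"
proof -
  have "compose (Elts (mon c m (dir p J))) h (extension (dir p J) (mu c m (dir p I)) g)
      \<in> alg_hom c m (free_alg c m (dir p J)) (X, \<psi>)"
    if "(I, J, g) \<in> Arr (Theta c m p)" "h \<in> alg_hom c m (free_alg c m (dir p I)) (X, \<psi>)" for I J g h
    using alg_hom_compose[OF Theta_incl_alg_hom[OF that(1), unfolded free_alg_def]
        that(2)[unfolded free_alg_def] mon_copresheaf mu_Hom]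
    by (simp add: free_alg_def)
  then show ?thesis
    by (simp add: presheaf_data_def generalized_nerve_def Let_def Theta_incl_extension)
qed

text \<open>The content is functoriality of the inclusion of \<open>Theta\<close> into algebras:
  \<open>eq\<close> says that the extension of a Kleisli composite is the composite of the
  extensions.\<close>

lemma generalized_nerve_copresheaf:
  assumes A: "algebra c m (X, \<psi>)"
  shows "copresheaf (opposite (Theta c m p)) (fst (generalized_nerve c m p) (X, \<psi>))"
proof (rule presheaf_copresheaf[OF generalized_nerve_data[OF A]])
  fix I h assume I: "I \<in> Elts (pos p)" and h: "h \<in> alg_hom c m (free_alg c m (dir p I)) (X, \<psi>)"
  have "extension (dir p I) \<psi> (\<lambda>x. h (eta c m (dir p I) x)) = h"
    using alg_hom_from_free[OF dir_copresheaf[OF I] h] by metis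
  then show "compose (Elts (mon c m (dir p I))) h
      (extension (dir p I) (mu c m (dir p I)) (eta c m (dir p I))) = h"
    using alg_hom_extension[OF h[unfolded free_alg_def] eta_Hom[OF dir_copresheaf[OF I]]] by metis
next
  fix I J K g g' h
  assume g: "(I, J, g) \<in> Arr (Theta c m p)" and g': "(J, K, g') \<in> Arr (Theta c m p)"
    and h: "h \<in> alg_hom c m (free_alg c m (dir p I)) (X, \<psi>)"
  have g'H: "g' \<in> Hom c (dir p K) (mon c m (dir p J))"
    using g' by (simp add: Theta_simps)
  have eq: "compose (Elts (mon c m (dir p K))) (extension (dir p J) (mu c m (dir p I)) g)
      (extension (dir p K) (mu c m (dir p J)) g') =
    extension (dir p K) (mu c m (dir p I))
      (compose (Elts (dir p K)) (extension (dir p J) (mu c m (dir p I)) g) g')"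
    using Theta_incl_alg_hom[OF g] g'H
    by (intro alg_hom_extension) (simp_all add: free_alg_def compose_def)
  have "extension (dir p K) (mu c m (dir p J)) g' t \<in> Elts (mon c m (dir p J))"
    if "t \<in> Elts (mon c m (dir p K))" for t
    by (rule HomD(2)[OF extension_Hom[OF mu_Hom g'H] that])
  then show "compose (Elts (mon c m (dir p K))) h (extension (dir p K) (mu c m (dir p I))
      (compose (Elts (dir p K)) (extension (dir p J) (mu c m (dir p I)) g) g')) =
    compose (Elts (mon c m (dir p K))) (compose (Elts (mon c m (dir p J))) h
      (extension (dir p J) (mu c m (dir p I)) g)) (extension (dir p K) (mu c m (dir p J)) g')"
    unfolding eq[symmetric] by (simp add: compose_def fun_eq_iff del: split_paired_All)
qed

section \<open>The two nerves on algebra maps\<close>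

lemma Alg_simps:
  "Obj (Alg c m) = {A. algebra c m A}"
  "(A, h, B) \<in> Arr (Alg c m) \<longleftrightarrow> algebra c m A \<and> algebra c m B \<and> h \<in> alg_hom c m A B"
  "Dom (Alg c m) (A, h, B) = A" "Cod (Alg c m) (A, h, B) = B"
  "Id (Alg c m) A = (A, idmap (fst A), A)"
  "Comp (Alg c m) (B, k, C) (A, h, B') = (A, compose (Elts (fst A)) k h, C)"
  by (simp_all add: Alg_def)

text \<open>An algebra map \<open>h\<close> turns the extension of \<open>k\<close> into the
  extension of \<open>h \<circ> k\<close>; compatibility with \<open>g\<close> is then associativity
  of composition.\<close>

lemma N_tilde_map:
  assumes A: "algebra c m (X, \<psi>)" and B: "algebra c m (Y, \<chi>)"
    and h: "h \<in> alg_hom c m (X, \<psi>) (Y, \<chi>)"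
  shows "fam_map c p X h \<in> Hom (opposite (Theta c m p))
    (fst (N_tilde c d m p) (X, \<psi>)) (fst (N_tilde c d m p) (Y, \<chi>))"
proof (rule presheaf_Hom[OF N_tilde_data[OF A] N_tilde_data[OF B], where s = "\<lambda>I. compose (Elts (dir p I)) h"])
  show "fam_map c p X h (I, k) = (I, compose (Elts (dir p I)) h k) \<and>
      compose (Elts (dir p I)) h k \<in> Hom c (dir p I) Y"
    if "I \<in> Elts (pos p)" "k \<in> Hom c (dir p I) X" for I k
    using that alg_homD(1)[OF h] by (simp add: fam_map_apply Elts_fam Hom_compose dir_copresheaf)
  show "fam_map c p X h \<in> extensional (Elts (fst (N_tilde c d m p) (X, \<psi>)))"
    by (simp add: N_tilde_def comodule_copresheaf_def fam_map_def)
  fix I J g k assume g: "(I, J, g) \<in> Arr (Theta c m p)" and k: "k \<in> Hom c (dir p I) X"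
  have gH: "g \<in> Hom c (dir p J) (mon c m (dir p I))" using g by (simp add: Theta_simps)
  have eq: "compose (Elts (mon c m (dir p I))) h (extension (dir p I) \<psi> k) =
      extension (dir p I) \<chi> (compose (Elts (dir p I)) h k)"
    by (rule alg_hom_extension[OF h k]) (simp add: compose_def)
  show "compose (Elts (dir p J)) h (compose (Elts (dir p J)) (extension (dir p I) \<psi> k) g) =
      compose (Elts (dir p J)) (extension (dir p I) \<chi> (compose (Elts (dir p I)) h k)) g"
    unfolding eq[symmetric] using HomD(2)[OF gH] by (simp add: compose_def fun_eq_iff)
qed

lemma N_tilde_functor:
  "functor_to_copresheaves (Alg c m :: (('o, 'f, 'i, 'a, 'x) alg, _) cat) (opposite (Theta c m p)) (N_tilde c d m p)"
proof -
  let ?N = "fst (N_tilde c d m p) :: ('o, 'f, 'i, 'a, 'x) alg \<Rightarrow> _"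
  let ?N' = "snd (N_tilde c d m p) :: _ \<times> ('x \<Rightarrow> 'x) \<times> _ \<Rightarrow> _"
  have E: "Elts (?N A) = Elts (fam c p (fst A))" for A
    by (simp add: N_tilde_def comodule_copresheaf_def)
  have S: "?N' (A, h, B) = fam_map c p (fst A) h" for A h B
    by (simp add: N_tilde_def)
  have 1: "fam_map c p X (idmap X) = idmap (fam c p X)" for X
  proof (rule extensionalityI[of _ "Elts (fam c p X)"])
    fix t assume t: "t \<in> Elts (fam c p X)"
    then show "fam_map c p X (idmap X) t = idmap (fam c p X) t"
      using fam_map_id[OF t, of "idmap X"] by simp
  qed (simp_all add: fam_map_def)
  have 2: "fam_map c p X (compose (Elts X) k h) = compose (Elts (fam c p X)) (fam_map c p Y k) (fam_map c p X h)"
    if "h \<in> Hom c X Y" for X Y h k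
  proof (rule extensionalityI[of _ "Elts (fam c p X)"])
    fix t assume t: "t \<in> Elts (fam c p X)"
    then show "fam_map c p X (compose (Elts X) k h) t =
        compose (Elts (fam c p X)) (fam_map c p Y k) (fam_map c p X h) t"
      using fam_map_comp[OF p that t, of "compose (Elts X) k h" k]
      by (simp add: compose_def[of "Elts (fam c p X)"] compose_def[of "Elts X"])
  qed (simp_all add: fam_map_def)
  have id: "?N' (A, idmap (fst A), A) = idmap (?N A)" for A
    by (simp add: S 1 E)
  have comp: "?N' (A, compose (Elts (fst A)) k l, C) = compose (Elts (?N A)) (?N' (B, k, C)) (?N' (A, l, B))"
    if "l \<in> alg_hom c m A B" for A k l B C
  proof -
    have "l \<in> Hom c (fst A) (fst B)" using that by (auto simp: alg_hom_def split: prod.splits)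
    from 2[OF this] show ?thesis by (simp add: S E)
  qed
  have "functor_to_copresheaves (Alg c m :: (('o, 'f, 'i, 'a, 'x) alg, _) cat)
      (opposite (Theta c m p)) (?N, ?N')"
    unfolding functor_to_copresheaves_def prod.case
  proof (intro conjI ballI impI)
    fix A :: "('o, 'f, 'i, 'a, 'x) alg"
    assume "A \<in> Obj (Alg c m)"
    then show "copresheaf (opposite (Theta c m p)) (?N A)"
      using N_tilde_copresheaf by (cases A) (simp add: Alg_simps)
  next
    fix f :: "('o, 'f, 'i, 'a, 'x) alg \<times> ('x \<Rightarrow> 'x) \<times> ('o, 'f, 'i, 'a, 'x) alg"
    obtain X \<psi> h Y \<chi> where f: "f = ((X, \<psi>), h, (Y, \<chi>))" by (metis surj_pair)
    assume "f \<in> Arr (Alg c m)"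
    then show "?N' f \<in> Hom (opposite (Theta c m p)) (?N (Dom (Alg c m) f)) (?N (Cod (Alg c m) f))"
      using N_tilde_map[of X \<psi> Y \<chi> h] by (simp add: f Alg_simps S)
  next
    fix A :: "('o, 'f, 'i, 'a, 'x) alg"
    show "?N' (Id (Alg c m) A) = idmap (?N A)" by (simp add: Alg_simps id)
  next
    fix f g :: "('o, 'f, 'i, 'a, 'x) alg \<times> ('x \<Rightarrow> 'x) \<times> ('o, 'f, 'i, 'a, 'x) alg"
    obtain A h B where f: "f = (A, h, B)" by (metis surj_pair)
    obtain B' k C where g: "g = (B', k, C)" by (metis surj_pair)
    assume fg: "f \<in> Arr (Alg c m)" "g \<in> Arr (Alg c m)" "Dom (Alg c m) g = Cod (Alg c m) f"
    then have "h \<in> alg_hom c m A B" "B' = B" by (simp_all add: f g Alg_simps)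
    then show "?N' (Comp (Alg c m) g f) = compose (Elts (?N (Dom (Alg c m) f))) (?N' g) (?N' f)"
      using comp by (simp add: f g Alg_simps)
  qed
  then show ?thesis by simp
qed

text \<open>Algebra maps act by postcomposition and arrows of \<open>Theta\<close> by
  precomposition, so the two actions commute.\<close>

lemma generalized_nerve_map:
  assumes A: "algebra c m (X, \<psi>)" and B: "algebra c m (Y, \<chi>)"
    and k: "k \<in> alg_hom c m (X, \<psi>) (Y, \<chi>)"
  shows "snd (generalized_nerve c m p) ((X, \<psi>), k, (Y, \<chi>)) \<in> Hom (opposite (Theta c m p))
    (fst (generalized_nerve c m p) (X, \<psi>)) (fst (generalized_nerve c m p) (Y, \<chi>))"
proof (rule presheaf_Hom[OF generalized_nerve_data[OF A] generalized_nerve_data[OF B],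
      where s = "\<lambda>I. compose (Elts (mon c m (dir p I))) k"])
  fix I h assume I: "I \<in> Elts (pos p)" and h: "h \<in> alg_hom c m (free_alg c m (dir p I)) (X, \<psi>)"
  have "compose (Elts (mon c m (dir p I))) k h \<in> alg_hom c m (free_alg c m (dir p I)) (Y, \<chi>)"
    using alg_hom_compose[OF h[unfolded free_alg_def] k mon_copresheaf mu_Hom]
    by (simp add: free_alg_def)
  then show "snd (generalized_nerve c m p) ((X, \<psi>), k, (Y, \<chi>)) (I, h) =
      (I, compose (Elts (mon c m (dir p I))) k h) \<and>
    compose (Elts (mon c m (dir p I))) k h \<in> alg_hom c m (free_alg c m (dir p I)) (Y, \<chi>)"
    using I h by (simp add: generalized_nerve_def Let_def)
next
  show "snd (generalized_nerve c m p) ((X, \<psi>), k, (Y, \<chi>)) \<in>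
      extensional (Elts (fst (generalized_nerve c m p) (X, \<psi>)))"
    by (simp add: generalized_nerve_def Let_def)
next
  fix I J g h assume g: "(I, J, g) \<in> Arr (Theta c m p)"
  have gH: "g \<in> Hom c (dir p J) (mon c m (dir p I))" using g by (simp add: Theta_simps)
  have "extension (dir p J) (mu c m (dir p I)) g t \<in> Elts (mon c m (dir p I))"
    if "t \<in> Elts (mon c m (dir p J))" for t
    by (rule HomD(2)[OF extension_Hom[OF mu_Hom gH] that])
  then show "compose (Elts (mon c m (dir p J))) k (compose (Elts (mon c m (dir p J))) h
      (extension (dir p J) (mu c m (dir p I)) g)) =
    compose (Elts (mon c m (dir p J))) (compose (Elts (mon c m (dir p I))) k h)
      (extension (dir p J) (mu c m (dir p I)) g)"
    by (auto simp: compose_def fun_eq_iff)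
qed

lemma generalized_nerve_functor:
  "functor_to_copresheaves (Alg c m :: (('o, 'f, 'i, 'a, 'x) alg, _) cat) (opposite (Theta c m p)) (generalized_nerve c m p)"
proof -
  let ?G = "fst (generalized_nerve c m p) :: ('o, 'f, 'i, 'a, 'x) alg \<Rightarrow> _"
  let ?G' = "snd (generalized_nerve c m p) :: _ \<times> ('x \<Rightarrow> 'x) \<times> _ \<Rightarrow> _"
  have E: "Elts (?G A) = (SIGMA I : Elts (pos p). alg_hom c m (free_alg c m (dir p I)) A)" for A
    by (simp add: generalized_nerve_def Let_def)
  have S: "?G' (A, k, B) = (\<lambda>(I, h)\<in>Elts (?G A). (I, compose (Elts (mon c m (dir p I))) k h))" for A k B
    by (simp add: generalized_nerve_def Let_def)
  have h: "h \<in> extensional (Elts (mon c m P)) \<and> (\<forall>t\<in>Elts (mon c m P). h t \<in> Elts X)"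
    if "h \<in> alg_hom c m (free_alg c m P) (X, \<psi>)" for P X \<psi> h
    using HomD(1,2)[OF alg_homD(1)[OF that[unfolded free_alg_def]]] by simp
  have 1: "compose (Elts (mon c m P)) (idmap X) h = h"
    if "h \<in> alg_hom c m (free_alg c m P) (X, \<psi>)" for P X \<psi> h
    using h[OF that] by (intro extensionalityI[of _ "Elts (mon c m P)"]) (simp_all add: compose_def)
  have 2: "compose (Elts (mon c m P)) (compose (Elts X) k l) h =
      compose (Elts (mon c m P)) k (compose (Elts (mon c m P)) l h)"
    if "h \<in> alg_hom c m (free_alg c m P) (X, \<psi>)" for P X \<psi> h k l
    using h[OF that] by (auto simp: compose_def fun_eq_iff)
  have 3: "compose (Elts (mon c m (dir p I))) k h \<in> alg_hom c m (free_alg c m (dir p I)) (Y, \<chi>)"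
    if "h \<in> alg_hom c m (free_alg c m (dir p I)) (X, \<psi>)" "k \<in> alg_hom c m (X, \<psi>) (Y, \<chi>)"
    for I h k X \<psi> Y \<chi>
    using alg_hom_compose[OF that(1)[unfolded free_alg_def] that(2) mon_copresheaf mu_Hom]
    by (simp add: free_alg_def)
  have id: "?G' (A, idmap (fst A), A) = idmap (?G A)" for A
  proof (rule ext)
    fix x
    show "?G' (A, idmap (fst A), A) x = idmap (?G A) x"
      using 1 by (cases A) (auto simp: S E restrict_def[of _ "Sigma _ _"])
  qed
  have comp: "?G' (A, compose (Elts (fst A)) k l, C) = compose (Elts (?G A)) (?G' (B, k, C)) (?G' (A, l, B))"
    if "l \<in> alg_hom c m A B" for A k l B C
  proof (rule ext)
    fix x
    obtain X \<psi> Y \<chi> where A: "A = (X, \<psi>)" and B: "B = (Y, \<chi>)" by (metis surj_pair)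
    show "?G' (A, compose (Elts (fst A)) k l, C) x = compose (Elts (?G A)) (?G' (B, k, C)) (?G' (A, l, B)) x"
    proof (cases "x \<in> Elts (?G A)")
      case True
      then obtain I h where x: "x = (I, h)" "I \<in> Elts (pos p)"
        "h \<in> alg_hom c m (free_alg c m (dir p I)) (X, \<psi>)" by (auto simp: E A)
      have "(I, compose (Elts (mon c m (dir p I))) l h) \<in> Elts (?G B)"
        using 3[OF x(3)] x(2) that by (simp add: E A B)
      then show ?thesis
        using True 2[OF x(3)] by (simp add: S x(1) compose_def[of "Elts (?G (X, \<psi>))"] A)
    qed (simp add: S compose_def[of "Elts (?G A)"])
  qed
  have "functor_to_copresheaves (Alg c m :: (('o, 'f, 'i, 'a, 'x) alg, _) cat)
      (opposite (Theta c m p)) (?G, ?G')"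
    unfolding functor_to_copresheaves_def prod.case
  proof (intro conjI ballI impI)
    fix A :: "('o, 'f, 'i, 'a, 'x) alg"
    assume "A \<in> Obj (Alg c m)"
    then show "copresheaf (opposite (Theta c m p)) (?G A)"
      using generalized_nerve_copresheaf by (cases A) (simp add: Alg_simps)
  next
    fix f :: "('o, 'f, 'i, 'a, 'x) alg \<times> ('x \<Rightarrow> 'x) \<times> ('o, 'f, 'i, 'a, 'x) alg"
    obtain X \<psi> h Y \<chi> where f: "f = ((X, \<psi>), h, (Y, \<chi>))" by (metis surj_pair)
    assume "f \<in> Arr (Alg c m)"
    then show "?G' f \<in> Hom (opposite (Theta c m p)) (?G (Dom (Alg c m) f)) (?G (Cod (Alg c m) f))"
      using generalized_nerve_map[of X \<psi> Y \<chi> h] by (simp add: f Alg_simps)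
  next
    fix A :: "('o, 'f, 'i, 'a, 'x) alg"
    show "?G' (Id (Alg c m) A) = idmap (?G A)" by (simp add: Alg_simps id)
  next
    fix f g :: "('o, 'f, 'i, 'a, 'x) alg \<times> ('x \<Rightarrow> 'x) \<times> ('o, 'f, 'i, 'a, 'x) alg"
    obtain A h B where f: "f = (A, h, B)" by (metis surj_pair)
    obtain B' k C where g: "g = (B', k, C)" by (metis surj_pair)
    assume fg: "f \<in> Arr (Alg c m)" "g \<in> Arr (Alg c m)" "Dom (Alg c m) g = Cod (Alg c m) f"
    then have "h \<in> alg_hom c m A B" "B' = B" by (simp_all add: f g Alg_simps)
    then show "?G' (Comp (Alg c m) g f) = compose (Elts (?G (Dom (Alg c m) f))) (?G' g) (?G' f)"
      using comp by (simp add: f g Alg_simps)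
  qed
  then show ?thesis by simp
qed

section \<open>Comparison of the two nerves\<close>

text \<open>The bijection is the universal property of the free algebras \<open>m(p[I])\<close>. Its
  naturality in \<open>I\<close> and in the algebra are two instances of
  \<open>alg_hom_extension\<close>.\<close>

lemma nerve_iso:
  "naturally_isomorphic (Alg c m :: (('o, 'f, 'i, 'a, 'x) alg, _) cat) (opposite (Theta c m p))
    (N_tilde c d m p) (generalized_nerve c m p)"
proof -
  let ?N = "fst (N_tilde c d m p) :: ('o, 'f, 'i, 'a, 'x) alg \<Rightarrow> _"
  let ?N' = "snd (N_tilde c d m p) :: _ \<times> ('x \<Rightarrow> 'x) \<times> _ \<Rightarrow> _"
  let ?G = "fst (generalized_nerve c m p) :: ('o, 'f, 'i, 'a, 'x) alg \<Rightarrow> _"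
  let ?G' = "snd (generalized_nerve c m p) :: _ \<times> ('x \<Rightarrow> 'x) \<times> _ \<Rightarrow> _"
  define \<Phi> where "\<Phi> = (\<lambda>A :: ('o, 'f, 'i, 'a, 'x) alg. \<lambda>(I, k)\<in>Elts (fam c p (fst A)).
    (I, extension (dir p I) (snd A) k))"
  have EN: "Elts (?N A) = Elts (fam c p (fst A))" for A
    by (simp add: N_tilde_def comodule_copresheaf_def)
  have EG: "Elts (?G A) = (SIGMA I : Elts (pos p). alg_hom c m (free_alg c m (dir p I)) A)" for A
    by (simp add: generalized_nerve_def Let_def)
  have \<Phi>: "\<Phi> (X, \<psi>) (I, k) = (I, extension (dir p I) \<psi> k)"
    if "I \<in> Elts (pos p)" "k \<in> Hom c (dir p I) X" for X \<psi> I k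
    using that by (simp add: \<Phi>_def Elts_fam)
  have Hom: "\<Phi> (X, \<psi>) \<in> Hom (opposite (Theta c m p)) (?N (X, \<psi>)) (?G (X, \<psi>))"
    if A: "algebra c m (X, \<psi>)" for X \<psi>
  proof (rule presheaf_Hom[OF N_tilde_data[OF A] generalized_nerve_data[OF A],
        where s = "\<lambda>I. extension (dir p I) \<psi>"])
    fix I J g k assume g: "(I, J, g) \<in> Arr (Theta c m p)" and k: "k \<in> Hom c (dir p I) X"
    have gH: "g \<in> Hom c (dir p J) (mon c m (dir p I))" using g by (simp add: Theta_simps)
    show "extension (dir p J) \<psi> (compose (Elts (dir p J)) (extension (dir p I) \<psi> k) g) =
      compose (Elts (mon c m (dir p J))) (extension (dir p I) \<psi> k)
        (extension (dir p J) (mu c m (dir p I)) g)"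
      by (rule alg_hom_extension[OF extension_alg_hom[OF A k, unfolded free_alg_def] gH, symmetric])
        (simp add: compose_def)
  qed (simp_all add: \<Phi> extension_alg_hom[OF A], simp add: \<Phi>_def EN)
  have bij: "bij_betw (\<Phi> (X, \<psi>)) (Elts (?N (X, \<psi>))) (Elts (?G (X, \<psi>)))"
    if A: "algebra c m (X, \<psi>)" for X \<psi>
  \<comment> \<open>The inverse restricts an algebra map along \<open>\<eta>\<close>; the round
    trips are \<open>extension_eta\<close> and \<open>alg_hom_from_free\<close>.\<close>
  proof (rule bij_betwI[where g = "\<lambda>(I, h). (I, compose (Elts (dir p I)) h (eta c m (dir p I)))"])
    show "\<Phi> (X, \<psi>) \<in> Elts (?N (X, \<psi>)) \<rightarrow> Elts (?G (X, \<psi>))"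
      using HomD(2)[OF Hom[OF A]] by blast
    show "(\<lambda>(I, h). (I, compose (Elts (dir p I)) h (eta c m (dir p I)))) \<in>
        Elts (?G (X, \<psi>)) \<rightarrow> Elts (?N (X, \<psi>))"
      using alg_homD(1) by (auto simp: EG EN Elts_fam free_alg_def
          intro!: Hom_compose[OF dir_copresheaf eta_Hom[OF dir_copresheaf]])
    show "(\<lambda>(I, h). (I, compose (Elts (dir p I)) h (eta c m (dir p I)))) (\<Phi> (X, \<psi>) x) = x"
      if x: "x \<in> Elts (?N (X, \<psi>))" for x
    proof -
      obtain I k where Ik: "x = (I, k)" "I \<in> Elts (pos p)" "k \<in> Hom c (dir p I) X"
        using x by (cases x) (simp add: EN Elts_fam)
      have "compose (Elts (dir p I)) (extension (dir p I) \<psi> k) (eta c m (dir p I)) = k"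
        using HomD(1)[OF Ik(3)] extension_eta[OF A dir_copresheaf[OF Ik(2)] Ik(3)]
        by (intro extensionalityI[of _ "Elts (dir p I)"]) (simp_all add: compose_def)
      then show ?thesis by (simp add: Ik \<Phi>)
    qed
    show "\<Phi> (X, \<psi>) ((\<lambda>(I, h). (I, compose (Elts (dir p I)) h (eta c m (dir p I)))) y) = y"
      if y: "y \<in> Elts (?G (X, \<psi>))" for y
    proof -
      obtain I h where Ih: "y = (I, h)" "I \<in> Elts (pos p)"
        "h \<in> alg_hom c m (free_alg c m (dir p I)) (X, \<psi>)"
        using y by (auto simp: EG)
      have k: "compose (Elts (dir p I)) h (eta c m (dir p I)) \<in> Hom c (dir p I) X"
        using Hom_compose[OF dir_copresheaf eta_Hom[OF dir_copresheaf]] Ih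
          alg_homD(1)[OF Ih(3)[unfolded free_alg_def]] by blast
      have "h = extension (dir p I) \<psi> (compose (Elts (dir p I)) h (eta c m (dir p I)))"
        by (rule alg_hom_from_free[OF dir_copresheaf[OF Ih(2)] Ih(3)]) (simp add: compose_def)
      then show ?thesis by (simp add: Ih \<Phi>[OF Ih(2) k])
    qed
  qed
  have nat: "\<Phi> (Y, \<chi>) (?N' ((X, \<psi>), h, (Y, \<chi>)) x) = ?G' ((X, \<psi>), h, (Y, \<chi>)) (\<Phi> (X, \<psi>) x)"
    if A: "algebra c m (X, \<psi>)" and h: "h \<in> alg_hom c m (X, \<psi>) (Y, \<chi>)"
      and x: "x \<in> Elts (?N (X, \<psi>))" for X \<psi> Y \<chi> h x
  proof -
    obtain I k where Ik: "x = (I, k)" "I \<in> Elts (pos p)" "k \<in> Hom c (dir p I) X"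
      using x by (cases x) (simp add: EN Elts_fam)
    have "compose (Elts (dir p I)) h k \<in> Hom c (dir p I) Y"
      by (rule Hom_compose[OF dir_copresheaf[OF Ik(2)] Ik(3) alg_homD(1)[OF h]])
    moreover have "compose (Elts (mon c m (dir p I))) h (extension (dir p I) \<psi> k) =
        extension (dir p I) \<chi> (compose (Elts (dir p I)) h k)"
      by (rule alg_hom_extension[OF h Ik(3)]) (simp add: compose_def)
    ultimately show ?thesis
      using extension_alg_hom[OF A Ik(3)] Ik
      by (simp add: \<Phi> N_tilde_def generalized_nerve_def Let_def fam_map_apply Elts_fam)
  qed
  have "naturally_isomorphic (Alg c m) (opposite (Theta c m p)) (?N, ?N') (?G, ?G')"
    unfolding naturally_isomorphic_def prod.case
  proof (intro conjI exI[of _ \<Phi>])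
    show "functor_to_copresheaves (Alg c m) (opposite (Theta c m p)) (?N, ?N')"
      using N_tilde_functor by simp
    show "functor_to_copresheaves (Alg c m) (opposite (Theta c m p)) (?G, ?G')"
      using generalized_nerve_functor by simp
    show "\<forall>A\<in>Obj (Alg c m). \<Phi> A \<in> Hom (opposite (Theta c m p)) (?N A) (?G A) \<and>
        bij_betw (\<Phi> A) (Elts (?N A)) (Elts (?G A))"
      using Hom bij by (auto simp: Alg_simps)
    show "\<forall>f\<in>Arr (Alg c m). \<forall>x\<in>Elts (?N (Dom (Alg c m) f)).
        \<Phi> (Cod (Alg c m) f) (?N' f x) = ?G' f (\<Phi> (Dom (Alg c m) f) x)"
      using nat by (auto simp: Alg_simps)
  qed
  then show ?thesis by simp
qed

end

text \<open>At \<open>p = m\<close> the two definitions differ only in bound names and in how pairs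
  are matched.\<close>

lemma Weber_nerve_eq_generalized_nerve: "Weber_nerve c m = generalized_nerve c m (fun_of m)"
  by (simp add: Weber_nerve_def generalized_nerve_def Let_def case_prod_unfold)

theorem corollary4p5:
  fixes c :: "('o, 'f) cat" and d :: "('e, 'g) cat"
    and m :: "('o, 'f, 'i, 'a) monad"
    and p :: "('e, 'g, 'o, 'f, 'j, 'b) bicomodule"
  assumes "small_category c" and "small_category d" and "monad c m" and "bicomodule d c p"
  shows
    "(familial_monad c m \<longrightarrow>
       comonad_category c (L_of c m (fun_of m)) (L_counit c c m (fun_of m)) (L_comult c c m (fun_of m))
         = opposite (Weber_theory c m) \<and>
       naturally_isomorphic
         (Alg c m :: (('o, 'f, 'i, 'a, 'x) alg, _) cat) (opposite (Weber_theory c m))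
         (N_tilde c c m (fun_of m)) (Weber_nerve c m)) \<and>
     (comonad_category d (L_of c m p) (L_counit c d m p) (L_comult c d m p)
         = opposite (Theta c m p) \<and>
       naturally_isomorphic
         (Alg c m :: (('o, 'f, 'i, 'a, 'x) alg, _) cat) (opposite (Theta c m p))
         (N_tilde c d m p) (generalized_nerve c m p))"
proof -
  have M: "sharp_monad c m" using assms by (simp add: sharp_monad_def)
  interpret P: nerve_setting c m d p
    using assms M by (simp add: nerve_setting_def nerve_setting_axioms_def)
  \<comment> \<open>Part (i) is the general result at \<open>d = c\<close> and \<open>p = m\<close>;
    that the underlying functor of \<open>m\<close> is a bicomodule belongs to
    \<open>monad\<close>.\<close>
  interpret W: nerve_setting c m c "fun_of m"
    using assms M by (simp add: nerve_setting_def nerve_setting_axioms_def monad_def)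
  show ?thesis
    unfolding Weber_nerve_eq_generalized_nerve
    by (intro conjI impI P.comonad_category_L P.nerve_iso W.comonad_category_L W.nerve_iso)
qed

end
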